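(* Let $n\in\mathbb N$, $n\geq 2$, let $\alpha,\beta>0$ satisfy $\beta>n$ and $\alpha=\beta-n+1$, and let $\{\Omega_j\}_{j\in\mathbb N}$ be the sequence of bounded Lipschitz domains of $\mathbb R^n$ (cubes of side $\frac1j$ with pyramids on their upper face) constructed in the context from $\alpha$ and $\beta$. For $p>n$, the second variational Steklov eigenvalue of the $p$-Laplacian on $\Omega_j$ satisfies $$\sigma_{p,2}(\Omega_j)\geq C(p,n)\, j^{p-n}\qquad\text{for } j\in\mathbb N,$$ where $C(p,n)>0$ depends only on $p$ and $n$.
   Context: $\mathbb N$ is the set of positive integers. Construction of $\Omega_j$. Let $\alpha,\beta>0$ with $\beta>n$ and $\alpha=\beta-n+1$ (in particular $\alpha>1$), and let $j\in\mathbb N$. Let $Q_j:=\left(0,\frac1j\right)^n$, and let $m(j)=[j^{\beta-1}]+1$, where $[\cdot]$ denotes the integer part. For $(i_1,\dots,i_{n-1})\in\{0,\dots,m(j)-1\}^{n-1}$ set $c_{i_\ell}=\frac{1}{jm(j)}\left(\frac12+i_\ell\right)$, $\ell=1,\dots,n-1$, and let $$Q_{i_1,\dots,i_{n-1}}:=\left\{(x_1,\dots,x_n)\in\mathbb R^n: x_\ell\in\left(c_{i_\ell}-\tfrac{1}{2jm(j)},c_{i_\ell}+\tfrac{1}{2jm(j)}\right),\ \ell=1,\dots,n-1,\ x_n=\tfrac1j\right\},$$ an $(n-1)$-dimensional cube; the union of the closures of these cubes is the upper face $\overline Q_j\cap\{x_n=\frac1j\}$. Let $P_{i_1,\dots,i_{n-1}}$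 be the square pyramid with base $Q_{i_1,\dots,i_{n-1}}$, height $\frac{1}{j^\alpha}$ and vertex $\left(c_{i_1},\dots,c_{i_{n-1}},\frac1j+\frac{1}{j^\alpha}\right)$ (i.e., $\overline P_{i_1,\dots,i_{n-1}}$ is the convex hull of $\overline Q_{i_1,\dots,i_{n-1}}$ and this vertex). Finally $$\Omega_j:={\rm Int}\left(\overline Q_j\cup\bigcup_{i_1,\dots,i_{n-1}=0}^{m(j)-1}\overline P_{i_1,\dots,i_{n-1}}\right),$$ where ${\rm Int}$ denotes the interior. Eigenvalues. The Steklov problem for the $p$-Laplacian on a bounded Lipschitz domain $\Omega$ is $\Delta_p u={\rm div}(|\nabla u|^{p-2}\nabla u)=0$ in $\Omega$, $|\nabla u|^{p-2}\frac{\partial u}{\partial\nu}=\sigma|u|^{p-2}u$ on $\partial\Omega$, where $\frac{\partial u}{\partial\nu}$ is the outer normal derivative, understood in the weak sense: $\int_\Omega|\nabla u|^{p-2}\nabla u\cdot\nabla\phi\,dx=\sigma\int_{\partial\Omega}|u|^{p-2}u\phi\,d\sigma(x)$ for all $\phi\in W^{1,p}(\Omega)$, with $d\sigma(x)$ the $(n-1)$-dimensional measure element on $\partial\Omega$. Its variational eigenvalues are, for integers $k\ge1$, $$\sigma_{p,k}(\Omega):=\inf_{F\in\Gamma_k}\sup_{u\in F}\mathcal R_p(u),\qquad \mathcal R_p(u):=\frac{\int_{\Omega}|\nabla u|^p\,dx}{\int_{\partial\Omega}|u|^p\,d\sigma(x)},$$ where $\mathcal R_p(u)=+\infty$ if the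 denominator vanishes. Here $\Gamma_k$ is the family of all sets $F\subset W^{1,p}(\Omega)\setminus\{0\}$ such that $F$ is symmetric ($F=-F$), $F\cap\{u:\|u\|_{L^p(\partial\Omega)}=1\}$ is compact, and $\gamma(F)\geq k$, where $\gamma(F)$ is the Krasnoselskii genus $$\gamma(F):=\min\{\ell\in\mathbb N:\text{ there exists } f:F\to\mathbb R^\ell\setminus\{0\}\text{ continuous and odd}\}$$ (with $\gamma(F)=+\infty$ if no such $\ell$ exists). *)

theory Defs
  imports "HOL-Analysis.Analysis"
begin

text \<open>
  Dimension: \<open>n = CARD('n)\<close>.  The index type \<open>'n\<close> carries no order, so the vertical
  coordinate \<open>x\<^sub>n\<close> of the construction is given by a distinguished index \<open>\<kappa> :: 'n\<close>.
  Elements of \<open>L\<^sup>p\<close> and \<open>W\<^sup>1\<^sup>,\<^sup>p\<close> are represented by functions on the whole space, of which only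
  the almost-everywhere class on \<open>\<Omega>\<close> matters.
\<close>

section \<open>The surface measure\<close>

text \<open>
  The \<open>d\<close>-dimensional Hausdorff measure, normalised so as to agree with Lebesgue measure on
  \<open>d\<close>-dimensional planes.  Boundedness of the covering sets is required explicitly because
  \<^const>\<open>diameter\<close> is unspecified on unbounded sets; empty sets are treated separately because
  \<open>0 ^ 0 = 1\<close>.
\<close>

definition hausdorff_pre :: "nat \<Rightarrow> real \<Rightarrow> 'a::metric_space set \<Rightarrow> ennreal" where
  "hausdorff_pre d \<delta> A =
     (INF U \<in> {U :: nat \<Rightarrow> 'a set. A \<subseteq> (\<Union>i. U i) \<and> (\<forall>i. bounded (U i) \<and> diameter (U i) \<le> \<delta>)}.
        \<Sum>i. if U i = {} then 0
            else ennreal (unit_ball_vol (real d) * (diameter (U i) / 2) ^ d))"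

definition hausdorff_outer :: "nat \<Rightarrow> 'a::metric_space set \<Rightarrow> ennreal" where
  "hausdorff_outer d A = (SUP \<delta> \<in> {0<..}. hausdorff_pre d \<delta> A)"

definition hausdorff_measure :: "nat \<Rightarrow> 'a::metric_space measure" where
  "hausdorff_measure d = measure_of UNIV (sets borel) (hausdorff_outer d)"

definition surface_measure :: "(real^'n) set \<Rightarrow> (real^'n) measure" where
  "surface_measure \<Omega> = restrict_space (hausdorff_measure (CARD('n) - 1)) (frontier \<Omega>)"


section \<open>Sobolev spaces and traces\<close>

definition Lp_int :: "'a measure \<Rightarrow> real \<Rightarrow> ('a \<Rightarrow> 'b::real_normed_vector) \<Rightarrow> ennreal" where
  "Lp_int M p f = (\<integral>\<^sup>+x. ennreal (norm (f x) powr p) \<partial>M)"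

definition in_Lp :: "'a measure \<Rightarrow> real \<Rightarrow> ('a \<Rightarrow> 'b::real_normed_vector) \<Rightarrow> bool" where
  "in_Lp M p f \<longleftrightarrow> f \<in> borel_measurable M \<and> Lp_int M p f < \<infinity>"

definition partial_deriv :: "'n \<Rightarrow> (real^'n \<Rightarrow> real) \<Rightarrow> real^'n \<Rightarrow> real" where
  "partial_deriv i f x = frechet_derivative f (at x) (axis i 1)"

primrec Ck :: "nat \<Rightarrow> (real^'n \<Rightarrow> real) \<Rightarrow> bool" where
  "Ck 0 f \<longleftrightarrow> continuous_on UNIV f"
| "Ck (Suc k) f \<longleftrightarrow> (\<forall>x. f differentiable (at x)) \<and> (\<forall>i. Ck k (partial_deriv i f))"

definition smooth :: "(real^'n \<Rightarrow> real) \<Rightarrow> bool" where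
  "smooth f \<longleftrightarrow> (\<forall>k. Ck k f)"

text \<open>\<open>C\<^sub>c\<^sup>\<infinity>(\<Omega>)\<close>, extended by zero.\<close>

definition test_function :: "(real^'n) set \<Rightarrow> (real^'n \<Rightarrow> real) \<Rightarrow> bool" where
  "test_function \<Omega> \<phi> \<longleftrightarrow>
     smooth \<phi> \<and> compact (closure {x. \<phi> x \<noteq> 0}) \<and> closure {x. \<phi> x \<noteq> 0} \<subseteq> \<Omega>"

definition is_weak_gradient ::
    "(real^'n) set \<Rightarrow> real \<Rightarrow> (real^'n \<Rightarrow> real) \<Rightarrow> (real^'n \<Rightarrow> real^'n) \<Rightarrow> bool" where
  "is_weak_gradient \<Omega> p u g \<longleftrightarrow>
     in_Lp (lebesgue_on \<Omega>) p g \<and>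
     (\<forall>\<phi> i. test_function \<Omega> \<phi> \<longrightarrow>
        (LINT x|lebesgue_on \<Omega>. u x * partial_deriv i \<phi> x) =
        - (LINT x|lebesgue_on \<Omega>. g x $ i * \<phi> x))"

definition sobolev :: "(real^'n) set \<Rightarrow> real \<Rightarrow> (real^'n \<Rightarrow> real) set" where
  "sobolev \<Omega> p = {u. in_Lp (lebesgue_on \<Omega>) p u \<and> (\<exists>g. is_weak_gradient \<Omega> p u g)}"

definition weak_gradient ::
    "(real^'n) set \<Rightarrow> real \<Rightarrow> (real^'n \<Rightarrow> real) \<Rightarrow> real^'n \<Rightarrow> real^'n" where
  "weak_gradient \<Omega> p u = (SOME g. is_weak_gradient \<Omega> p u g)"

definition sobolev_norm :: "(real^'n) set \<Rightarrow> real \<Rightarrow> (real^'n \<Rightarrow> real) \<Rightarrow> real" where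
  "sobolev_norm \<Omega> p u =
     enn2real (Lp_int (lebesgue_on \<Omega>) p u + Lp_int (lebesgue_on \<Omega>) p (weak_gradient \<Omega> p u))
       powr (1 / p)"

text \<open>
  The topology of \<open>W\<^sup>1\<^sup>,\<^sup>p(\<Omega>)\<close>, on representatives: it does not separate functions that agree
  almost everywhere on \<open>\<Omega>\<close>, and its quotient by this relation is the norm topology.
\<close>

definition sobolev_topology :: "(real^'n) set \<Rightarrow> real \<Rightarrow> (real^'n \<Rightarrow> real) topology" where
  "sobolev_topology \<Omega> p =
     topology (\<lambda>S. S \<subseteq> sobolev \<Omega> p \<and>
       (\<forall>u\<in>S. \<exists>r>0. \<forall>v\<in>sobolev \<Omega> p. sobolev_norm \<Omega> p (\<lambda>x. v x - u x) < r \<longrightarrow> v \<in> S))"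

lemma openin_sobolev_topology:
  "openin (sobolev_topology \<Omega> p) S \<longleftrightarrow> S \<subseteq> sobolev \<Omega> p \<and>
     (\<forall>u\<in>S. \<exists>r>0. \<forall>v\<in>sobolev \<Omega> p. sobolev_norm \<Omega> p (\<lambda>x. v x - u x) < r \<longrightarrow> v \<in> S)"
    (is "_ \<longleftrightarrow> ?P S")
proof -
  have "istopology ?P"
    unfolding istopology_def
  proof (intro conjI allI impI)
    fix S T assume S: "?P S" and T: "?P T"
    show "S \<inter> T \<subseteq> sobolev \<Omega> p" using S by blast
    show "\<forall>u\<in>S \<inter> T. \<exists>r>0. \<forall>v\<in>sobolev \<Omega> p.
            sobolev_norm \<Omega> p (\<lambda>x. v x - u x) < r \<longrightarrow> v \<in> S \<inter> T"
    proof
      fix u assume u: "u \<in> S \<inter> T"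
      from S u obtain r where r: "r > 0"
        "\<forall>v\<in>sobolev \<Omega> p. sobolev_norm \<Omega> p (\<lambda>x. v x - u x) < r \<longrightarrow> v \<in> S" by blast
      from T u obtain s where s: "s > 0"
        "\<forall>v\<in>sobolev \<Omega> p. sobolev_norm \<Omega> p (\<lambda>x. v x - u x) < s \<longrightarrow> v \<in> T" by blast
      show "\<exists>r>0. \<forall>v\<in>sobolev \<Omega> p. sobolev_norm \<Omega> p (\<lambda>x. v x - u x) < r \<longrightarrow> v \<in> S \<inter> T"
        using r s by (intro exI[of _ "min r s"]) auto
    qed
  next
    fix \<K> assume K: "\<forall>S\<in>\<K>. ?P S"
    show "\<Union>\<K> \<subseteq> sobolev \<Omega> p" using K by blast
    show "\<forall>u\<in>\<Union>\<K>. \<exists>r>0. \<forall>v\<in>sobolev \<Omega> p.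
            sobolev_norm \<Omega> p (\<lambda>x. v x - u x) < r \<longrightarrow> v \<in> \<Union>\<K>"
      using K by (metis Union_iff)
  qed
  then show ?thesis
    unfolding sobolev_topology_def by (simp add: topology_inverse')
qed

lemma topspace_sobolev_topology [simp]: "topspace (sobolev_topology \<Omega> p) = sobolev \<Omega> p"
proof
  show "topspace (sobolev_topology \<Omega> p) \<subseteq> sobolev \<Omega> p"
    using openin_topspace[of "sobolev_topology \<Omega> p"] unfolding openin_sobolev_topology by blast
  have "openin (sobolev_topology \<Omega> p) (sobolev \<Omega> p)"
    unfolding openin_sobolev_topology by (auto intro: exI[of _ "1::real"])
  then show "sobolev \<Omega> p \<subseteq> topspace (sobolev_topology \<Omega> p)"
    by (rule openin_subset)
qed

text \<open>
  The trace is the continuous extension to \<open>W\<^sup>1\<^sup>,\<^sup>p(\<Omega>)\<close> of the restriction map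
  \<open>C\<^sup>\<infinity>(closure \<Omega>) \<rightarrow> L\<^sup>p(frontier \<Omega>)\<close>.  On a bounded Lipschitz domain it exists for every \<open>u\<close> and
  is unique up to null sets of the surface measure.
\<close>

definition is_trace ::
    "(real^'n) set \<Rightarrow> real \<Rightarrow> (real^'n \<Rightarrow> real) \<Rightarrow> (real^'n \<Rightarrow> real) \<Rightarrow> bool" where
  "is_trace \<Omega> p u g \<longleftrightarrow>
     in_Lp (surface_measure \<Omega>) p g \<and>
     (\<exists>v :: nat \<Rightarrow> real^'n \<Rightarrow> real.
        (\<forall>k. smooth (v k) \<and> v k \<in> sobolev \<Omega> p) \<and>
        (\<lambda>k. sobolev_norm \<Omega> p (\<lambda>x. v k x - u x)) \<longlonglongrightarrow> 0 \<and>
        (\<lambda>k. Lp_int (surface_measure \<Omega>) p (\<lambda>x. v k x - g x)) \<longlonglongrightarrow> 0)"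

definition sobolev_trace :: "(real^'n) set \<Rightarrow> real \<Rightarrow> (real^'n \<Rightarrow> real) \<Rightarrow> real^'n \<Rightarrow> real" where
  "sobolev_trace \<Omega> p u = (SOME g. is_trace \<Omega> p u g)"

definition boundary_norm :: "(real^'n) set \<Rightarrow> real \<Rightarrow> (real^'n \<Rightarrow> real) \<Rightarrow> real" where
  "boundary_norm \<Omega> p u = enn2real (Lp_int (surface_measure \<Omega>) p (sobolev_trace \<Omega> p u)) powr (1 / p)"


section \<open>Variational Steklov eigenvalues of the \<open>p\<close>-Laplacian\<close>

definition rayleigh :: "(real^'n) set \<Rightarrow> real \<Rightarrow> (real^'n \<Rightarrow> real) \<Rightarrow> ennreal" where
  "rayleigh \<Omega> p u =
     (let b = Lp_int (surface_measure \<Omega>) p (sobolev_trace \<Omega> p u)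
      in if b = 0 then \<infinity> else Lp_int (lebesgue_on \<Omega>) p (weak_gradient \<Omega> p u) / b)"

text \<open>
  The Krasnoselskii genus of a symmetric set \<open>F\<close> of real functions, with respect to the topology
  \<open>X\<close>.  \<^term>\<open>Euclidean_space l\<close> models \<open>\<real>\<^sup>l\<close> as the sequences vanishing from index \<open>l\<close> on.  The
  infimum over the empty set is \<open>\<infinity>\<close>.
\<close>

definition genus :: "('a \<Rightarrow> real) topology \<Rightarrow> ('a \<Rightarrow> real) set \<Rightarrow> enat" where
  "genus X F =
     Inf (enat ` {l. l \<ge> 1 \<and>
       (\<exists>f. continuous_map (subtopology X F) (Euclidean_space l) f \<and>
            (\<forall>u\<in>F. f u \<noteq> (\<lambda>_. 0)) \<and>
            (\<forall>u\<in>F. f (\<lambda>x. - u x) = (\<lambda>i. - f u i)))})"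

text \<open>
  The third condition makes \<open>F\<close> a union of almost-everywhere classes, so that the members of
  \<open>Gamma\<close> correspond bijectively to the admissible sets of elements of \<open>W\<^sup>1\<^sup>,\<^sup>p(\<Omega>)\<close>.
\<close>

definition Gamma :: "(real^'n) set \<Rightarrow> real \<Rightarrow> nat \<Rightarrow> (real^'n \<Rightarrow> real) set set" where
  "Gamma \<Omega> p k = {F.
     F \<subseteq> sobolev \<Omega> p \<and>
     (\<forall>u\<in>F. \<not> (AE x in lebesgue_on \<Omega>. u x = 0)) \<and>
     (\<forall>u\<in>F. \<forall>v\<in>sobolev \<Omega> p. (AE x in lebesgue_on \<Omega>. u x = v x) \<longrightarrow> v \<in> F) \<and>
     (\<forall>u\<in>F. (\<lambda>x. - u x) \<in> F) \<and>
     compactin (sobolev_topology \<Omega> p) {u \<in> F. boundary_norm \<Omega> p u = 1} \<and>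
     genus (sobolev_topology \<Omega> p) F \<ge> enat k}"

definition steklov_eigenvalue :: "(real^'n) set \<Rightarrow> real \<Rightarrow> nat \<Rightarrow> ennreal" where
  "steklov_eigenvalue \<Omega> p k = (INF F \<in> Gamma \<Omega> p k. SUP u \<in> F. rayleigh \<Omega> p u)"


section \<open>The domains \<open>\<Omega>\<^sub>j\<close>\<close>

definition cube :: "nat \<Rightarrow> (real^'n) set" where
  "cube j = {x. \<forall>l. 0 < x $ l \<and> x $ l < 1 / real j}"

definition num_div :: "real \<Rightarrow> nat \<Rightarrow> nat" where
  "num_div \<beta> j = nat \<lfloor>real j powr (\<beta> - 1)\<rfloor> + 1"

definition centre :: "real \<Rightarrow> nat \<Rightarrow> nat \<Rightarrow> real" where
  "centre \<beta> j i = 1 / (real j * real (num_div \<beta> j)) * (1 / 2 + real i)"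

text \<open>Only the values of the multi-index \<open>i\<close> at coordinates other than \<open>\<kappa>\<close> are used.\<close>

definition pyramid_base :: "real \<Rightarrow> 'n \<Rightarrow> nat \<Rightarrow> ('n \<Rightarrow> nat) \<Rightarrow> (real^'n) set" where
  "pyramid_base \<beta> \<kappa> j i =
     {x. (\<forall>l. l \<noteq> \<kappa> \<longrightarrow>
            centre \<beta> j (i l) - 1 / (2 * real j * real (num_div \<beta> j)) < x $ l \<and>
            x $ l < centre \<beta> j (i l) + 1 / (2 * real j * real (num_div \<beta> j))) \<and>
         x $ \<kappa> = 1 / real j}"

definition pyramid_vertex :: "real \<Rightarrow> real \<Rightarrow> 'n \<Rightarrow> nat \<Rightarrow> ('n \<Rightarrow> nat) \<Rightarrow> real^'n" where
  "pyramid_vertex \<alpha> \<beta> \<kappa> j i =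
     (\<chi> l. if l = \<kappa> then 1 / real j + 1 / real j powr \<alpha> else centre \<beta> j (i l))"

definition closed_pyramid :: "real \<Rightarrow> real \<Rightarrow> 'n \<Rightarrow> nat \<Rightarrow> ('n \<Rightarrow> nat) \<Rightarrow> (real^'n) set" where
  "closed_pyramid \<alpha> \<beta> \<kappa> j i =
     convex hull (insert (pyramid_vertex \<alpha> \<beta> \<kappa> j i) (closure (pyramid_base \<beta> \<kappa> j i)))"

definition Omega :: "real \<Rightarrow> real \<Rightarrow> 'n \<Rightarrow> nat \<Rightarrow> (real^'n) set" where
  "Omega \<alpha> \<beta> \<kappa> j =
     interior (closure (cube j) \<union>
       (\<Union>i \<in> {i. \<forall>l. l \<noteq> \<kappa> \<longrightarrow> i l < num_div \<beta> j}. closed_pyramid \<alpha> \<beta> \<kappa> j i))"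

end

theory Submission
  imports Defs
begin

text \<open>
  Write \<open>L = 1/j\<close> and \<open>Q = (0, L)\<^sup>n\<close>.  The mean value over \<open>Q\<close> is a continuous odd functional on
  \<open>W\<^sup>1\<^sup>,\<^sup>p(\<Omega>\<^sub>j)\<close>.  If it had no zero on a symmetric set \<open>F\<close>, it would map \<open>F\<close> oddly into the
  punctured line and the genus of \<open>F\<close> would be at most 1; so every \<open>F\<close> admitted for the second
  eigenvalue contains a function \<open>u\<close> with mean value zero over \<open>Q\<close>
  (\<open>genus_ge_2_imp_mean_zero\<close>).  It suffices to bound the Rayleigh quotient of such a \<open>u\<close> from
  below, that is, to prove
    \<open>\<integral>\<^bsub>\<partial>\<Omega>\<^esub> |u|\<^sup>p \<le> C j\<^bsup>n-p\<^esup> \<integral>\<^bsub>\<Omega>\<^esub> |\<nabla>u|\<^sup>p\<close>.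

  For a continuously differentiable \<open>u\<close> this needs only integrals along segments.  The domain is the
  region below the graph of a function with values in \<open>[L, 2L]\<close> over an \<open>(n-1)\<close>-dimensional cube
  of side \<open>L\<close>, because the height \<open>j\<^bsup>-\<alpha>\<^esup>\<close> of the pyramids is at most \<open>L\<close>; the function is Lipschitz
  with a constant \<open>K\<close> of order \<open>j\<^bsup>-\<alpha>\<^esup> / j\<^bsup>-\<beta>\<^esup> = j\<^bsup>n-1\<^esup>\<close>.  Each boundary point lies over (or beside, or
  under) the cube \<open>Q\<close> on a segment parallel to an axis that stays in \<open>\<Omega>\<close> and has length at most
  \<open>2L\<close>.  Hoelder's inequality on these segments and the Poincare inequality on \<open>Q\<close> give a bound of
  order \<open>L\<^bsup>p-1\<^esup>\<close> when the boundary is measured by its projection, and the surface measure is at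
  most of order \<open>1 + K\<close> times the projected measure (\<open>graph_integral_le\<close>).  Altogether
  (\<open>boundary_deviation_le\<close>) the constant is of order \<open>(1 + K) L\<^bsup>p-1\<^esup> = j\<^bsup>n-1\<^esup> j\<^bsup>1-p\<^esup> = j\<^bsup>n-p\<^esup>\<close>.
  That the factor is \<open>K\<close> and not \<open>K\<^bsup>n-1\<^esup>\<close>, the Lipschitz constant of the parametrisation to the power
  of the dimension, is seen by counting: the graph over a small cell of side \<open>s\<close> has
  vertical extent \<open>K s\<close>, so about \<open>K\<close> cubes of side \<open>s\<close> cover it.

  The passage to \<open>W\<^sup>1\<^sup>,\<^sup>p\<close> rests on two facts.  The weak gradient and the trace are defined by choice,
  so the weak gradient has to be unique almost everywhere (\<open>weak_gradient_unique\<close>) and every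
  Sobolev function has to possess a trace (\<open>trace_exists\<close>).  The second fact follows from the
  density of smooth functions (\<open>smooth_dense\<close>), since the boundary inequality for smooth functions
  turns Cauchy sequences in \<open>W\<^sup>1\<^sup>,\<^sup>p(\<Omega>)\<close> into Cauchy sequences in \<open>L\<^sup>p(\<partial>\<Omega>)\<close>.  For the density, the
  function is first composed with an affine map that moves the closure of \<open>\<Omega>\<close> into \<open>\<Omega>\<close> (\<open>shrink\<close>)
  and is then mollified.

  All inequalities are proved up to constants that depend on \<open>n\<close> and \<open>p\<close>; in particular
  \<open>|a + b|\<^sup>p \<le> 2\<^sup>p (|a|\<^sup>p + |b|\<^sup>p)\<close> takes the place of Minkowski's inequality.
\<close>

section \<open>Elementary inequalities for \<open>p\<close>-th powers\<close>

lemma norm_add_powr_le: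
  fixes a b :: "'a::real_normed_vector"
  assumes "0 \<le> p"
  shows "norm (a + b) powr p \<le> 2 powr p * (norm a powr p + norm b powr p)"
proof -
  let ?m = "max (norm a) (norm b)"
  have "norm (a + b) \<le> 2 * ?m" using norm_triangle_ineq[of a b] by linarith
  then have "norm (a + b) powr p \<le> (2 * ?m) powr p"
    using assms by (intro powr_mono2) auto
  also have "\<dots> = 2 powr p * ?m powr p" by (simp add: powr_mult)
  also have "?m powr p \<le> norm a powr p + norm b powr p" by (simp add: max_def)
  finally show ?thesis by simp
qed

lemma Lp_int_add_le:
  fixes f g :: "'a \<Rightarrow> 'b::real_normed_vector"
  assumes [measurable]: "f \<in> borel_measurable M" "g \<in> borel_measurable M" and "0 \<le> p"
  shows "Lp_int M p (\<lambda>x. f x + g x) \<le> ennreal (2 powr p) * (Lp_int M p f + Lp_int M p g)"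
proof -
  have "Lp_int M p (\<lambda>x. f x + g x) \<le>
      (\<integral>\<^sup>+x. ennreal (2 powr p) * (ennreal (norm (f x) powr p) + ennreal (norm (g x) powr p)) \<partial>M)"
    unfolding Lp_int_def
    by (intro nn_integral_mono)
       (simp add: norm_add_powr_le[OF \<open>0 \<le> p\<close>] flip: ennreal_plus ennreal_mult)
  also have "\<dots> = ennreal (2 powr p) * (Lp_int M p f + Lp_int M p g)"
    unfolding Lp_int_def by (simp add: nn_integral_cmult nn_integral_add)
  finally show ?thesis .
qed

lemma Lp_int_uminus: "Lp_int M p (\<lambda>x. - f x) = Lp_int M p f"
  by (simp add: Lp_int_def)

lemma Lp_int_minus_commute: "Lp_int M p (\<lambda>x. f x - g x) = Lp_int M p (\<lambda>x. g x - f x)"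
  by (simp add: Lp_int_def norm_minus_commute)

lemma Lp_int_diff_le:
  fixes f g :: "'a \<Rightarrow> 'b::real_normed_vector"
  assumes "f \<in> borel_measurable M" "g \<in> borel_measurable M" "0 \<le> p"
  shows "Lp_int M p (\<lambda>x. f x - g x) \<le> ennreal (2 powr p) * (Lp_int M p f + Lp_int M p g)"
proof -
  have "(\<lambda>x. - g x) \<in> borel_measurable M"
  proof -
    have "uminus \<in> borel_measurable (borel :: 'b measure)"
      by (intro borel_measurable_continuous_onI continuous_intros)
    from measurable_compose[OF assms(2) this] show ?thesis .
  qed
  then show ?thesis
    using Lp_int_add_le[of f M "\<lambda>x. - g x" p] assms by (simp add: Lp_int_uminus)
qed

lemma Lp_int_cong_AE: "(AE x in M. f x = g x) \<Longrightarrow> Lp_int M p f = Lp_int M p g"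
  unfolding Lp_int_def by (rule nn_integral_cong_AE) auto

lemma powr_Young:
  fixes s a p :: real
  assumes "p > 1" "0 \<le> s" "0 \<le> a"
  shows "s * a powr (p - 1) \<le> s powr p / p + (1 - 1 / p) * a powr p"
proof -
  let ?q = "p / (p - 1)"
  have "s * a powr (p - 1) \<le> s powr p / p + (a powr (p - 1)) powr ?q / ?q"
    using assms by (intro Youngs_inequality) (auto simp: field_simps)
  also have "(a powr (p - 1)) powr ?q = a powr p" using assms by (simp add: powr_powr)
  finally show ?thesis using assms by (simp add: field_simps)
qed

text \<open>
  Jensen's inequality for \<open>t \<mapsto> |t|\<^sup>p\<close> with values in the extended half-line, so that it can
  be used before the right-hand side is known to be finite. Young's inequality is integrated
  with the second factor fixed at the mean of \<open>|f|\<close>.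
\<close>

lemma powr_integral_le:
  fixes f :: "'a \<Rightarrow> real"
  assumes p: "p > 1" and f[measurable]: "f \<in> borel_measurable M"
    and m: "emeasure M (space M) = ennreal m" "m > 0"
  shows "ennreal (\<bar>\<integral>x. f x \<partial>M\<bar> powr p) \<le> ennreal (m powr (p - 1)) * (\<integral>\<^sup>+x. ennreal (\<bar>f x\<bar> powr p) \<partial>M)"
proof -
  interpret finite_measure M using m by (intro finite_measureI) auto
  define a where "a = (\<integral>x. \<bar>f x\<bar> \<partial>M) / m"
  have a0: "0 \<le> a" using m by (simp add: a_def)
  have le: "\<bar>\<integral>x. f x \<partial>M\<bar> \<le> m * a" using m by (simp add: a_def integral_abs_bound)
  show ?thesis
  proof (cases "integrable M f \<and> (\<integral>\<^sup>+x. ennreal (\<bar>f x\<bar> powr p) \<partial>M) < \<infinity>")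
    case False
    then show ?thesis
    proof (cases "integrable M f")
      case True
      with False have "(\<integral>\<^sup>+x. ennreal (\<bar>f x\<bar> powr p) \<partial>M) = \<infinity>"
        by (simp add: less_top[symmetric])
      then show ?thesis using m by (simp add: ennreal_mult_top)
    qed (simp add: not_integrable_integral_eq)
  next
    case True
    then have fi: "integrable M f" and pi: "integrable M (\<lambda>x. \<bar>f x\<bar> powr p)"
      by (auto intro!: integrableI_bounded)
    have ms: "measure M (space M) = m" using m by (simp add: measure_def)
    have "(\<integral>x. \<bar>f x\<bar> * a powr (p - 1) \<partial>M) \<le> (\<integral>x. \<bar>f x\<bar> powr p / p + (1 - 1 / p) * a powr p \<partial>M)"
      using fi pi p a0 by (intro integral_mono powr_Young) auto
    also have "\<dots> = (\<integral>x. \<bar>f x\<bar> powr p \<partial>M) / p + (1 - 1 / p) * a powr p * m"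
      using pi ms by simp
    finally have "m * (a * a powr (p - 1)) \<le> (\<integral>x. \<bar>f x\<bar> powr p \<partial>M) / p + (1 - 1 / p) * a powr p * m"
      using m by (simp add: a_def)
    also have "a * a powr (p - 1) = a powr p"
      using a0 p by (cases "a = 0") (simp_all add: powr_diff)
    finally have "m * a powr p / p \<le> (\<integral>x. \<bar>f x\<bar> powr p \<partial>M) / p"
      by (simp add: field_simps)
    then have ma: "m * a powr p \<le> (\<integral>x. \<bar>f x\<bar> powr p \<partial>M)" using p by (simp add: divide_le_cancel)
    have "\<bar>\<integral>x. f x \<partial>M\<bar> powr p \<le> (m * a) powr p" using le p by (intro powr_mono2) auto
    also have "\<dots> = m powr (p - 1) * (m * a powr p)"
      using m a0 by (simp add: powr_mult powr_diff)
    also have "\<dots> \<le> m powr (p - 1) * (\<integral>x. \<bar>f x\<bar> powr p \<partial>M)"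
      using ma by (intro mult_left_mono) auto
    finally show ?thesis
      using pi by (simp add: nn_integral_eq_integral ennreal_mult''[symmetric])
  qed
qed

section \<open>Smooth functions and mollifiers\<close>

lemma partial_deriv_eq:
  "(f has_derivative f') (at x) \<Longrightarrow> partial_deriv i f x = f' (axis i 1)"
  unfolding partial_deriv_def using frechet_derivative_at by metis

lemma smooth_differentiable: "smooth f \<Longrightarrow> f differentiable (at x)"
  unfolding smooth_def by (metis Ck.simps(2))

lemma smooth_partial_deriv: "smooth f \<Longrightarrow> smooth (partial_deriv i f)"
  unfolding smooth_def by (metis Ck.simps(2))

lemma smooth_continuous: "smooth f \<Longrightarrow> continuous_on S f"
  unfolding smooth_def by (metis Ck.simps(1) continuous_on_subset subset_UNIV)

text \<open>
  Smoothness is an infinite conjunction over the order \<open>k\<close>; a class of differentiable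
  functions that is closed under partial derivatives lies in all of the classes \<open>Ck k\<close> at
  once.
\<close>

lemma smooth_coinduct:
  assumes "P f"
    and "\<And>f x. P f \<Longrightarrow> f differentiable (at x)"
    and "\<And>f i. P f \<Longrightarrow> P (partial_deriv i f)"
  shows "smooth f"
proof -
  have "Ck k f" if "P f" for k f
    using that
  proof (induction k arbitrary: f)
    case 0
    then show ?case using assms(2)
      by (auto simp: continuous_on_eq_continuous_at intro: differentiable_imp_continuous_within)
  next
    case (Suc k)
    then show ?case using assms by auto
  qed
  then show ?thesis using assms(1) by (simp add: smooth_def)
qed

definition grad :: "(real^'n \<Rightarrow> real) \<Rightarrow> real^'n \<Rightarrow> real^'n" where
  "grad f x = (\<chi> i. partial_deriv i f x)"

lemma linear_eq_inner_axis:
  fixes L :: "real^'n \<Rightarrow> real"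
  assumes "linear L"
  shows "L h = (\<chi> i. L (axis i 1)) \<bullet> h"
proof -
  have "h = (\<Sum>i\<in>UNIV. h $ i *\<^sub>R axis i 1)"
    by (simp add: vec_eq_iff axis_def if_distrib[of "\<lambda>a. _ * a"] cong: if_cong)
  then have "L h = L (\<Sum>i\<in>UNIV. h $ i *\<^sub>R axis i 1)" by simp
  also have "\<dots> = (\<Sum>i\<in>UNIV. h $ i * L (axis i 1))"
    using assms by (simp add: linear_sum linear_cmul)
  finally show ?thesis by (simp add: inner_vec_def mult.commute)
qed

lemma differentiable_has_grad:
  assumes "f differentiable (at x)"
  shows "(f has_derivative (\<lambda>h. grad f x \<bullet> h)) (at x)"
proof -
  let ?L = "frechet_derivative f (at x)"
  have d: "(f has_derivative ?L) (at x)" using assms by (simp add: frechet_derivative_works)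
  then have "linear ?L" by (rule has_derivative_linear)
  then have "?L = (\<lambda>h. grad f x \<bullet> h)"
    unfolding grad_def partial_deriv_def using linear_eq_inner_axis by blast
  then show ?thesis using d by simp
qed

lemma smooth_has_grad: "smooth f \<Longrightarrow> (f has_derivative (\<lambda>h. grad f x \<bullet> h)) (at x)"
  by (intro differentiable_has_grad smooth_differentiable)

lemma smooth_continuous_grad: "smooth f \<Longrightarrow> continuous_on S (grad f)"
  unfolding grad_def by (intro continuous_on_vec_lambda smooth_continuous smooth_partial_deriv)

lemma partial_deriv_cmult:
  assumes "f differentiable (at x)"
  shows "partial_deriv i (\<lambda>x. c * f x) x = c * partial_deriv i f x"
proof -
  have "((\<lambda>x. c * f x) has_derivative (\<lambda>h. c * (grad f x \<bullet> h))) (at x)"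
    by (intro has_derivative_mult_right differentiable_has_grad assms)
  from partial_deriv_eq[OF this, of i] show ?thesis by (simp add: grad_def inner_axis)
qed

lemma Ck_cmult: "Ck k f \<Longrightarrow> Ck k (\<lambda>x. c * f x)"
proof (induction k arbitrary: f)
  case 0
  then show ?case by (auto intro: continuous_intros)
next
  case (Suc k)
  have "partial_deriv i (\<lambda>x. c * f x) = (\<lambda>x. c * partial_deriv i f x)" for i
    using Suc.prems by (intro ext partial_deriv_cmult) auto
  with Suc show ?case by (auto intro: differentiable_cmult_right_iff[THEN iffD2])
qed

text \<open>
  Diagonal affine maps shrink the horizontal and the vertical directions by different
  factors; the map that moves the closure of the domain into the domain (\<open>shrink\<close>) is of this
  form.
\<close>

lemma diag_affine_has_derivative:
  fixes f :: "real^'n \<Rightarrow> real" and d :: "'n \<Rightarrow> real" and b :: "real^'n"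
  assumes "\<And>x. f differentiable (at x)"
  defines "A \<equiv> \<lambda>x::real^'n. (\<chi> l. d l * x $ l) + b"
  shows "((\<lambda>x. f (A x)) has_derivative (\<lambda>h. grad f (A x) \<bullet> (\<chi> l. d l * h $ l))) (at x)"
proof -
  have "linear (\<lambda>h::real^'n. \<chi> l. d l * h $ l)"
    by (rule linearI) (auto simp: vec_eq_iff algebra_simps)
  then have "((\<lambda>h::real^'n. \<chi> l. d l * h $ l) has_derivative (\<lambda>h. \<chi> l. d l * h $ l)) (at x)"
    by (intro bounded_linear_imp_has_derivative) (simp add: linear_conv_bounded_linear)
  from has_derivative_add[OF this has_derivative_const[of b]]
  have "(A has_derivative (\<lambda>h. \<chi> l. d l * h $ l)) (at x)" by (simp add: A_def)
  then show ?thesis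
    by (rule has_derivative_compose) (rule differentiable_has_grad, rule assms)
qed

lemma partial_deriv_diag_affine:
  fixes f :: "real^'n \<Rightarrow> real" and d :: "'n \<Rightarrow> real"
  assumes "\<And>x. f differentiable (at x)"
  shows "partial_deriv i (\<lambda>x. f ((\<chi> l. d l * x $ l) + b)) x = d i * partial_deriv i f ((\<chi> l. d l * x $ l) + b)"
proof -
  have "(\<chi> l. d l * axis i (1::real) $ l) = axis i (d i)" by (simp add: vec_eq_iff axis_def)
  then show ?thesis
    using partial_deriv_eq[OF diag_affine_has_derivative[OF assms], of i d b x]
    by (simp add: inner_axis grad_def)
qed

lemma Ck_diag_affine:
  fixes f :: "real^'n \<Rightarrow> real"
  shows "Ck k f \<Longrightarrow> Ck k (\<lambda>x. f ((\<chi> l. d l * x $ l) + b))"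
proof (induction k arbitrary: f)
  case 0
  have "continuous_on UNIV (\<lambda>x::real^'n. (\<chi> l. d l * x $ l) + b)"
    by (intro continuous_intros continuous_on_vec_lambda)
  with 0 show ?case
    by (auto intro: continuous_on_compose2)
next
  case (Suc k)
  then have f: "\<And>x. f differentiable (at x)" by simp
  have "partial_deriv i (\<lambda>x. f ((\<chi> l. d l * x $ l) + b)) =
      (\<lambda>x. d i * partial_deriv i f ((\<chi> l. d l * x $ l) + b))" for i
    by (rule ext) (rule partial_deriv_diag_affine[OF f])
  moreover have "(\<lambda>x. f ((\<chi> l. d l * x $ l) + b)) differentiable (at x)" for x
    using diag_affine_has_derivative[OF f] unfolding differentiable_def by blast
  ultimately show ?case
    using Suc by (auto intro!: Ck_cmult)
qed

lemma smooth_diag_affine: "smooth f \<Longrightarrow> smooth (\<lambda>x. f ((\<chi> l. d l * x $ l) + b))"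
  unfolding smooth_def using Ck_diag_affine by blast

text \<open>
  For \<open>t > 0\<close> this is \<open>t\<^bsup>-k\<^esup> exp (-1/t)\<close>. The powers are part of the family because the
  derivative of a member is a linear combination of members, so that all derivatives at the
  critical point 0 are covered by the single limit \<open>flat_tendsto_0\<close>.
\<close>

definition flat :: "nat \<Rightarrow> real \<Rightarrow> real" where
  "flat k t = (if t > 0 then inverse t ^ k * exp (- inverse t) else 0)"

lemma flat_tendsto_0: "(flat k \<longlongrightarrow> 0) (at 0)"
proof -
  have "((\<lambda>y::real. y ^ k / exp y) \<longlongrightarrow> 0) at_top" by (rule tendsto_power_div_exp_0)
  then have "((\<lambda>t::real. inverse t ^ k / exp (inverse t)) \<longlongrightarrow> 0) (at_right 0)"
    by (rule filterlim_compose[OF _ filterlim_inverse_at_top_right])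
  then have r: "(flat k \<longlongrightarrow> 0) (at_right 0)"
    by (rule Lim_transform_eventually)
       (auto simp: eventually_at_filter flat_def exp_minus divide_inverse)
  have "((\<lambda>_. 0) \<longlongrightarrow> 0) (at_left (0::real))" by simp
  then have l: "(flat k \<longlongrightarrow> 0) (at_left 0)"
    by (rule Lim_transform_eventually) (auto simp: eventually_at_filter flat_def)
  from l r show ?thesis by (simp add: filterlim_split_at)
qed

text \<open>
  At 0 the difference quotient of \<open>flat k\<close> is \<open>flat (k + 1)\<close>, which tends to 0.
\<close>

lemma DERIV_flat:
  "(flat k has_real_derivative flat (k + 2) t - real k * flat (k + 1) t) (at t)"
proof -
  consider "t > 0" | "t < 0" | "t = 0" by linarith
  then show ?thesis
  proof cases
    case 1
    have "((\<lambda>t. inverse t ^ k * exp (- inverse t)) has_real_derivative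
            flat (k + 2) t - real k * flat (k + 1) t) (at t)"
      using 1 by (cases k) (auto intro!: derivative_eq_intros simp: flat_def algebra_simps power2_eq_square,
        metis One_nat_def power_eq_if)
    then show ?thesis
      by (rule has_field_derivative_transform_within_open[of _ _ _ "{0<..}"])
         (use 1 in \<open>auto simp: flat_def\<close>)
  next
    case 2
    have "((\<lambda>t. 0) has_real_derivative flat (k + 2) t - real k * flat (k + 1) t) (at t)"
      using 2 by (simp add: flat_def)
    then show ?thesis
      by (rule has_field_derivative_transform_within_open[of _ _ _ "{..<0}"])
         (use 2 in \<open>auto simp: flat_def\<close>)
  next
    case 3
    have "((\<lambda>h. (flat k (0 + h) - flat k 0) / h) \<longlongrightarrow> 0) (at 0)"
      by (rule Lim_transform_eventually[OF flat_tendsto_0[of "k + 1"]])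
         (auto simp: eventually_at_filter flat_def divide_inverse)
    then show ?thesis using 3 by (simp add: DERIV_def flat_def)
  qed
qed

text \<open>
  An algebra of functions closed under partial derivatives and containing bump functions that
  are supported in the ball around \<open>a\<close> of radius \<open>\<surd>s\<close>. The centre is a parameter because the
  test functions \<open>y \<mapsto> r (a - y)\<close> have to be smooth, too.
\<close>

inductive bump_algebra :: "real^'n \<Rightarrow> real \<Rightarrow> (real^'n \<Rightarrow> real) \<Rightarrow> bool" for a s where
  const: "bump_algebra a s (\<lambda>x. c)"
| coord: "bump_algebra a s (\<lambda>x. x $ l)"
| flat: "bump_algebra a s (\<lambda>x. flat k (s - (x - a) \<bullet> (x - a)))"
| add: "bump_algebra a s f \<Longrightarrow> bump_algebra a s g \<Longrightarrow> bump_algebra a s (\<lambda>x. f x + g x)"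
| mult: "bump_algebra a s f \<Longrightarrow> bump_algebra a s g \<Longrightarrow> bump_algebra a s (\<lambda>x. f x * g x)"

lemma bump_algebra_step:
  assumes "bump_algebra a s f"
  shows "(\<forall>x. f differentiable (at x)) \<and> (\<forall>i. bump_algebra a s (partial_deriv i f))"
  using assms
proof induction
  case (const c)
  have "((\<lambda>x. c) has_derivative (\<lambda>h. 0)) (at x)" for x :: "real^'a" by simp
  from partial_deriv_eq[OF this]
  have "partial_deriv i (\<lambda>x. c) = (\<lambda>x. 0)" for i :: 'a by auto
  then show ?case by (auto intro: bump_algebra.const)
next
  case (coord l)
  have "((\<lambda>x. x $ l) has_derivative (\<lambda>h. h $ l)) (at x)" for x :: "real^'a"
    by (intro bounded_linear_imp_has_derivative bounded_linear_vec_nth)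
  from partial_deriv_eq[OF this] this
  have "partial_deriv i (\<lambda>x. x $ l) = (\<lambda>x. axis i 1 $ l)" "(\<lambda>x::real^'a. x $ l) differentiable at x"
    for i :: 'a and x by (auto simp: differentiable_def)
  then show ?case by (auto intro: bump_algebra.const)
next
  case (flat k)
  let ?q = "\<lambda>x. s - (x - a) \<bullet> (x - a)"
  let ?g = "\<lambda>x. flat (k + 2) (?q x) - real k * flat (k + 1) (?q x)"
  have q: "(?q has_derivative (\<lambda>h. - 2 * ((x - a) \<bullet> h))) (at x)" for x
    by (auto intro!: derivative_eq_intros simp: inner_commute)
  have d: "((\<lambda>x. flat k (?q x)) has_derivative (\<lambda>h. ?g x * (- 2 * ((x - a) \<bullet> h)))) (at x)" for x
    by (rule has_derivative_compose[OF q DERIV_flat[of k, unfolded has_field_derivative_def]])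
  have "partial_deriv i (\<lambda>x. flat k (?q x)) =
     (\<lambda>x. (flat (k + 2) (?q x) + (- real k) * flat (k + 1) (?q x)) * (-2 * (x $ i + - (a $ i))))" for i
    using partial_deriv_eq[OF d, of i] by (auto simp: inner_axis)
  then show ?case
    using d by (auto simp only: differentiable_def intro!: bump_algebra.intros)
next
  case (add f g)
  have "((\<lambda>x. f x + g x) has_derivative (\<lambda>h. grad f x \<bullet> h + grad g x \<bullet> h)) (at x)" for x
    using add by (intro has_derivative_add differentiable_has_grad) auto
  from partial_deriv_eq[OF this]
  have "partial_deriv i (\<lambda>x. f x + g x) = (\<lambda>x. partial_deriv i f x + partial_deriv i g x)" for i
    by (auto simp: inner_axis grad_def)
  then show ?case using add by (auto intro: bump_algebra.add)
next
  case (mult f g)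
  have "((\<lambda>x. f x * g x) has_derivative (\<lambda>h. f x * (grad g x \<bullet> h) + (grad f x \<bullet> h) * g x)) (at x)" for x
    using mult by (intro has_derivative_mult differentiable_has_grad) auto
  from partial_deriv_eq[OF this]
  have "partial_deriv i (\<lambda>x. f x * g x) = (\<lambda>x. f x * partial_deriv i g x + partial_deriv i f x * g x)" for i
    by (auto simp: inner_axis grad_def)
  then show ?case using mult by (auto intro!: bump_algebra.add bump_algebra.mult)
qed

lemma bump_algebra_smooth: "bump_algebra a s f \<Longrightarrow> smooth f"
  by (rule smooth_coinduct[of "bump_algebra a s"]) (auto dest: bump_algebra_step)

definition vanishes_outside :: "real \<Rightarrow> (real^'n \<Rightarrow> 'b::zero) \<Rightarrow> bool" where
  "vanishes_outside R f \<longleftrightarrow> (\<forall>x. norm x \<ge> R \<longrightarrow> f x = 0)"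

text \<open>
  The functions \<open>y \<mapsto> r (a - y)\<close> are the test functions that extract the value of a
  mollification at \<open>a\<close>; their smoothness is recorded together with that of \<open>r\<close>.
\<close>

definition mollifier :: "real \<Rightarrow> (real^'n \<Rightarrow> real) \<Rightarrow> bool" where
  "mollifier \<delta> r \<longleftrightarrow> smooth r \<and> (\<forall>a. smooth (\<lambda>y. r (a - y))) \<and> (\<forall>x. 0 \<le> r x) \<and>
     vanishes_outside \<delta> r \<and> integrable lborel r \<and> (\<integral>x. r x \<partial>lborel) = 1"

lemma integrable_continuous_vanishing:
  fixes f :: "real^'n \<Rightarrow> real"
  assumes "continuous_on UNIV f" "vanishes_outside R f"
  shows "integrable lborel f"
proof -
  have "integrable lborel (\<lambda>x. indicator (cball 0 R) x *\<^sub>R f x)"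
    using assms(1) by (intro borel_integrable_compact compact_cball) (auto intro: continuous_on_subset)
  also have "(\<lambda>x. indicator (cball 0 R) x *\<^sub>R f x) = f"
    using assms(2) by (auto simp: vanishes_outside_def indicator_def fun_eq_iff)
  finally show ?thesis .
qed

lemma mollifier_exists:
  assumes "\<delta> > 0"
  obtains r :: "real^'n \<Rightarrow> real" where "mollifier \<delta> r"
proof -
  define q :: "real^'n \<Rightarrow> real" where "q x = flat 0 (\<delta>\<^sup>2 - x \<bullet> x)" for x
  have sm: "smooth (\<lambda>y. c * q (a - y))" for a c
  proof (rule bump_algebra_smooth[of a "\<delta>\<^sup>2"])
    have "(\<lambda>y. c * q (a - y)) = (\<lambda>y. c * flat 0 (\<delta>\<^sup>2 - (y - a) \<bullet> (y - a)))"
      by (auto simp: q_def algebra_simps inner_commute)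
    then show "bump_algebra a (\<delta>\<^sup>2) (\<lambda>y. c * q (a - y))" by (auto intro: bump_algebra.intros)
  qed
  have sm': "smooth (\<lambda>y. c * q y)" for c
  proof -
    have "(\<lambda>y. c * q y) = (\<lambda>y. c * q (0 - y))" by (auto simp: q_def)
    then show ?thesis using sm[of c 0] by simp
  qed
  have q0: "0 \<le> q x" for x by (simp add: q_def flat_def)
  have v: "vanishes_outside \<delta> q"
    unfolding vanishes_outside_def
  proof (intro allI impI)
    fix x :: "real^'n" assume "\<delta> \<le> norm x"
    then have "\<delta>\<^sup>2 \<le> x \<bullet> x" using \<open>\<delta> > 0\<close>
      by (metis less_imp_le power2_norm_eq_inner power_mono)
    then show "q x = 0" by (simp add: q_def flat_def)
  qed
  have cont: "continuous_on UNIV q"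
    using smooth_continuous[OF sm'[of 1]] by simp
  have int: "integrable lborel q" by (rule integrable_continuous_vanishing[OF cont v])
  have "(\<integral>x. q x \<partial>lborel) \<noteq> 0"
  proof
    assume "(\<integral>x. q x \<partial>lborel) = 0"
    then have "AE x in lborel. q x = 0"
      using integral_nonneg_eq_0_iff_AE[OF int] q0 by auto
    then have "AE x in lborel. x \<in> {x. q x = 0}" by simp
    then have "AE x in lebesgue. x \<in> {x. q x = 0}" by (rule AE_completion)
    moreover have "closed {x. q x = 0}"
      using cont by (intro closed_Collect_eq) auto
    ultimately have "0 \<in> {x. q x = 0}" by (rule mem_closed_if_AE_lebesgue[rotated])
    then show False using \<open>\<delta> > 0\<close> by (simp add: q_def flat_def)
  qed
  moreover have "(\<integral>x. q x \<partial>lborel) \<ge> 0" using q0 by simp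
  ultimately have I: "(\<integral>x. q x \<partial>lborel) > 0" by simp
  have "mollifier \<delta> (\<lambda>x. inverse (\<integral>x. q x \<partial>lborel) * q x)"
    unfolding mollifier_def using sm sm' q0 v int I by (auto simp: vanishes_outside_def)
  then show ?thesis by (rule that)
qed

lemma uniformly_continuous_vanishing:
  fixes f :: "real^'n \<Rightarrow> 'b::real_normed_vector"
  assumes c: "continuous_on UNIV f" and v: "vanishes_outside R f"
  shows "uniformly_continuous_on UNIV f"
  unfolding uniformly_continuous_on_def
proof (intro allI impI)
  fix e :: real assume "e > 0"
  have "uniformly_continuous_on (cball 0 (R + 2)) f"
    by (intro compact_uniformly_continuous compact_cball continuous_on_subset[OF c]) auto
  with \<open>e > 0\<close> obtain d where d: "d > 0"
    "\<And>x y. x \<in> cball 0 (R + 2) \<Longrightarrow> y \<in> cball 0 (R + 2) \<Longrightarrow> dist y x < d \<Longrightarrow> dist (f y) (f x) < e"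
    unfolding uniformly_continuous_on_def by metis
  show "\<exists>d>0. \<forall>x\<in>UNIV. \<forall>y\<in>UNIV. dist y x < d \<longrightarrow> dist (f y) (f x) < e"
  proof (intro exI[of _ "min d 1"] conjI ballI impI)
    fix x y :: "real^'n" assume xy: "dist y x < min d 1"
    have "norm y \<le> norm x + dist y x" "norm x \<le> norm y + dist y x"
      by (smt (verit) dist_norm norm_minus_commute norm_triangle_sub)+
    with xy show "dist (f y) (f x) < e"
      using d(2)[of x y] v \<open>e > 0\<close> by (cases "norm x \<le> R + 1") (auto simp: vanishes_outside_def)
  qed (use d in auto)
qed

lemma bounded_vanishing:
  fixes f :: "real^'n \<Rightarrow> 'b::real_normed_vector"
  assumes c: "continuous_on UNIV f" and v: "vanishes_outside R f"
  obtains B where "\<And>x. norm (f x) \<le> B"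
proof -
  have "bounded (f ` cball 0 R)"
    by (intro compact_imp_bounded compact_continuous_image compact_cball continuous_on_subset[OF c]) auto
  then obtain B where "\<forall>x\<in>cball 0 R. norm (f x) \<le> B" by (auto simp: bounded_iff)
  then have "norm (f x) \<le> max B 0" for x
    using v by (cases "norm x \<le> R") (auto simp: vanishes_outside_def le_max_iff_disj)
  then show ?thesis by (rule that)
qed

lemma vanishes_partial_deriv:
  fixes f :: "real^'n \<Rightarrow> real"
  assumes "vanishes_outside R f"
  shows "vanishes_outside (R + 1) (partial_deriv i f)"
  unfolding vanishes_outside_def
proof (intro allI impI)
  fix x :: "real^'n" assume x: "R + 1 \<le> norm x"
  have "((\<lambda>x. 0::real) has_derivative (\<lambda>h. 0)) (at x)" by simp
  then have "(f has_derivative (\<lambda>h. 0)) (at x)"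
    by (rule has_derivative_transform_within_open[of _ _ _ _ "{x. R < norm x}"])
       (use assms x in \<open>auto simp: vanishes_outside_def intro!: open_Collect_less continuous_intros\<close>)
  from partial_deriv_eq[OF this] show "partial_deriv i f x = 0" by simp
qed

lemma vanishes_grad: "vanishes_outside R f \<Longrightarrow> vanishes_outside (R + 1) (grad f)"
  using vanishes_partial_deriv[of R f]
  by (simp add: vanishes_outside_def grad_def vec_eq_iff)

definition moll :: "(real^'n \<Rightarrow> real) \<Rightarrow> (real^'n \<Rightarrow> real) \<Rightarrow> real^'n \<Rightarrow> real" where
  "moll r f x = (\<integral>y. r (x - y) * f y \<partial>lborel)"

lemma integrable_bounded_mult:
  fixes h f :: "real^'n \<Rightarrow> real"
  assumes "integrable lborel f" "h \<in> borel_measurable borel" "\<And>x. \<bar>h x\<bar> \<le> B"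
  shows "integrable lborel (\<lambda>x. h x * f x)"
proof (rule Bochner_Integration.integrable_bound)
  show "integrable lborel (\<lambda>x. B * f x)" using assms by simp
  show "(\<lambda>x. h x * f x) \<in> borel_measurable lborel" using assms by (auto simp: borel_measurable_integrable)
  have "0 \<le> B" using assms(3)[of 0] by linarith
  then show "AE x in lborel. norm (h x * f x) \<le> norm (B * f x)"
    using assms by (auto simp: abs_mult intro!: mult_right_mono)
qed

lemma borel_measurable_minus_shift:
  assumes "continuous_on UNIV (h :: real^'n \<Rightarrow> real)"
  shows "(\<lambda>y. h (x - y)) \<in> borel_measurable borel"
  by (intro borel_measurable_continuous_onI continuous_on_compose2[OF assms] continuous_intros) auto

lemma integrable_moll:
  fixes r f :: "real^'n \<Rightarrow> real"
  assumes "integrable lborel f" "continuous_on UNIV r" "vanishes_outside R r"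
  shows "integrable lborel (\<lambda>y. r (x - y) * f y)"
proof -
  obtain B where "\<And>x. norm (r x) \<le> B" using bounded_vanishing[OF assms(2,3)] by blast
  then show ?thesis
    using assms by (intro integrable_bounded_mult[where B=B and h="\<lambda>y. r (x - y)"] borel_measurable_minus_shift) auto
qed

text \<open>
  The gradient of \<open>r\<close> is uniformly continuous, so the first-order remainder of \<open>r\<close> is bounded
  by \<open>e' |h|\<close> uniformly in the base point and may be integrated against \<open>|f|\<close>.
\<close>

lemma moll_has_derivative:
  fixes r f :: "real^'n \<Rightarrow> real"
  assumes f: "integrable lborel f" and r: "smooth r" and v: "vanishes_outside R r"
  shows "(moll r f has_derivative (\<lambda>h. (\<chi> i. moll (partial_deriv i r) f x) \<bullet> h)) (at x)"
  unfolding has_derivative_at_alt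
proof (intro conjI allI impI)
  show "bounded_linear (\<lambda>h. (\<chi> i. moll (partial_deriv i r) f x) \<bullet> h)"
    by (rule bounded_linear_inner_right)
  fix e :: real assume "0 < e"
  define N where "N = (\<integral>y. \<bar>f y\<bar> \<partial>lborel)"
  have N: "0 \<le> N" by (simp add: N_def)
  define e' where "e' = e / (N + 1)"
  have e': "e' > 0" "e' * N \<le> e" using \<open>0 < e\<close> N by (auto simp: e'_def field_simps)
  have "uniformly_continuous_on UNIV (grad r)"
    by (rule uniformly_continuous_vanishing[OF smooth_continuous_grad[OF r] vanishes_grad[OF v]])
  then obtain d where d: "d > 0" "\<And>u w. dist u w < d \<Longrightarrow> dist (grad r u) (grad r w) < e'"
    using e'(1) unfolding uniformly_continuous_on_def by (metis UNIV_I)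
  have taylor: "\<bar>r (w + h) - r w - grad r w \<bullet> h\<bar> \<le> e' * norm h" if "norm h < d" for w h
  proof -
    let ?\<phi> = "\<lambda>z. r z - grad r w \<bullet> z"
    have "norm (?\<phi> (w + h) - ?\<phi> w) \<le> e' * norm ((w + h) - w)"
    proof (rule differentiable_bound[of "ball w d" _ "\<lambda>z h. grad r z \<bullet> h - grad r w \<bullet> h"])
      show "(?\<phi> has_derivative (\<lambda>h. grad r z \<bullet> h - grad r w \<bullet> h)) (at z within ball w d)" for z
        by (intro has_derivative_diff has_derivative_at_withinI[OF smooth_has_grad[OF r]]
            bounded_linear_imp_has_derivative bounded_linear_inner_right)
      show "onorm (\<lambda>h. grad r z \<bullet> h - grad r w \<bullet> h) \<le> e'" if "z \<in> ball w d" for z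
      proof (rule onorm_bound)
        fix h :: "real^'n"
        have "norm (grad r z \<bullet> h - grad r w \<bullet> h) \<le> norm (grad r z - grad r w) * norm h"
          using Cauchy_Schwarz_ineq2[of "grad r z - grad r w" h] by (simp add: inner_diff_left)
        also have "\<dots> \<le> e' * norm h"
          using d(2)[of z w] that by (intro mult_right_mono) (auto simp: dist_norm norm_minus_commute)
        finally show "norm (grad r z \<bullet> h - grad r w \<bullet> h) \<le> e' * norm h" .
      qed (use e' in auto)
    qed (use that d in \<open>auto simp: dist_norm\<close>)
    then show ?thesis by (simp add: inner_add_right algebra_simps)
  qed
  show "\<exists>d>0. \<forall>y. norm (y - x) < d \<longrightarrow>
      norm (moll r f y - moll r f x - (\<chi> i. moll (partial_deriv i r) f x) \<bullet> (y - x)) \<le> e * norm (y - x)"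
  proof (intro exI[of _ d] conjI allI impI)
    fix y assume y: "norm (y - x) < d"
    let ?h = "y - x"
    have i0: "integrable lborel (\<lambda>z. r (w - z) * f z)" for w
      by (rule integrable_moll[OF f smooth_continuous[OF r] v])
    have i1: "integrable lborel (\<lambda>z. partial_deriv i r (x - z) * f z)" for i
      by (rule integrable_moll[OF f smooth_continuous[OF smooth_partial_deriv[OF r]] vanishes_partial_deriv[OF v]])
    have "(\<chi> i. moll (partial_deriv i r) f x) \<bullet> ?h = (\<Sum>i\<in>UNIV. (\<integral>z. partial_deriv i r (x - z) * f z \<partial>lborel) * ?h $ i)"
      by (simp add: inner_vec_def moll_def)
    also have "\<dots> = (\<integral>z. (\<Sum>i\<in>UNIV. (partial_deriv i r (x - z) * f z) * ?h $ i) \<partial>lborel)"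
      using i1 by (simp add: Bochner_Integration.integral_sum)
    also have "(\<lambda>z. (\<Sum>i\<in>UNIV. (partial_deriv i r (x - z) * f z) * ?h $ i)) = (\<lambda>z. (grad r (x - z) \<bullet> ?h) * f z)"
      by (auto simp: inner_vec_def grad_def sum_distrib_right intro!: sum.cong)
    finally have eq: "(\<chi> i. moll (partial_deriv i r) f x) \<bullet> ?h = (\<integral>z. (grad r (x - z) \<bullet> ?h) * f z \<partial>lborel)" .
    have i2: "integrable lborel (\<lambda>z. (grad r (x - z) \<bullet> ?h) * f z)"
    proof -
      have "integrable lborel (\<lambda>z. (\<Sum>i\<in>UNIV. (partial_deriv i r (x - z) * f z) * ?h $ i))"
        using i1 by (intro Bochner_Integration.integrable_sum integrable_mult_left) auto
      also have "(\<lambda>z. (\<Sum>i\<in>UNIV. (partial_deriv i r (x - z) * f z) * ?h $ i)) = (\<lambda>z. (grad r (x - z) \<bullet> ?h) * f z)"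
        by (auto simp: inner_vec_def grad_def sum_distrib_right intro!: sum.cong)
      finally show ?thesis .
    qed
    have "moll r f y - moll r f x - (\<chi> i. moll (partial_deriv i r) f x) \<bullet> ?h =
        (\<integral>z. (r (y - z) - r (x - z) - grad r (x - z) \<bullet> ?h) * f z \<partial>lborel)"
      unfolding eq using i0[of x] i0[of y] i2 by (simp add: moll_def left_diff_distrib)
    also have "norm \<dots> \<le> (\<integral>z. (e' * norm ?h) * \<bar>f z\<bar> \<partial>lborel)"
    proof (rule order_trans[OF integral_norm_bound integral_mono])
      show "integrable lborel (\<lambda>z. norm ((r (y - z) - r (x - z) - grad r (x - z) \<bullet> ?h) * f z))"
        unfolding left_diff_distrib using i0[of x] i0[of y] i2 by auto
      show "integrable lborel (\<lambda>z. e' * norm (y - x) * \<bar>f z\<bar>)" using f by auto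
      fix z
      have "\<bar>r (x - z + ?h) - r (x - z) - grad r (x - z) \<bullet> ?h\<bar> \<le> e' * norm ?h" by (rule taylor[OF y])
      moreover have "x - z + ?h = y - z" by simp
      ultimately have "\<bar>r (y - z) - r (x - z) - grad r (x - z) \<bullet> ?h\<bar> \<le> e' * norm ?h" by metis
      then show "norm ((r (y - z) - r (x - z) - grad r (x - z) \<bullet> ?h) * f z) \<le> e' * norm ?h * \<bar>f z\<bar>"
        by (simp add: abs_mult mult_right_mono)
    qed
    also have "\<dots> = e' * N * norm ?h" by (simp add: N_def)
    also have "\<dots> \<le> e * norm ?h" using e' by (intro mult_right_mono) auto
    finally show "norm (moll r f y - moll r f x - (\<chi> i. moll (partial_deriv i r) f x) \<bullet> ?h) \<le> e * norm ?h" .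
  qed (use d in auto)
qed

lemma partial_deriv_moll:
  assumes "integrable lborel f" "smooth r" "vanishes_outside R r"
  shows "partial_deriv i (moll r f) = moll (partial_deriv i r) f"
  using partial_deriv_eq[OF moll_has_derivative[OF assms]] by (auto simp: inner_axis)

lemma smooth_moll:
  assumes f: "integrable lborel f" and "smooth r" "vanishes_outside R r"
  shows "smooth (moll r f)"
proof (rule smooth_coinduct[of "\<lambda>g. \<exists>r R. smooth r \<and> vanishes_outside R r \<and> g = moll r f"])
  show "\<exists>r' R. smooth r' \<and> vanishes_outside R r' \<and> moll r f = moll r' f" using assms by blast
  show "g differentiable at x" if "\<exists>r R. smooth r \<and> vanishes_outside R r \<and> g = moll r f" for g x
    using that moll_has_derivative[OF f] by (auto simp: differentiable_def)
  show "\<exists>r R. smooth r \<and> vanishes_outside R r \<and> partial_deriv i g = moll r f"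
    if "\<exists>r R. smooth r \<and> vanishes_outside R r \<and> g = moll r f" for g i
    using that partial_deriv_moll[OF f] smooth_partial_deriv vanishes_partial_deriv by metis
qed

section \<open>Continuity of affine maps and mollification in \<open>L\<^sup>p\<close>\<close>

abbreviation diag_affine :: "('n \<Rightarrow> real) \<Rightarrow> real^'n \<Rightarrow> real^'n \<Rightarrow> real^'n" where
  "diag_affine d b x \<equiv> (\<chi> l. d l * x $ l) + b"

lemma borel_measurable_diag_affine [measurable]: "diag_affine d b \<in> borel_measurable borel"
  by (intro borel_measurable_continuous_onI continuous_intros continuous_on_vec_lambda)

text \<open>
  The determinant of the linear part is at least \<open>2\<^bsup>-n\<^esup>\<close>.
\<close>

lemma nn_integral_diag_affine_le:
  fixes f :: "real^'n \<Rightarrow> ennreal"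
  assumes f[measurable]: "f \<in> borel_measurable borel" and d: "\<And>l. d l \<ge> 1 / 2"
  shows "(\<integral>\<^sup>+x. f (diag_affine d b x) \<partial>lborel) \<le> ennreal (2 ^ CARD('n)) * (\<integral>\<^sup>+x. f x \<partial>lborel)"
proof -
  define c where "c j = (\<chi> l. d l) \<bullet> j" for j :: "real^'n"
  have cB: "c j \<ge> 1 / 2" if "j \<in> Basis" for j
    using that d by (auto simp: c_def Basis_vec_def inner_axis)
  have T: "b + (\<Sum>j\<in>Basis. (c j * (x \<bullet> j)) *\<^sub>R j) = diag_affine d b x" for x
  proof (rule euclidean_eqI)
    fix k :: "real^'n" assume k: "k \<in> Basis"
    then have "(\<Sum>j\<in>Basis. (c j * (x \<bullet> j)) *\<^sub>R j) \<bullet> k = c k * (x \<bullet> k)"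
      by (simp add: inner_sum_left_Basis)
    with k show "(b + (\<Sum>j\<in>Basis. (c j * (x \<bullet> j)) *\<^sub>R j)) \<bullet> k = diag_affine d b x \<bullet> k"
      by (auto simp: inner_add_left c_def Basis_vec_def inner_axis)
  qed
  have c0: "c j \<noteq> 0" if "j \<in> Basis" for j using cB[OF that] by auto
  let ?P = "\<Prod>j\<in>Basis. \<bar>c j\<bar>"
  have "(1 / 2) ^ DIM(real^'n) \<le> ?P"
    using cB prod_mono[of "Basis :: (real^'n) set" "\<lambda>_. 1 / 2" "\<lambda>j. \<bar>c j\<bar>"] by force
  then have P: "1 \<le> 2 ^ CARD('n) * ?P" by (simp add: field_simps power_one_over)
  have "(\<integral>\<^sup>+x. f x \<partial>lborel) = ennreal ?P * (\<integral>\<^sup>+x. f (diag_affine d b x) \<partial>lborel)"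
    by (subst lborel_affine_euclidean[where c=c and t=b, OF c0], assumption)
       (simp add: T nn_integral_density nn_integral_distr nn_integral_cmult)
  then have "ennreal (2 ^ CARD('n)) * (\<integral>\<^sup>+x. f x \<partial>lborel) =
      ennreal (2 ^ CARD('n) * ?P) * (\<integral>\<^sup>+x. f (diag_affine d b x) \<partial>lborel)"
    by (simp add: ennreal_mult prod_nonneg mult.assoc)
  moreover have "1 * (\<integral>\<^sup>+x. f (diag_affine d b x) \<partial>lborel) \<le>
      ennreal (2 ^ CARD('n) * ?P) * (\<integral>\<^sup>+x. f (diag_affine d b x) \<partial>lborel)"
    using P by (intro mult_right_mono) (auto simp flip: ennreal_1)
  ultimately show ?thesis by simp
qed

lemma nn_integral_shift:
  fixes f :: "real^'n \<Rightarrow> ennreal"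
  assumes [measurable]: "f \<in> borel_measurable borel"
  shows "(\<integral>\<^sup>+x. f (x + b) \<partial>lborel) = (\<integral>\<^sup>+x. f x \<partial>lborel)"
proof -
  have "(\<integral>\<^sup>+x. f x \<partial>lborel) = (\<integral>\<^sup>+x. f x \<partial>(distr lborel borel ((+) b)))"
    by (simp add: lborel_distr_plus)
  also have "\<dots> = (\<integral>\<^sup>+x. f (x + b) \<partial>lborel)"
    by (subst nn_integral_distr) (simp_all add: add.commute)
  finally show ?thesis by simp
qed

definition clip :: "real \<Rightarrow> real \<Rightarrow> real" where
  "clip m t = max (- m) (min m t)"

lemma clip_abs_le: "0 \<le> m \<Longrightarrow> \<bar>clip m t\<bar> \<le> m"
  by (auto simp: clip_def)

lemma clip_diff_le: "0 \<le> m \<Longrightarrow> \<bar>t - clip m t\<bar> \<le> \<bar>t\<bar>"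
  by (auto simp: clip_def)

lemma continuous_on_clip: "continuous_on S f \<Longrightarrow> continuous_on S (\<lambda>x. clip m (f x))"
  unfolding clip_def by (intro continuous_intros)

lemma borel_measurable_restrict_lborel:
  "h \<in> borel_measurable borel \<Longrightarrow> h \<in> borel_measurable (restrict_space lborel S)"
  by (rule measurable_restrict_space1) simp

text \<open>
  A measurable function is the limit almost everywhere of continuous functions; truncating at
  a level \<open>m\<close> beforehand makes dominated convergence applicable on the bounded set.
\<close>

lemma continuous_approx_Lp:
  fixes f :: "real^'n \<Rightarrow> real"
  assumes f[measurable]: "f \<in> borel_measurable borel" and p: "p > 0"
    and fin: "Lp_int (restrict_space lborel (cball 0 R)) p f < \<infinity>" and e: "e > 0"
  obtains \<phi> where "continuous_on UNIV \<phi>"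
    "Lp_int (restrict_space lborel (cball 0 R)) p (\<lambda>x. f x - \<phi> x) < ennreal e"
proof -
  let ?B = "restrict_space lborel (cball (0::real^'n) R)"
  have [measurable]: "(\<lambda>x. clip m (h x)) \<in> borel_measurable borel"
    if [measurable]: "h \<in> borel_measurable borel" for h :: "real^'n \<Rightarrow> real" and m
    unfolding clip_def by measurable
  have finB: "emeasure ?B (space ?B) < \<infinity>"
    using emeasure_bounded_finite[OF bounded_cball, of 0 R]
    by (simp add: emeasure_restrict_space space_restrict_space)
  define e' where "e' = e / (2 * 2 powr p)"
  have e': "e' > 0" using e by (simp add: e'_def)
  have pw: "(\<lambda>k. \<bar>h k\<bar> powr p) \<longlonglongrightarrow> 0" if "h \<longlonglongrightarrow> 0" for h :: "nat \<Rightarrow> real"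
    using tendsto_powr2[OF tendsto_rabs_zero[OF that] tendsto_const[of p]] p
    by (auto simp: powr_0)
  have "(\<lambda>m::nat. \<integral>\<^sup>+x. ennreal (norm (0 - \<bar>f x - clip (real m) (f x)\<bar> powr p)) \<partial>?B) \<longlonglongrightarrow> 0"
  proof (rule nn_integral_dominated_convergence_norm[where w="\<lambda>x. \<bar>f x\<bar> powr p"])
    show "(\<integral>\<^sup>+x. ennreal (\<bar>f x\<bar> powr p) \<partial>?B) < \<infinity>" using fin by (simp add: Lp_int_def)
    show "AE x in ?B. (\<lambda>m. \<bar>f x - clip (real m) (f x)\<bar> powr p) \<longlonglongrightarrow> 0"
    proof (intro AE_I2 pw)
      fix x
      obtain m0 :: nat where m0: "\<bar>f x\<bar> \<le> real m0" using real_arch_simple by blast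
      have "eventually (\<lambda>m. f x - clip (real m) (f x) = 0) sequentially"
        using eventually_ge_at_top[of m0] by eventually_elim (use m0 in \<open>auto simp: clip_def\<close>)
      then show "(\<lambda>m. f x - clip (real m) (f x)) \<longlonglongrightarrow> 0"
        by (rule tendsto_eventually)
    qed
    show "AE x in ?B. norm (\<bar>f x - clip (real m) (f x)\<bar> powr p) \<le> \<bar>f x\<bar> powr p" for m
      using p by (intro AE_I2) (auto intro!: powr_mono2 clip_diff_le)
    show "(\<lambda>x. \<bar>f x - clip (real m) (f x)\<bar> powr p) \<in> borel_measurable ?B" for m
      by (rule borel_measurable_restrict_lborel) measurable
    show "(\<lambda>x. \<bar>f x\<bar> powr p) \<in> borel_measurable ?B"
      by (rule borel_measurable_restrict_lborel) measurable
  qed simp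
  then have "eventually (\<lambda>m::nat. (\<integral>\<^sup>+x. ennreal (norm (0 - \<bar>f x - clip (real m) (f x)\<bar> powr p)) \<partial>?B) < ennreal e') sequentially"
    using e' by (intro order_tendstoD) auto
  then obtain m :: nat where m: "Lp_int ?B p (\<lambda>x. f x - clip (real m) (f x)) < ennreal e'"
    unfolding Lp_int_def by (auto simp: eventually_sequentially)
  have "f measurable_on UNIV"
    by (rule lebesgue_measurable_imp_measurable_on) (rule measurable_completion, simp_all)
  then obtain N g where N: "negligible N" and g: "\<And>n. continuous_on UNIV (g n)"
    "\<And>x. x \<notin> N \<Longrightarrow> (\<lambda>n. g n x) \<longlonglongrightarrow> f x"
    unfolding measurable_on_def by auto
  have [measurable]: "g n \<in> borel_measurable borel" for n
    by (rule borel_measurable_continuous_onI[OF g(1)])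
  from N have "N \<in> null_sets lebesgue" by (simp add: negligible_iff_null_sets)
  then obtain N' where N': "N' \<in> null_sets lborel" "N \<subseteq> N'"
    using null_sets_completion_iff2[of N lborel] by blast
  have "AE x in lborel. x \<notin> N'" by (rule AE_not_in[OF N'(1)])
  then have "AE x in lborel. x \<notin> N"
    by eventually_elim (use N'(2) in blast)
  then have AEN: "AE x in ?B. x \<notin> N" by (auto simp: AE_restrict_space_iff elim: eventually_mono)
  have "(\<lambda>n. \<integral>\<^sup>+x. ennreal (norm (0 - \<bar>clip (real m) (f x) - clip (real m) (g n x)\<bar> powr p)) \<partial>?B) \<longlonglongrightarrow> 0"
  proof (rule nn_integral_dominated_convergence_norm[where w="\<lambda>x. (2 * real m) powr p"])
    show "(\<integral>\<^sup>+x. ennreal ((2 * real m) powr p) \<partial>?B) < \<infinity>"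
      using finB unfolding nn_integral_const infinity_ennreal_def
      by (subst ennreal_mult_less_top) simp
    show "AE x in ?B. norm (\<bar>clip (real m) (f x) - clip (real m) (g n x)\<bar> powr p) \<le> (2 * real m) powr p" for n
    proof (intro AE_I2)
      fix x
      have "\<bar>clip (real m) (f x) - clip (real m) (g n x)\<bar> \<le> 2 * real m"
        using clip_abs_le[of "real m" "f x"] clip_abs_le[of "real m" "g n x"] by linarith
      then show "norm (\<bar>clip (real m) (f x) - clip (real m) (g n x)\<bar> powr p) \<le> (2 * real m) powr p"
        using p by (auto intro!: powr_mono2)
    qed
    show "AE x in ?B. (\<lambda>n. \<bar>clip (real m) (f x) - clip (real m) (g n x)\<bar> powr p) \<longlonglongrightarrow> 0"
      using AEN
    proof eventually_elim
      case (elim x)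
      have "(\<lambda>n. clip (real m) (f x) - clip (real m) (g n x)) \<longlonglongrightarrow> clip (real m) (f x) - clip (real m) (f x)"
        unfolding clip_def using g(2)[OF elim] by (intro tendsto_intros)
      then show ?case by (intro pw) simp
    qed
    show "(\<lambda>x. \<bar>clip (real m) (f x) - clip (real m) (g n x)\<bar> powr p) \<in> borel_measurable ?B" for n
      by (rule borel_measurable_restrict_lborel) measurable
  qed simp_all
  then have "eventually (\<lambda>n. (\<integral>\<^sup>+x. ennreal (norm (0 - \<bar>clip (real m) (f x) - clip (real m) (g n x)\<bar> powr p)) \<partial>?B) < ennreal e') sequentially"
    using e' by (intro order_tendstoD) auto
  then obtain n where n: "Lp_int ?B p (\<lambda>x. clip (real m) (f x) - clip (real m) (g n x)) < ennreal e'"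
    unfolding Lp_int_def by (auto simp: eventually_sequentially)
  let ?a = "\<lambda>x. f x - clip (real m) (f x)" and ?b = "\<lambda>x. clip (real m) (f x) - clip (real m) (g n x)"
  have "Lp_int ?B p (\<lambda>x. ?a x + ?b x) \<le> ennreal (2 powr p) * (Lp_int ?B p ?a + Lp_int ?B p ?b)"
    by (intro Lp_int_add_le borel_measurable_restrict_lborel) (measurable, use p in simp)
  also have "\<dots> < ennreal (2 powr p) * (ennreal e' + ennreal e')"
  proof (rule ennreal_mult_strict_left_mono)
    show "Lp_int ?B p ?a + Lp_int ?B p ?b < ennreal e' + ennreal e'"
      by (rule add_strict_mono[OF m n])
  qed auto
  also have "\<dots> = ennreal e" using e' by (simp add: e'_def flip: ennreal_plus ennreal_mult)
  finally have "Lp_int ?B p (\<lambda>x. f x - clip (real m) (g n x)) < ennreal e" by simp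
  moreover have "continuous_on UNIV (\<lambda>x. clip (real m) (g n x))"
    by (intro continuous_on_clip g)
  ultimately show ?thesis using that by blast
qed

lemma norm_diag_affine_diff_le:
  fixes x b :: "real^'n"
  assumes "\<And>l. \<bar>d l - 1\<bar> \<le> \<eta>" "norm b \<le> \<eta>" "norm x \<le> R"
  shows "norm (diag_affine d b x - x) \<le> \<eta> * (real CARD('n) * R + 1)"
proof -
  have "norm (diag_affine d b x - x) = norm ((\<chi> l. (d l - 1) * x $ l) + b)"
    by (rule arg_cong[where f=norm]) (simp add: vec_eq_iff algebra_simps)
  also have "\<dots> \<le> norm (\<chi> l. (d l - 1) * x $ l) + norm b" by (rule norm_triangle_ineq)
  also have "norm (\<chi> l. (d l - 1) * x $ l) \<le> (\<Sum>l\<in>UNIV. \<bar>(d l - 1) * x $ l\<bar>)"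
    using norm_le_l1_cart[of "\<chi> l. (d l - 1) * x $ l"] by simp
  also have "\<dots> \<le> (\<Sum>l\<in>(UNIV::'n set). \<eta> * R)"
  proof (rule sum_mono)
    fix l
    have "\<bar>x $ l\<bar> \<le> R" using component_le_norm_cart[of x l] assms(3) by linarith
    then show "\<bar>(d l - 1) * x $ l\<bar> \<le> \<eta> * R"
      unfolding abs_mult using assms(1)[of l] by (intro mult_mono) auto
  qed
  finally show ?thesis using assms(2) by (simp add: algebra_simps)
qed

text \<open>
  The generalisation of the continuity of translations in \<open>L\<^sup>p\<close>: it is clear for a uniformly
  continuous function, and replacing \<open>f\<close> by such a function costs a small error in \<open>L\<^sup>p\<close>,
  which the affine map increases by at most the factor \<open>2\<^sup>n\<close>.
\<close>

lemma Lp_affine_continuity: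
  fixes f :: "real^'n \<Rightarrow> real"
  assumes f[measurable]: "f \<in> borel_measurable borel" and p: "p > 0"
    and fin: "Lp_int lborel p f < \<infinity>" and e: "e > 0" and R: "R > 0"
  obtains \<eta> where "\<eta> > 0"
    "\<And>d b. (\<And>l. \<bar>d l - 1\<bar> < \<eta>) \<Longrightarrow> norm b < \<eta> \<Longrightarrow>
       Lp_int (restrict_space lborel (cball 0 R)) p (\<lambda>x. f (diag_affine d b x) - f x) \<le> ennreal e"
proof -
  let ?B = "\<lambda>R. restrict_space lborel (cball (0::real^'n) R)"
  have [measurable]: "cball (0::real^'n) R' \<in> sets borel" for R' by simp
  have mono: "Lp_int (?B R') p h \<le> Lp_int lborel p h" for R' and h :: "real^'n \<Rightarrow> real"
    unfolding Lp_int_def by (simp add: nn_integral_restrict_space) (intro nn_integral_mono, auto simp: indicator_def)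
  define c where "c = 2 powr p * (2 powr p * (2 ^ CARD('n) + 1) + 1)"
  have c: "c > 0" by (simp add: c_def add_pos_pos)
  define e1 where "e1 = e / c"
  have e1: "e1 > 0" using e c by (simp add: e1_def)
  obtain \<phi> where \<phi>: "continuous_on UNIV \<phi>" "Lp_int (?B (R + 1)) p (\<lambda>x. f x - \<phi> x) < ennreal e1"
    using continuous_approx_Lp[OF f p le_less_trans[OF mono fin] e1] by metis
  have [measurable]: "\<phi> \<in> borel_measurable borel" by (rule borel_measurable_continuous_onI[OF \<phi>(1)])
  define V where "V = measure lborel (cball (0::real^'n) R)"
  have V: "emeasure lborel (cball (0::real^'n) R) = ennreal V"
    unfolding V_def using emeasure_lborel_cball_finite[of "0::real^'n" R]
    by (simp add: emeasure_eq_ennreal_measure)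
  have V0: "0 \<le> V" by (simp add: V_def)
  define w where "w = (e1 / (V + 1)) powr (1 / p)"
  have w: "w > 0" "w powr p * V \<le> e1"
  proof -
    show "w > 0" using e1 V0 by (simp add: w_def add_nonneg_pos)
    have "w powr p = e1 / (V + 1)" using e1 V0 p by (simp add: w_def powr_powr)
    then have eq: "w powr p * (V + 1) = e1" using V0 by (simp add: nonzero_eq_divide_eq)
    have "w powr p * V \<le> w powr p * (V + 1)" by (intro mult_left_mono) auto
    then show "w powr p * V \<le> e1" unfolding eq .
  qed
  have "uniformly_continuous_on (cball 0 (R + 1)) \<phi>"
    by (intro compact_uniformly_continuous continuous_on_subset[OF \<phi>(1)]) auto
  then obtain s where s: "s > 0" "\<And>x y. x \<in> cball 0 (R + 1) \<Longrightarrow> y \<in> cball 0 (R + 1) \<Longrightarrow> dist y x < s \<Longrightarrow> dist (\<phi> y) (\<phi> x) < w"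
    unfolding uniformly_continuous_on_def using w(1) by metis
  define K where "K = real CARD('n) * R + 1"
  have K: "K \<ge> 1" using R by (simp add: K_def)
  define \<eta> where "\<eta> = min (1 / 2) (min (1 / K) (s / (2 * K)))"
  have \<eta>: "\<eta> > 0" "\<eta> \<le> 1 / 2" "\<eta> * K \<le> 1" "\<eta> * K < s"
  proof -
    show "\<eta> > 0" using s K by (simp add: \<eta>_def)
    show "\<eta> \<le> 1 / 2" by (simp add: \<eta>_def)
    have "\<eta> \<le> 1 / K" "\<eta> \<le> s / (2 * K)" by (simp_all add: \<eta>_def)
    then show "\<eta> * K \<le> 1" "\<eta> * K < s" using K s by (auto simp: field_simps)
  qed
  show ?thesis
  proof (rule that[OF \<eta>(1)])
    fix d :: "'n \<Rightarrow> real" and b :: "real^'n" assume d: "\<And>l. \<bar>d l - 1\<bar> < \<eta>" and b: "norm b < \<eta>"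
    let ?A = "diag_affine d b"
    have near: "norm (?A x - x) \<le> \<eta> * K" if "norm x \<le> R" for x
      unfolding K_def using d b that by (intro norm_diag_affine_diff_le) (auto intro: less_imp_le)
    have AR: "?A x \<in> cball 0 (R + 1)" if "norm x \<le> R" for x
      using near[OF that] \<eta>(3) that norm_triangle_sub[of "?A x" x] by simp
    have d2: "d l \<ge> 1 / 2" for l using d[of l] \<eta>(2) by linarith
    have 1: "Lp_int (?B R) p (\<lambda>x. f (?A x) - \<phi> (?A x)) \<le> ennreal (2 ^ CARD('n) * e1)"
    proof -
      let ?h = "\<lambda>y. ennreal (norm (f y - \<phi> y) powr p) * indicator (cball 0 (R + 1)) y"
      have "Lp_int (?B R) p (\<lambda>x. f (?A x) - \<phi> (?A x)) \<le> (\<integral>\<^sup>+x. ?h (?A x) \<partial>lborel)"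
        unfolding Lp_int_def using AR
        by (simp add: nn_integral_restrict_space) (intro nn_integral_mono, auto simp: indicator_def)
      also have "\<dots> \<le> ennreal (2 ^ CARD('n)) * (\<integral>\<^sup>+x. ?h x \<partial>lborel)"
        by (intro nn_integral_diag_affine_le d2) measurable
      also have "(\<integral>\<^sup>+x. ?h x \<partial>lborel) = Lp_int (?B (R + 1)) p (\<lambda>x. f x - \<phi> x)"
        unfolding Lp_int_def by (simp add: nn_integral_restrict_space)
      also have "ennreal (2 ^ CARD('n)) * \<dots> \<le> ennreal (2 ^ CARD('n)) * ennreal e1"
        using \<phi>(2) by (intro mult_left_mono) auto
      finally show ?thesis using e1 by (simp add: ennreal_mult)
    qed
    have 2: "Lp_int (?B R) p (\<lambda>x. \<phi> (?A x) - \<phi> x) \<le> ennreal e1"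
    proof -
      have "Lp_int (?B R) p (\<lambda>x. \<phi> (?A x) - \<phi> x) \<le> (\<integral>\<^sup>+x. ennreal (w powr p) * indicator (cball (0::real^'n) R) x \<partial>lborel)"
        unfolding Lp_int_def
      proof (rule order_trans[OF eq_refl[OF nn_integral_restrict_space] nn_integral_mono])
        show "cball (0::real^'n) R \<inter> space lborel \<in> sets lborel" by simp
        fix x :: "real^'n"
        show "ennreal (norm (\<phi> (?A x) - \<phi> x) powr p) * indicator (cball 0 R) x \<le> ennreal (w powr p) * indicator (cball 0 R) x"
        proof (cases "norm x \<le> R")
          case True
          have "dist (\<phi> (?A x)) (\<phi> x) < w"
            using s(2)[of x "?A x"] AR[OF True] near[OF True] \<eta>(4) True by (auto simp: dist_norm)
          then show ?thesis using True p by (auto simp: dist_real_def intro!: ennreal_leI powr_mono2)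
        qed (auto simp: indicator_def)
      qed
      also have "\<dots> = ennreal (w powr p * V)" using V0 by (simp add: nn_integral_cmult V ennreal_mult)
      finally show ?thesis using w(2) by (meson ennreal_leI order_trans)
    qed
    have 3: "Lp_int (?B R) p (\<lambda>x. \<phi> x - f x) \<le> ennreal e1"
    proof -
      have "Lp_int (?B R) p (\<lambda>x. \<phi> x - f x) \<le> Lp_int (?B (R + 1)) p (\<lambda>x. f x - \<phi> x)"
        unfolding Lp_int_minus_commute[of _ _ \<phi>] unfolding Lp_int_def
        by (simp add: nn_integral_restrict_space) (intro nn_integral_mono, auto simp: indicator_def)
      then show ?thesis using \<phi>(2) by (meson less_imp_le order_trans)
    qed
    have "Lp_int (?B R) p (\<lambda>x. ((f (?A x) - \<phi> (?A x)) + (\<phi> (?A x) - \<phi> x)) + (\<phi> x - f x)) \<le>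
        ennreal (2 powr p) * (Lp_int (?B R) p (\<lambda>x. (f (?A x) - \<phi> (?A x)) + (\<phi> (?A x) - \<phi> x)) + Lp_int (?B R) p (\<lambda>x. \<phi> x - f x))"
      by (intro Lp_int_add_le borel_measurable_restrict_lborel) (measurable, use p in simp)
    also have "\<dots> \<le> ennreal (2 powr p) * (ennreal (2 powr p) * (ennreal (2 ^ CARD('n) * e1) + ennreal e1) + ennreal e1)"
    proof (intro mult_left_mono add_mono 3)
      have "Lp_int (?B R) p (\<lambda>x. (f (?A x) - \<phi> (?A x)) + (\<phi> (?A x) - \<phi> x)) \<le>
          ennreal (2 powr p) * (Lp_int (?B R) p (\<lambda>x. f (?A x) - \<phi> (?A x)) + Lp_int (?B R) p (\<lambda>x. \<phi> (?A x) - \<phi> x))"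
        by (intro Lp_int_add_le borel_measurable_restrict_lborel) (measurable, use p in simp)
      also have "\<dots> \<le> ennreal (2 powr p) * (ennreal (2 ^ CARD('n) * e1) + ennreal e1)"
        by (intro mult_left_mono add_mono 1 2) auto
      finally show "Lp_int (?B R) p (\<lambda>x. (f (?A x) - \<phi> (?A x)) + (\<phi> (?A x) - \<phi> x)) \<le> \<dots>" .
    qed auto
    also have "\<dots> = ennreal (c * e1)"
      using e1 by (simp add: c_def algebra_simps flip: ennreal_plus ennreal_mult)
    also have "c * e1 = e" using c by (simp add: e1_def)
    finally show "Lp_int (?B R) p (\<lambda>x. f (?A x) - f x) \<le> ennreal e" by simp
  qed
qed

lemma moll_shift:
  fixes r f :: "real^'n \<Rightarrow> real"
  assumes [measurable]: "r \<in> borel_measurable borel" "f \<in> borel_measurable borel"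
  shows "moll r f x = (\<integral>z. r z * f (x - z) \<partial>lborel)"
proof -
  have "lborel = distr lborel borel (\<lambda>z::real^'n. x - z)"
    using lborel_affine[of "-1" x] by (simp add: density_1)
  then have "moll r f x = (\<integral>y. r (x - y) * f y \<partial>(distr lborel borel (\<lambda>z. x - z)))"
    by (simp add: moll_def)
  also have "\<dots> = (\<integral>z. r z * f (x - z) \<partial>lborel)"
    by (subst integral_distr) (simp_all add: measurable_lborel1)
  finally show ?thesis .
qed

text \<open>
  By Jensen's inequality for the probability density \<open>r\<close>, the error is at most the average
  over \<open>|z| < \<delta>\<close> of the distances between \<open>f\<close> and its compositions with \<open>x \<mapsto> A x - z\<close>. These
  are again diagonal affine maps close to the identity.
\<close>

lemma moll_diag_affine_converges:
  fixes f :: "real^'n \<Rightarrow> real"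
  assumes f[measurable]: "f \<in> borel_measurable borel" and int: "integrable lborel f" and p: "p > 1"
    and fin: "Lp_int lborel p f < \<infinity>" and e: "e > 0" and R: "R > 0"
  obtains \<eta> where "\<eta> > 0"
    "\<And>d b \<delta> r. (\<And>l. \<bar>d l - 1\<bar> < \<eta>) \<Longrightarrow> norm b < \<eta> \<Longrightarrow> \<delta> < \<eta> \<Longrightarrow> mollifier \<delta> r \<Longrightarrow>
       Lp_int (restrict_space lborel (cball 0 R)) p (\<lambda>x. moll r f (diag_affine d b x) - f x) \<le> ennreal e"
proof -
  let ?B = "restrict_space lborel (cball (0::real^'n) R)"
  have [measurable]: "cball (0::real^'n) R \<in> sets borel" by simp
  obtain \<eta> where \<eta>: "\<eta> > 0" and cont:
    "\<And>d b. (\<And>l. \<bar>d l - 1\<bar> < \<eta>) \<Longrightarrow> norm b < \<eta> \<Longrightarrow>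
       Lp_int ?B p (\<lambda>x. f (diag_affine d b x) - f x) \<le> ennreal e"
    by (rule Lp_affine_continuity[OF f _ fin e R]) (use p in simp, rule that, assumption, blast)
  show ?thesis
  proof (rule that[of "\<eta> / 2"])
    fix d :: "'n \<Rightarrow> real" and b :: "real^'n" and \<delta> and r :: "real^'n \<Rightarrow> real"
    assume d: "\<And>l. \<bar>d l - 1\<bar> < \<eta> / 2" and b: "norm b < \<eta> / 2" and \<delta>: "\<delta> < \<eta> / 2" and r: "mollifier \<delta> r"
    let ?A = "diag_affine d b"
    from r have rs: "smooth r" and r0: "\<And>x. 0 \<le> r x" and rv: "vanishes_outside \<delta> r"
      and ri: "integrable lborel r" "(\<integral>x. r x \<partial>lborel) = 1" by (auto simp: mollifier_def)
    have rc: "continuous_on UNIV r" by (rule smooth_continuous[OF rs])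
    have [measurable]: "r \<in> borel_measurable borel" by (rule borel_measurable_continuous_onI[OF rc])
    let ?M = "density lborel (\<lambda>z. ennreal (r z))"
    have M1: "emeasure ?M (space ?M) = ennreal 1"
      using ri r0 by (simp add: emeasure_density nn_integral_eq_integral)
    have ir: "integrable lborel (\<lambda>z. r z * f (y - z))" for y :: "real^'n"
    proof -
      have "integrable (distr lborel borel (\<lambda>z::real^'n. y - z)) (\<lambda>w. r (y - w) * f w)"
        using integrable_moll[OF int rc rv, of y] lborel_affine[of "-1" y] by (simp add: density_1)
      then show ?thesis by (subst (asm) integrable_distr_eq) (simp_all add: measurable_lborel1)
    qed
    have pt: "ennreal (\<bar>moll r f (?A x) - f x\<bar> powr p) \<le>
        (\<integral>\<^sup>+z. ennreal (r z) * ennreal (\<bar>f (?A x - z) - f x\<bar> powr p) \<partial>lborel)" for x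
    proof -
      have "moll r f (?A x) - f x = (\<integral>z. r z * f (?A x - z) \<partial>lborel) - (\<integral>z. r z * f x \<partial>lborel)"
        using ri by (simp add: moll_shift)
      also have "\<dots> = (\<integral>z. r z * (f (?A x - z) - f x) \<partial>lborel)"
        using ir ri by (simp add: right_diff_distrib)
      also have "\<dots> = (\<integral>z. f (?A x - z) - f x \<partial>?M)"
        using r0 by (subst integral_real_density) auto
      finally have "ennreal (\<bar>moll r f (?A x) - f x\<bar> powr p) = ennreal (\<bar>\<integral>z. f (?A x - z) - f x \<partial>?M\<bar> powr p)" by simp
      also have "\<dots> \<le> ennreal (1 powr (p - 1)) * (\<integral>\<^sup>+z. ennreal (\<bar>f (?A x - z) - f x\<bar> powr p) \<partial>?M)"
        by (rule powr_integral_le[OF p _ M1]) auto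
      also have "\<dots> = (\<integral>\<^sup>+z. ennreal (r z) * ennreal (\<bar>f (?A x - z) - f x\<bar> powr p) \<partial>lborel)"
        by (simp add: nn_integral_density)
      finally show ?thesis .
    qed
    have "Lp_int ?B p (\<lambda>x. moll r f (?A x) - f x) =
        (\<integral>\<^sup>+x. ennreal (\<bar>moll r f (?A x) - f x\<bar> powr p) * indicator (cball 0 R) x \<partial>lborel)"
      by (simp add: Lp_int_def nn_integral_restrict_space)
    also have "\<dots> \<le> (\<integral>\<^sup>+x. (\<integral>\<^sup>+z. ennreal (r z) * ennreal (\<bar>f (?A x - z) - f x\<bar> powr p) \<partial>lborel) * indicator (cball 0 R) x \<partial>lborel)"
      by (intro nn_integral_mono mult_right_mono pt) auto
    also have "\<dots> = (\<integral>\<^sup>+x. (\<integral>\<^sup>+z. ennreal (r z) * (ennreal (\<bar>f (?A x - z) - f x\<bar> powr p) * indicator (cball 0 R) x) \<partial>lborel) \<partial>lborel)"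
      by (subst nn_integral_multc[symmetric]) (auto simp: mult.assoc)
    also have "\<dots> = (\<integral>\<^sup>+z. (\<integral>\<^sup>+x. ennreal (r z) * (ennreal (\<bar>f (?A x - z) - f x\<bar> powr p) * indicator (cball 0 R) x) \<partial>lborel) \<partial>lborel)"
      by (rule lborel_pair.Fubini') measurable
    also have "\<dots> \<le> (\<integral>\<^sup>+z. ennreal (r z) * ennreal e \<partial>lborel)"
    proof (rule nn_integral_mono)
      fix z
      show "(\<integral>\<^sup>+x. ennreal (r z) * (ennreal (\<bar>f (?A x - z) - f x\<bar> powr p) * indicator (cball 0 R) x) \<partial>lborel) \<le> ennreal (r z) * ennreal e"
      proof (cases "norm z < \<delta>")
        case True
        have nb: "norm (b - z) < \<eta>" using norm_triangle_ineq4[of b z] b \<delta> True by linarith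
        have d': "\<bar>d l - 1\<bar> < \<eta>" for l using d[of l] \<eta> by linarith
        have "Lp_int ?B p (\<lambda>x. f (diag_affine d (b - z) x) - f x) \<le> ennreal e" by (rule cont[OF d' nb])
        moreover have "(\<lambda>x. f (diag_affine d (b - z) x) - f x) = (\<lambda>x. f (?A x - z) - f x)"
          by (simp only: add_diff_eq)
        ultimately have "Lp_int ?B p (\<lambda>x. f (?A x - z) - f x) \<le> ennreal e" by metis
        then have "(\<integral>\<^sup>+x. ennreal (\<bar>f (?A x - z) - f x\<bar> powr p) * indicator (cball 0 R) x \<partial>lborel) \<le> ennreal e"
          unfolding Lp_int_def by (simp add: nn_integral_restrict_space)
        then show ?thesis by (subst nn_integral_cmult) (auto intro!: mult_left_mono)
      next
        case False
        then have "r z = 0" using rv by (simp add: vanishes_outside_def)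
        then show ?thesis by simp
      qed
    qed
    also have "\<dots> = ennreal e" using ri r0 by (simp add: nn_integral_multc nn_integral_eq_integral)
    finally show "Lp_int ?B p (\<lambda>x. moll r f (?A x) - f x) \<le> ennreal e" .
  qed (use \<eta> in simp)
qed

section \<open>Weak gradients\<close>

lemma integrable_in_Lp:
  fixes f :: "'a \<Rightarrow> real"
  assumes "finite_measure M" "in_Lp M p f" "1 \<le> p"
  shows "integrable M f"
proof -
  interpret finite_measure M by fact
  have [measurable]: "f \<in> borel_measurable M" using assms by (simp add: in_Lp_def)
  have i: "integrable M (\<lambda>x. 1 + \<bar>f x\<bar> powr p)"
    using assms(2) by (intro Bochner_Integration.integrable_add integrableI_bounded)
      (auto simp: in_Lp_def Lp_int_def emeasure_eq_measure)
  show ?thesis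
  proof (rule Bochner_Integration.integrable_bound[OF i])
    show "AE x in M. norm (f x) \<le> norm (1 + \<bar>f x\<bar> powr p)"
    proof (rule AE_I2)
      fix x
      have "\<bar>f x\<bar> \<le> 1 + \<bar>f x\<bar> powr p"
      proof (cases "\<bar>f x\<bar> \<le> 1")
        case False
        then have "\<bar>f x\<bar> powr 1 \<le> \<bar>f x\<bar> powr p" using assms(3) by (intro powr_mono) auto
        then show ?thesis using False by simp
      qed (simp add: add_increasing2)
      then show "norm (f x) \<le> norm (1 + \<bar>f x\<bar> powr p)" by simp
    qed
  qed simp
qed

lemma integral_shift:
  fixes f :: "real^'n \<Rightarrow> real"
  assumes [measurable]: "f \<in> borel_measurable borel"
  shows "(\<integral>x. f (x + b) \<partial>lborel) = (\<integral>x. f x \<partial>lborel)"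
proof -
  have "(\<integral>x. f x \<partial>lborel) = (\<integral>x. f x \<partial>(distr lborel borel ((+) b)))"
    by (simp add: lborel_distr_plus)
  also have "\<dots> = (\<integral>x. f (x + b) \<partial>lborel)"
    by (subst integral_distr) (simp_all add: add.commute)
  finally show ?thesis by simp
qed

text \<open>
  The difference quotients of \<open>F\<close> have integral 0 because Lebesgue measure is invariant under
  translations, and they converge boundedly to the partial derivative.
\<close>

lemma integral_partial_deriv_eq_0:
  fixes F :: "real^'n \<Rightarrow> real"
  assumes diff: "\<And>x. F differentiable (at x)" and c: "continuous_on UNIV (partial_deriv i F)"
    and v: "vanishes_outside R F"
  shows "(\<integral>x. partial_deriv i F x \<partial>lborel) = 0"
proof -
  have v': "vanishes_outside (R + 1) (partial_deriv i F)" by (rule vanishes_partial_deriv[OF v])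
  obtain B where B: "\<And>x. norm (partial_deriv i F x) \<le> B" using bounded_vanishing[OF c v'] by blast
  have B0: "0 \<le> B" using B[of 0] norm_ge_zero order_trans by blast
  let ?e = "axis i (1::real)"
  have Fc: "continuous_on UNIV F"
    using diff by (auto simp: continuous_on_eq_continuous_at intro: differentiable_imp_continuous_within)
  have [measurable]: "F \<in> borel_measurable borel" by (rule borel_measurable_continuous_onI[OF Fc])
  have [measurable]: "partial_deriv i F \<in> borel_measurable borel" by (rule borel_measurable_continuous_onI[OF c])
  have Fi: "integrable lborel F" by (rule integrable_continuous_vanishing[OF Fc v])
  have line: "((\<lambda>t. F (x + t *\<^sub>R ?e)) has_real_derivative partial_deriv i F (x + t *\<^sub>R ?e)) (at t)" for x t
  proof -
    have "((\<lambda>t. x + t *\<^sub>R ?e) has_derivative (\<lambda>h. h *\<^sub>R ?e)) (at t)"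
      by (auto intro!: derivative_eq_intros)
    from has_derivative_compose[OF this differentiable_has_grad[OF diff]]
    show ?thesis unfolding has_field_derivative_def
      by (rule has_derivative_eq_rhs) (auto simp: fun_eq_iff grad_def inner_axis)
  qed
  have mvt: "\<bar>F (x + t *\<^sub>R ?e) - F x\<bar> \<le> B * t" if "t \<ge> 0" for x t
  proof -
    have "norm (F (x + t *\<^sub>R ?e) - F (x + 0 *\<^sub>R ?e)) \<le> B * norm (t - 0)"
      by (rule field_differentiable_bound[of UNIV _ "\<lambda>t. partial_deriv i F (x + t *\<^sub>R ?e)"])
         (use line B in auto)
    then show ?thesis using that by simp
  qed
  define h where "h k = 1 / real (Suc k)" for k
  have h: "h k > 0" "h k \<le> 1" for k by (auto simp: h_def)
  define q where "q k x = (F (x + h k *\<^sub>R ?e) - F x) / h k" for k x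
  have [measurable]: "q k \<in> borel_measurable borel" for k unfolding q_def by measurable
  have "(\<lambda>k. \<integral>x. q k x \<partial>lborel) \<longlonglongrightarrow> (\<integral>x. partial_deriv i F x \<partial>lborel)"
  proof (rule integral_dominated_convergence[where w="\<lambda>x. B * indicator (cball 0 (R + 2)) x"])
    show "integrable lborel (\<lambda>x. B * indicator (cball (0::real^'n) (R + 2)) x)"
      using emeasure_bounded_finite[OF bounded_cball, of "0::real^'n" "R + 2"]
      by (intro integrable_mult_right integrable_real_indicator) auto
    show "AE x in lborel. (\<lambda>k. q k x) \<longlonglongrightarrow> partial_deriv i F x"
    proof (rule AE_I2)
      fix x
      have "((\<lambda>t. (F (x + (0 + t) *\<^sub>R ?e) - F (x + 0 *\<^sub>R ?e)) / t) \<longlongrightarrow> partial_deriv i F (x + 0 *\<^sub>R ?e)) (at 0)"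
        using line[of x 0] by (simp add: DERIV_def)
      moreover have "filterlim h (at 0) sequentially"
        unfolding h_def filterlim_at by (auto intro: LIMSEQ_Suc lim_1_over_n simp del: of_nat_Suc)
      ultimately show "(\<lambda>k. q k x) \<longlonglongrightarrow> partial_deriv i F x"
        unfolding q_def by (auto dest: filterlim_compose)
    qed
    show "AE x in lborel. norm (q k x) \<le> B * indicator (cball 0 (R + 2)) x" for k
    proof (rule AE_I2)
      fix x
      show "norm (q k x) \<le> B * indicator (cball 0 (R + 2)) x"
      proof (cases "norm x \<le> R + 2")
        case True
        then show ?thesis using mvt[of "h k" x] h[of k] by (simp add: q_def field_simps)
      next
        case False
        have "norm x \<le> norm (x + h k *\<^sub>R ?e) + norm (h k *\<^sub>R ?e)"
          using norm_triangle_ineq4[of "x + h k *\<^sub>R ?e" "h k *\<^sub>R ?e"] by simp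
        also have "norm (h k *\<^sub>R ?e) \<le> 1" using h[of k] by simp
        finally have "norm (x + h k *\<^sub>R ?e) \<ge> R" using False by simp
        then have "q k x = 0" using v False by (simp add: q_def vanishes_outside_def)
        then show ?thesis using B0 by simp
      qed
    qed
  qed simp_all
  moreover have "(\<integral>x. q k x \<partial>lborel) = 0" for k
  proof -
    have i: "integrable lborel (\<lambda>x. F (x + h k *\<^sub>R ?e))"
    proof (rule integrable_continuous_vanishing[where R="R + 1"])
      show "continuous_on UNIV (\<lambda>x. F (x + h k *\<^sub>R ?e))"
        by (intro continuous_on_compose2[OF Fc] continuous_intros) auto
      show "vanishes_outside (R + 1) (\<lambda>x. F (x + h k *\<^sub>R ?e))"
        unfolding vanishes_outside_def
      proof (intro allI impI)
        fix x :: "real^'n" assume "R + 1 \<le> norm x"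
        moreover have "norm x \<le> norm (x + h k *\<^sub>R ?e) + norm (h k *\<^sub>R ?e)"
          using norm_triangle_ineq4[of "x + h k *\<^sub>R ?e" "h k *\<^sub>R ?e"] by simp
        moreover have "norm (h k *\<^sub>R ?e) \<le> 1" using h[of k] by simp
        ultimately show "F (x + h k *\<^sub>R ?e) = 0" using v by (simp add: vanishes_outside_def)
      qed
    qed
    have "(\<integral>x. q k x \<partial>lborel) = ((\<integral>x. F (x + h k *\<^sub>R ?e) \<partial>lborel) - (\<integral>x. F x \<partial>lborel)) / h k"
      unfolding q_def using i Fi by simp
    then show ?thesis by (simp add: integral_shift)
  qed
  ultimately show ?thesis by (simp add: LIMSEQ_const_iff)
qed

lemma test_function_vanishes:
  assumes "test_function \<Omega> \<phi>"
  obtains R where "vanishes_outside R \<phi>"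
proof -
  have "bounded (closure {x. \<phi> x \<noteq> 0})" using assms by (simp add: test_function_def compact_imp_bounded)
  then obtain R where R: "\<And>x. x \<in> closure {x. \<phi> x \<noteq> 0} \<Longrightarrow> norm x \<le> R" by (auto simp: bounded_iff)
  have "\<phi> x = 0" if "R + 1 \<le> norm x" for x
    using R[of x] that closure_subset[of "{x. \<phi> x \<noteq> 0}"] by fastforce
  then show ?thesis by (intro that[of "R + 1"]) (auto simp: vanishes_outside_def)
qed

lemma test_function_zero_outside:
  assumes "test_function \<Omega> \<phi>" "x \<notin> \<Omega>"
  shows "\<phi> x = 0" "partial_deriv i \<phi> x = 0"
proof -
  let ?K = "closure {x. \<phi> x \<noteq> 0}"
  have x: "x \<notin> ?K" using assms by (auto simp: test_function_def)
  then show "\<phi> x = 0" using closure_subset[of "{x. \<phi> x \<noteq> 0}"] by auto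
  have "((\<lambda>x. 0::real) has_derivative (\<lambda>h. 0)) (at x)" by simp
  then have "(\<phi> has_derivative (\<lambda>h. 0)) (at x)"
    by (rule has_derivative_transform_within_open[of _ _ _ _ "- ?K"])
       (use x closure_subset[of "{x. \<phi> x \<noteq> 0}"] in auto)
  from partial_deriv_eq[OF this] show "partial_deriv i \<phi> x = 0" by simp
qed

locale sobolev_domain =
  fixes \<Omega> :: "(real^'n) set" and p :: real
  assumes open_dom: "open \<Omega>" and bounded_dom: "bounded \<Omega>" and p_gt_1: "p > 1"
begin

lemma sets_dom [measurable, simp]: "\<Omega> \<in> sets borel" "\<Omega> \<in> sets lebesgue"
  using open_dom by auto

lemma dom_subset_cball:
  obtains R where "R > 0" "\<Omega> \<subseteq> cball 0 R"
proof -
  obtain R where "0 < R" "\<Omega> \<subseteq> ball 0 R" using bounded_subset_ballD[OF bounded_dom, of 0] by auto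
  then show ?thesis using ball_subset_cball[of 0 R] by (intro that[of R]) auto
qed

lemma emeasure_dom_finite: "emeasure lebesgue \<Omega> < \<infinity>"
  using emeasure_bounded_finite[OF bounded_dom] by simp

lemma finite_measure_dom: "finite_measure (lebesgue_on \<Omega>)"
  using emeasure_dom_finite
  by (intro finite_measureI) (simp add: emeasure_restrict_space space_restrict_space)

lemma borel_measurable_dom: "h \<in> borel_measurable borel \<Longrightarrow> h \<in> borel_measurable (lebesgue_on \<Omega>)"
  by (intro measurable_restrict_space1 measurable_completion) simp

text \<open>
  A Borel function on the whole space that vanishes off \<open>\<Omega>\<close> and represents \<open>u\<close>. Integrals
  over \<open>\<Omega>\<close> with respect to the completed measure become integrals with respect to \<open>lborel\<close>,
  for which Fubini's theorem is available.
\<close>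

definition borel_rep :: "(real^'n \<Rightarrow> real) \<Rightarrow> (real^'n \<Rightarrow> real) \<Rightarrow> bool" where
  "borel_rep u f \<longleftrightarrow> f \<in> borel_measurable borel \<and> (\<forall>x. x \<notin> \<Omega> \<longrightarrow> f x = 0) \<and>
     (AE x in lebesgue_on \<Omega>. u x = f x)"

lemma borel_rep_exists:
  assumes "u \<in> borel_measurable (lebesgue_on \<Omega>)"
  obtains f where "borel_rep u f"
proof -
  have "(\<lambda>x. if x \<in> \<Omega> then u x else 0) \<in> borel_measurable lebesgue"
    using assms by (simp add: borel_measurable_if)
  from completion_ex_borel_measurable_real[OF this] obtain g where
    g: "g \<in> borel_measurable lborel" "AE x in lborel. (if x \<in> \<Omega> then u x else 0) = g x" by blast
  have gm[measurable]: "g \<in> borel_measurable borel" using g(1) by simp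
  have "AE x in lebesgue. x \<in> \<Omega> \<longrightarrow> u x = indicator \<Omega> x * g x"
    using AE_completion[OF g(2)] by eventually_elim (auto simp: indicator_def split: if_splits)
  then have "borel_rep u (\<lambda>x. indicator \<Omega> x * g x)"
    unfolding borel_rep_def by (auto simp: AE_restrict_space_iff)
  then show ?thesis by (rule that)
qed

lemma borel_rep_Lp_int:
  assumes "borel_rep u f"
  shows "Lp_int (lebesgue_on \<Omega>) p u = Lp_int lborel p f"
proof -
  have "Lp_int (lebesgue_on \<Omega>) p u = Lp_int (lebesgue_on \<Omega>) p f"
    using assms by (intro Lp_int_cong_AE) (simp add: borel_rep_def)
  also have "\<dots> = (\<integral>\<^sup>+x. ennreal (norm (f x) powr p) * indicator \<Omega> x \<partial>lborel)"
    by (simp add: Lp_int_def nn_integral_restrict_space nn_integral_completion)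
  also have "\<dots> = Lp_int lborel p f"
    unfolding Lp_int_def using assms by (intro nn_integral_cong) (auto simp: borel_rep_def indicator_def)
  finally show ?thesis .
qed

lemma borel_rep_integral:
  assumes "borel_rep u f" "u \<in> borel_measurable (lebesgue_on \<Omega>)" and [measurable]: "h \<in> borel_measurable borel"
  shows "(\<integral>x. u x * h x \<partial>lebesgue_on \<Omega>) = (\<integral>x. f x * h x \<partial>lborel)"
proof -
  have [measurable]: "f \<in> borel_measurable borel" using assms by (simp add: borel_rep_def)
  have "(\<integral>x. u x * h x \<partial>lebesgue_on \<Omega>) = (\<integral>x. f x * h x \<partial>lebesgue_on \<Omega>)"
  proof (rule integral_cong_AE)
    show "(\<lambda>x. u x * h x) \<in> borel_measurable (lebesgue_on \<Omega>)"
      by (intro borel_measurable_times assms(2) borel_measurable_dom assms(3))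
    show "(\<lambda>x. f x * h x) \<in> borel_measurable (lebesgue_on \<Omega>)"
      by (intro borel_measurable_dom) measurable
    show "AE x in lebesgue_on \<Omega>. u x * h x = f x * h x"
      using assms(1) by (auto simp: borel_rep_def elim: eventually_mono)
  qed
  also have "\<dots> = (\<integral>x. indicator \<Omega> x * (f x * h x) \<partial>lebesgue)"
    by (subst integral_restrict_space) auto
  also have "\<dots> = (\<integral>x. indicator \<Omega> x * (f x * h x) \<partial>lborel)"
    by (subst integral_completion) auto
  also have "\<dots> = (\<integral>x. f x * h x \<partial>lborel)"
    using assms(1) by (intro Bochner_Integration.integral_cong) (auto simp: borel_rep_def indicator_def)
  finally show ?thesis .
qed

lemma borel_rep_integrable:
  assumes "borel_rep u f" "in_Lp (lebesgue_on \<Omega>) p u"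
  shows "integrable lborel f"
proof -
  have [measurable]: "f \<in> borel_measurable borel" using assms by (simp add: borel_rep_def)
  have "AE x in lebesgue_on \<Omega>. u x = f x" using assms(1) by (simp add: borel_rep_def)
  from Lp_int_cong_AE[OF this, of p] have "in_Lp (lebesgue_on \<Omega>) p f"
    unfolding in_Lp_def using assms(2) borel_measurable_dom[of f]
    by (metis \<open>f \<in> borel_measurable borel\<close> in_Lp_def)
  then have "integrable (lebesgue_on \<Omega>) f"
    using p_gt_1 by (intro integrable_in_Lp[OF finite_measure_dom]) auto
  then have "integrable lebesgue (\<lambda>x. indicator \<Omega> x *\<^sub>R f x)"
    by (subst (asm) integrable_restrict_space) auto
  also have "(\<lambda>x. indicator \<Omega> x *\<^sub>R f x) = f"
    using assms(1) by (auto simp: borel_rep_def indicator_def fun_eq_iff)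
  finally show ?thesis by (simp add: integrable_completion)
qed

lemma in_Lp_continuous:
  fixes f :: "real^'n \<Rightarrow> 'b::real_normed_vector"
  assumes "continuous_on UNIV f"
  shows "in_Lp (lebesgue_on \<Omega>) p f"
proof -
  obtain R where R: "\<Omega> \<subseteq> cball 0 R" by (rule dom_subset_cball)
  have "bounded (f ` cball 0 R)"
    by (intro compact_imp_bounded compact_continuous_image continuous_on_subset[OF assms]) auto
  then obtain B where B: "\<And>x. x \<in> \<Omega> \<Longrightarrow> norm (f x) \<le> B" using R by (auto simp: bounded_iff)
  have "Lp_int (lebesgue_on \<Omega>) p f \<le> (\<integral>\<^sup>+x. ennreal (B powr p) \<partial>lebesgue_on \<Omega>)"
    unfolding Lp_int_def using B p_gt_1
    by (intro nn_integral_mono ennreal_leI powr_mono2) (auto simp: space_restrict_space)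
  also have "\<dots> < \<infinity>"
    using finite_measure.emeasure_finite[OF finite_measure_dom]
    by (simp add: ennreal_mult_less_top less_top)
  finally show ?thesis
    using borel_measurable_dom[OF borel_measurable_continuous_onI[OF assms]] by (simp add: in_Lp_def)
qed

lemma integrable_mult_test:
  assumes "in_Lp (lebesgue_on \<Omega>) p u" "continuous_on UNIV h" "vanishes_outside R h"
  shows "integrable (lebesgue_on \<Omega>) (\<lambda>x. u x * h x :: real)"
proof -
  obtain B where B: "\<And>x. norm (h x) \<le> B" using bounded_vanishing[OF assms(2,3)] by blast
  then have B0: "0 \<le> B" using norm_ge_zero order_trans by blast
  show ?thesis
  proof (rule Bochner_Integration.integrable_bound)
  show "integrable (lebesgue_on \<Omega>) (\<lambda>x. B * u x)"
    using p_gt_1 by (intro integrable_mult_right integrable_in_Lp[OF finite_measure_dom assms(1)]) auto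
  show "(\<lambda>x. u x * h x) \<in> borel_measurable (lebesgue_on \<Omega>)"
    using assms(1) borel_measurable_dom[OF borel_measurable_continuous_onI[OF assms(2)]]
    by (intro borel_measurable_times) (simp_all add: in_Lp_def)
  show "AE x in lebesgue_on \<Omega>. norm (u x * h x) \<le> norm (B * u x)"
    using B B0 by (auto simp: abs_mult mult.commute intro!: mult_right_mono AE_I2)
  qed
qed

lemma in_Lp_component:
  assumes "in_Lp (lebesgue_on \<Omega>) p (g :: real^'n \<Rightarrow> real^'n)"
  shows "in_Lp (lebesgue_on \<Omega>) p (\<lambda>x. g x $ i)"
proof -
  have c: "(\<lambda>v::real^'n. v $ i) \<in> borel_measurable borel"
    by (intro borel_measurable_continuous_onI continuous_intros)
  have m: "(\<lambda>x. g x $ i) \<in> borel_measurable (lebesgue_on \<Omega>)"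
    using assms by (intro measurable_compose[OF _ c]) (simp add: in_Lp_def)
  have "Lp_int (lebesgue_on \<Omega>) p (\<lambda>x. g x $ i) \<le> Lp_int (lebesgue_on \<Omega>) p g"
    unfolding Lp_int_def using p_gt_1 component_le_norm_cart
    by (intro nn_integral_mono ennreal_leI powr_mono2) auto
  then show ?thesis using assms m by (auto simp: in_Lp_def)
qed

text \<open>
  Testing against \<open>y \<mapsto> r (a - y)\<close> turns the definition of the weak gradient into the
  statement that mollification commutes with differentiation at points farther than \<open>\<delta>\<close> from
  the boundary.
\<close>

lemma moll_partial_deriv_weak:
  assumes w: "is_weak_gradient \<Omega> p u g" and u: "in_Lp (lebesgue_on \<Omega>) p u"
    and f: "borel_rep u f" and \<gamma>: "borel_rep (\<lambda>x. g x $ i) \<gamma>"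
    and r: "mollifier \<delta> r" and a: "cball a \<delta> \<subseteq> \<Omega>"
  shows "moll (partial_deriv i r) f a = moll r \<gamma> a"
proof -
  from r have rs: "smooth r" and rs': "smooth (\<lambda>y. r (a - y))" and rv: "vanishes_outside \<delta> r"
    by (auto simp: mollifier_def)
  let ?\<phi> = "\<lambda>y. r (a - y)"
  have sub: "closure {y. ?\<phi> y \<noteq> 0} \<subseteq> cball a \<delta>"
  proof (rule closure_minimal)
    show "{y. ?\<phi> y \<noteq> 0} \<subseteq> cball a \<delta>"
      using rv by (force simp: vanishes_outside_def dist_norm)
  qed simp
  have test: "test_function \<Omega> ?\<phi>"
    unfolding test_function_def
  proof (intro conjI rs')
    have "bounded {y. ?\<phi> y \<noteq> 0}"
      by (rule bounded_subset[OF bounded_cball order_trans[OF closure_subset sub]])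
    then show "compact (closure {y. ?\<phi> y \<noteq> 0})" by (simp add: compact_closure)
    show "closure {y. ?\<phi> y \<noteq> 0} \<subseteq> \<Omega>" using sub a by (rule order_trans)
  qed
  have pd: "partial_deriv i ?\<phi> y = - partial_deriv i r (a - y)" for y
  proof -
    have "((\<lambda>y. a - y) has_derivative (\<lambda>h. - h)) (at y)"
      by (auto intro!: derivative_eq_intros)
    from has_derivative_compose[OF this smooth_has_grad[OF rs]]
    have "(?\<phi> has_derivative (\<lambda>h. grad r (a - y) \<bullet> - h)) (at y)" .
    from partial_deriv_eq[OF this] show ?thesis by (simp add: grad_def inner_axis)
  qed
  have [measurable]: "(\<lambda>y. partial_deriv i ?\<phi> y) \<in> borel_measurable borel" "?\<phi> \<in> borel_measurable borel"
    by (intro borel_measurable_continuous_onI smooth_continuous smooth_partial_deriv rs')+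
  have gi: "in_Lp (lebesgue_on \<Omega>) p (\<lambda>x. g x $ i)"
    using w by (intro in_Lp_component) (simp add: is_weak_gradient_def)
  have "(\<integral>x. u x * partial_deriv i ?\<phi> x \<partial>lebesgue_on \<Omega>) = - (\<integral>x. g x $ i * ?\<phi> x \<partial>lebesgue_on \<Omega>)"
    using w test by (auto simp: is_weak_gradient_def)
  moreover have "(\<integral>x. u x * partial_deriv i ?\<phi> x \<partial>lebesgue_on \<Omega>) = (\<integral>x. f x * partial_deriv i ?\<phi> x \<partial>lborel)"
    using u by (intro borel_rep_integral[OF f]) (auto simp: in_Lp_def)
  moreover have "(\<integral>x. g x $ i * ?\<phi> x \<partial>lebesgue_on \<Omega>) = (\<integral>x. \<gamma> x * ?\<phi> x \<partial>lborel)"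
    using gi by (intro borel_rep_integral[OF \<gamma>]) (auto simp: in_Lp_def)
  ultimately show ?thesis
    unfolding moll_def by (simp add: pd mult.commute)
qed

text \<open>
  The mollification of the difference of two weak gradients vanishes at distance more than
  \<open>\<delta>\<close> from the complement of \<open>\<Omega>\<close>, and it converges to the difference as \<open>\<delta>\<close> tends to 0. The
  sets \<open>K k\<close> in the proof exhaust \<open>\<Omega>\<close>.
\<close>

lemma weak_gradient_unique:
  assumes w: "is_weak_gradient \<Omega> p u g" "is_weak_gradient \<Omega> p u g'" and u: "in_Lp (lebesgue_on \<Omega>) p u"
  shows "AE x in lebesgue_on \<Omega>. g x = g' x"
proof -
  have gp: "in_Lp (lebesgue_on \<Omega>) p g" "in_Lp (lebesgue_on \<Omega>) p g'"
    using w by (auto simp: is_weak_gradient_def)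
  obtain R where R: "R > 0" "\<Omega> \<subseteq> cball 0 R"
    by (rule dom_subset_cball)
  have "AE x in lebesgue_on \<Omega>. g x $ i = g' x $ i" for i
  proof -
    obtain f where f: "borel_rep u f" using borel_rep_exists u by (auto simp: in_Lp_def)
    obtain a where a: "borel_rep (\<lambda>x. g x $ i) a"
      using borel_rep_exists in_Lp_component[OF gp(1), of i] by (auto simp: in_Lp_def)
    obtain b where b: "borel_rep (\<lambda>x. g' x $ i) b"
      using borel_rep_exists in_Lp_component[OF gp(2), of i] by (auto simp: in_Lp_def)
    have [measurable]: "a \<in> borel_measurable borel" "b \<in> borel_measurable borel"
      using a b by (auto simp: borel_rep_def)
    have ai: "integrable lborel a" and bi: "integrable lborel b"
      using borel_rep_integrable a b in_Lp_component gp by blast+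
    define h where "h x = a x - b x" for x
    have [measurable]: "h \<in> borel_measurable borel" unfolding h_def by measurable
    have hi: "integrable lborel h" unfolding h_def using ai bi by simp
    have "Lp_int lborel p h \<le> ennreal (2 powr p) * (Lp_int lborel p a + Lp_int lborel p b)"
      unfolding h_def using p_gt_1 by (intro Lp_int_diff_le) auto
    also have "\<dots> < \<infinity>"
      using borel_rep_Lp_int[OF a] borel_rep_Lp_int[OF b] in_Lp_component[OF gp(1), of i] in_Lp_component[OF gp(2), of i]
      by (auto simp: in_Lp_def ennreal_mult_less_top)
    finally have hp: "Lp_int lborel p h < \<infinity>" .
    define K where "K k = cball 0 R \<inter> (\<Inter>z\<in>- \<Omega>. {x. 1 / real (Suc k) \<le> dist x z})" for k
    have [measurable]: "K k \<in> sets borel" for k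
      unfolding K_def by (intro borel_closed closed_Int closed_cball closed_INT ballI closed_Collect_le continuous_intros)
    have "AE x in lborel. x \<in> K k \<longrightarrow> h x = 0" for k
    proof -
      let ?I = "\<integral>\<^sup>+x. ennreal (\<bar>h x\<bar> powr p) * indicator (K k) x \<partial>lborel"
      have "?I \<le> 0"
      proof (rule ennreal_le_epsilon)
        fix e :: real assume "e > 0"
        obtain \<eta> where \<eta>: "\<eta> > 0"
          "\<And>d b \<delta> r. (\<And>l. \<bar>d l - 1\<bar> < \<eta>) \<Longrightarrow> norm b < \<eta> \<Longrightarrow> \<delta> < \<eta> \<Longrightarrow> mollifier \<delta> r \<Longrightarrow>
           Lp_int (restrict_space lborel (cball 0 R)) p (\<lambda>x. moll r h (diag_affine d b x) - h x) \<le> ennreal e"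
          by (rule moll_diag_affine_converges[OF _ hi p_gt_1 hp \<open>e > 0\<close> R(1)]) (simp, blast)
        define \<delta> where "\<delta> = min (\<eta> / 2) (1 / (2 * real (Suc k)))"
        have \<delta>: "\<delta> > 0" "\<delta> < \<eta>" "\<delta> < 1 / real (Suc k)"
          using \<eta>(1) by (auto simp: \<delta>_def min_less_iff_disj field_simps)
        obtain r :: "real^'n \<Rightarrow> real" where r: "mollifier \<delta> r" using mollifier_exists[OF \<delta>(1)] by blast
        have rc: "continuous_on UNIV r" "vanishes_outside \<delta> r"
          using r by (auto simp: mollifier_def smooth_continuous)
        have "Lp_int (restrict_space lborel (cball 0 R)) p (\<lambda>x. moll r h (diag_affine (\<lambda>_. 1) 0 x) - h x) \<le> ennreal e"
          using \<eta>(1) \<delta>(2) r by (intro \<eta>(2)) auto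
        then have le: "(\<integral>\<^sup>+x. ennreal (\<bar>moll r h x - h x\<bar> powr p) * indicator (cball 0 R) x \<partial>lborel) \<le> ennreal e"
          by (simp add: Lp_int_def nn_integral_restrict_space)
        have zero: "moll r h x = 0" if "x \<in> K k" for x
        proof -
          have c: "cball x \<delta> \<subseteq> \<Omega>"
          proof
            fix y assume "y \<in> cball x \<delta>"
            then have "dist x y < 1 / real (Suc k)" using \<delta>(3) by simp
            then show "y \<in> \<Omega>" using that by (force simp: K_def)
          qed
          have "moll r h x = moll r a x - moll r b x"
            unfolding moll_def h_def right_diff_distrib
            using integrable_moll[OF ai rc] integrable_moll[OF bi rc] by simp
          also have "\<dots> = 0"
            using moll_partial_deriv_weak[OF w(1) u f a r c] moll_partial_deriv_weak[OF w(2) u f b r c] by simp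
          finally show ?thesis .
        qed
        have "?I \<le> (\<integral>\<^sup>+x. ennreal (\<bar>moll r h x - h x\<bar> powr p) * indicator (cball 0 R) x \<partial>lborel)"
          using zero by (intro nn_integral_mono) (auto simp: indicator_def K_def)
        with le show "?I \<le> 0 + ennreal e" by simp
      qed
      then have "AE x in lborel. ennreal (\<bar>h x\<bar> powr p) * indicator (K k) x = 0"
        by (subst nn_integral_0_iff_AE[symmetric]) auto
      then show ?thesis by eventually_elim (auto simp: indicator_def)
    qed
    then have "AE x in lborel. \<forall>k. x \<in> K k \<longrightarrow> h x = 0"
      by (intro AE_all_countable[THEN iffD2] allI)
    then have "AE x in lborel. x \<in> \<Omega> \<longrightarrow> h x = 0"
    proof eventually_elim
      case (elim x)
      show ?case
      proof
        assume "x \<in> \<Omega>"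
        then obtain e where e: "e > 0" "ball x e \<subseteq> \<Omega>" using open_dom open_contains_ball by blast
        then obtain k where k: "1 / real (Suc k) < e" using nat_approx_posE by blast
        have "x \<in> K k" using e(2) k R(2) \<open>x \<in> \<Omega>\<close> by (force simp: K_def)
        then show "h x = 0" using elim by blast
      qed
    qed
    then have "AE x in lebesgue_on \<Omega>. h x = 0"
      by (auto simp: AE_restrict_space_iff AE_completion)
    moreover have "AE x in lebesgue_on \<Omega>. g x $ i = a x" "AE x in lebesgue_on \<Omega>. g' x $ i = b x"
      using a b by (auto simp: borel_rep_def)
    ultimately show ?thesis by eventually_elim (auto simp: h_def)
  qed
  then have "AE x in lebesgue_on \<Omega>. \<forall>i. g x $ i = g' x $ i" by (simp add: AE_all_countable)
  then show ?thesis by eventually_elim (simp add: vec_eq_iff)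
qed

lemma is_weak_gradient_weak_gradient:
  "u \<in> sobolev \<Omega> p \<Longrightarrow> is_weak_gradient \<Omega> p u (weak_gradient \<Omega> p u)"
  unfolding sobolev_def weak_gradient_def by (metis (mono_tags, lifting) mem_Collect_eq someI)

text \<open>
  The gradient \<open>weak_gradient \<Omega> p u\<close> is some choice; by uniqueness its energy can be computed
  from any explicit weak gradient.
\<close>

lemma Lp_int_weak_gradient:
  assumes "is_weak_gradient \<Omega> p u g" "in_Lp (lebesgue_on \<Omega>) p u"
  shows "Lp_int (lebesgue_on \<Omega>) p (weak_gradient \<Omega> p u) = Lp_int (lebesgue_on \<Omega>) p g"
proof -
  have "u \<in> sobolev \<Omega> p" using assms by (auto simp: sobolev_def)
  then show ?thesis
    using weak_gradient_unique[OF is_weak_gradient_weak_gradient assms] by (intro Lp_int_cong_AE)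
qed

lemma smooth_weak_gradient:
  assumes "smooth v"
  shows "is_weak_gradient \<Omega> p v (grad v)" "v \<in> sobolev \<Omega> p"
proof -
  show w: "is_weak_gradient \<Omega> p v (grad v)"
    unfolding is_weak_gradient_def
  proof (intro conjI allI impI)
    show "in_Lp (lebesgue_on \<Omega>) p (grad v)"
      by (intro in_Lp_continuous smooth_continuous_grad assms)
    fix \<phi> i assume t: "test_function \<Omega> \<phi>"
    then have s: "smooth \<phi>" by (simp add: test_function_def)
    obtain R where R: "vanishes_outside R \<phi>" using test_function_vanishes[OF t] .
    have vR: "vanishes_outside (R + 1) (partial_deriv i \<phi>)" by (rule vanishes_partial_deriv[OF R])
    let ?F = "\<lambda>x. v x * \<phi> x"
    have d: "(?F has_derivative (\<lambda>h. v x * (grad \<phi> x \<bullet> h) + (grad v x \<bullet> h) * \<phi> x)) (at x)" for x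
      by (intro has_derivative_mult smooth_has_grad assms s)
    have pd: "partial_deriv i ?F = (\<lambda>x. v x * partial_deriv i \<phi> x + grad v x $ i * \<phi> x)"
      using partial_deriv_eq[OF d] by (auto simp: inner_axis grad_def)
    have cont: "continuous_on UNIV v" "continuous_on UNIV (\<lambda>x. grad v x $ i)" "continuous_on UNIV \<phi>"
      "continuous_on UNIV (partial_deriv i \<phi>)"
      by (auto simp: grad_def intro!: smooth_continuous smooth_partial_deriv assms s)
    have "(\<integral>x. partial_deriv i ?F x \<partial>lborel) = 0"
    proof (rule integral_partial_deriv_eq_0[where R=R])
      show "?F differentiable (at x)" for x using d differentiable_def by blast
      show "continuous_on UNIV (partial_deriv i ?F)" unfolding pd by (intro continuous_intros cont)
      show "vanishes_outside R ?F" using R by (simp add: vanishes_outside_def)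
    qed
    moreover have "integrable lborel (\<lambda>x. v x * partial_deriv i \<phi> x)"
      by (intro integrable_continuous_vanishing[where R="R + 1"] continuous_intros cont)
         (use vR in \<open>simp add: vanishes_outside_def\<close>)
    moreover have "integrable lborel (\<lambda>x. grad v x $ i * \<phi> x)"
      by (intro integrable_continuous_vanishing[where R=R] continuous_intros cont)
         (use R in \<open>simp add: vanishes_outside_def\<close>)
    ultimately have eq: "(\<integral>x. v x * partial_deriv i \<phi> x \<partial>lborel) = - (\<integral>x. grad v x $ i * \<phi> x \<partial>lborel)"
      by (simp add: pd)
    have loc: "(\<integral>x. H x \<partial>lebesgue_on \<Omega>) = (\<integral>x. H x \<partial>lborel)"
      if "continuous_on UNIV H" "\<And>x. x \<notin> \<Omega> \<Longrightarrow> H x = 0" for H :: "real^'n \<Rightarrow> real"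
    proof -
      have [measurable]: "H \<in> borel_measurable borel" by (rule borel_measurable_continuous_onI[OF that(1)])
      have "(\<integral>x. H x \<partial>lebesgue_on \<Omega>) = (\<integral>x. indicator \<Omega> x *\<^sub>R H x \<partial>lebesgue)"
        by (subst integral_restrict_space) auto
      also have "\<dots> = (\<integral>x. indicator \<Omega> x *\<^sub>R H x \<partial>lborel)"
        by (subst integral_completion) auto
      also have "\<dots> = (\<integral>x. H x \<partial>lborel)"
        using that by (intro Bochner_Integration.integral_cong) (auto simp: indicator_def)
      finally show ?thesis .
    qed
    have "(\<integral>x. v x * partial_deriv i \<phi> x \<partial>lebesgue_on \<Omega>) = (\<integral>x. v x * partial_deriv i \<phi> x \<partial>lborel)"
      using test_function_zero_outside[OF t] by (intro loc continuous_intros cont) auto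
    moreover have "(\<integral>x. grad v x $ i * \<phi> x \<partial>lebesgue_on \<Omega>) = (\<integral>x. grad v x $ i * \<phi> x \<partial>lborel)"
      using test_function_zero_outside[OF t] by (intro loc continuous_intros cont) auto
    ultimately show "(\<integral>x. v x * partial_deriv i \<phi> x \<partial>lebesgue_on \<Omega>) =
        - (\<integral>x. grad v x $ i * \<phi> x \<partial>lebesgue_on \<Omega>)"
      using eq by simp
  qed
  have "in_Lp (lebesgue_on \<Omega>) p v" by (intro in_Lp_continuous smooth_continuous assms)
  with w show "v \<in> sobolev \<Omega> p" by (auto simp: sobolev_def)
qed

lemma is_weak_gradient_diff:
  assumes u: "in_Lp (lebesgue_on \<Omega>) p u" "is_weak_gradient \<Omega> p u g"
    and v: "in_Lp (lebesgue_on \<Omega>) p v" "is_weak_gradient \<Omega> p v h"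
  shows "in_Lp (lebesgue_on \<Omega>) p (\<lambda>x. v x - u x)" "is_weak_gradient \<Omega> p (\<lambda>x. v x - u x) (\<lambda>x. h x - g x)"
proof -
  have L: "in_Lp (lebesgue_on \<Omega>) p (\<lambda>x. b x - a x)"
    if "in_Lp (lebesgue_on \<Omega>) p a" "in_Lp (lebesgue_on \<Omega>) p b" for a b :: "real^'n \<Rightarrow> 'z::euclidean_space"
    using that Lp_int_diff_le[of b "lebesgue_on \<Omega>" a p] p_gt_1
    by (auto simp: in_Lp_def ennreal_mult_less_top intro: le_less_trans)
  have gh: "in_Lp (lebesgue_on \<Omega>) p g" "in_Lp (lebesgue_on \<Omega>) p h"
    using u v by (auto simp: is_weak_gradient_def)
  show "in_Lp (lebesgue_on \<Omega>) p (\<lambda>x. v x - u x)" by (rule L[OF u(1) v(1)])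
  show "is_weak_gradient \<Omega> p (\<lambda>x. v x - u x) (\<lambda>x. h x - g x)"
    unfolding is_weak_gradient_def
  proof (intro conjI allI impI)
    show "in_Lp (lebesgue_on \<Omega>) p (\<lambda>x. h x - g x)" by (rule L[OF gh])
    fix \<phi> i assume t: "test_function \<Omega> \<phi>"
    then have s: "smooth \<phi>" by (simp add: test_function_def)
    obtain R where R: "vanishes_outside R \<phi>" using test_function_vanishes[OF t] .
    have vR: "vanishes_outside (R + 1) (partial_deriv i \<phi>)" by (rule vanishes_partial_deriv[OF R])
    have c: "continuous_on UNIV \<phi>" "continuous_on UNIV (partial_deriv i \<phi>)"
      by (auto intro!: smooth_continuous smooth_partial_deriv s)
    have "(\<integral>x. (v x - u x) * partial_deriv i \<phi> x \<partial>lebesgue_on \<Omega>) =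
       (\<integral>x. v x * partial_deriv i \<phi> x \<partial>lebesgue_on \<Omega>) - (\<integral>x. u x * partial_deriv i \<phi> x \<partial>lebesgue_on \<Omega>)"
      unfolding left_diff_distrib
      by (intro Bochner_Integration.integral_diff integrable_mult_test[OF _ c(2) vR] u v)
    also have "\<dots> = - (\<integral>x. h x $ i * \<phi> x \<partial>lebesgue_on \<Omega>) - - (\<integral>x. g x $ i * \<phi> x \<partial>lebesgue_on \<Omega>)"
      using u(2) v(2) t by (simp add: is_weak_gradient_def)
    also have "\<dots> = - (\<integral>x. (h x - g x) $ i * \<phi> x \<partial>lebesgue_on \<Omega>)"
      unfolding vector_minus_component left_diff_distrib
      by (subst Bochner_Integration.integral_diff) (auto intro!: integrable_mult_test[OF _ c(1) R] in_Lp_component gh)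
    finally show "(\<integral>x. (v x - u x) * partial_deriv i \<phi> x \<partial>lebesgue_on \<Omega>) =
        - (\<integral>x. (h x - g x) $ i * \<phi> x \<partial>lebesgue_on \<Omega>)" .
  qed
qed

end

section \<open>Density of smooth functions\<close>

lemma Lp_int_vec_le:
  fixes g :: "'a \<Rightarrow> real^'n"
  assumes p: "0 \<le> p" and m: "\<And>i. (\<lambda>x. g x $ i) \<in> borel_measurable M"
  shows "Lp_int M p g \<le> ennreal (real CARD('n) powr p) * (\<Sum>i\<in>UNIV. Lp_int M p (\<lambda>x. g x $ i))"
proof -
  have le: "norm v powr p \<le> real CARD('n) powr p * (\<Sum>i\<in>UNIV. \<bar>v $ i\<bar> powr p)" for v :: "real^'n"
  proof -
    define m where "m = Max (range (\<lambda>i. \<bar>v $ i\<bar>))"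
    have mi: "\<bar>v $ i\<bar> \<le> m" for i unfolding m_def by (intro Max_ge) auto
    have "m \<in> range (\<lambda>i. \<bar>v $ i\<bar>)" unfolding m_def by (intro Max_in) auto
    then obtain k where k: "m = \<bar>v $ k\<bar>" by blast
    have "norm v \<le> (\<Sum>i\<in>UNIV. \<bar>v $ i\<bar>)" by (rule norm_le_l1_cart)
    also have "\<dots> \<le> real CARD('n) * m" using mi sum_bounded_above[of UNIV "\<lambda>i. \<bar>v $ i\<bar>" m] by simp
    finally have "norm v powr p \<le> (real CARD('n) * m) powr p" using p by (intro powr_mono2) auto
    also have "\<dots> = real CARD('n) powr p * \<bar>v $ k\<bar> powr p" by (simp add: k powr_mult)
    also have "\<bar>v $ k\<bar> powr p \<le> (\<Sum>i\<in>UNIV. \<bar>v $ i\<bar> powr p)" by (rule member_le_sum) auto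
    finally show ?thesis by (simp add: mult_left_mono)
  qed
  have "Lp_int M p g \<le> (\<integral>\<^sup>+x. ennreal (real CARD('n) powr p) * (\<Sum>i\<in>UNIV. ennreal (\<bar>g x $ i\<bar> powr p)) \<partial>M)"
    unfolding Lp_int_def using le
    by (intro nn_integral_mono) (simp add: sum_ennreal ennreal_mult[symmetric] sum_nonneg ennreal_leI)
  also have "\<dots> = ennreal (real CARD('n) powr p) * (\<Sum>i\<in>UNIV. Lp_int M p (\<lambda>x. g x $ i))"
    using m unfolding Lp_int_def
    by (simp add: nn_integral_cmult nn_integral_sum del: sum_ennreal)
  finally show ?thesis .
qed

lemma Lp_int_cmult:
  fixes f :: "'a \<Rightarrow> real"
  assumes "f \<in> borel_measurable M"
  shows "Lp_int M p (\<lambda>x. c * f x) = ennreal (\<bar>c\<bar> powr p) * Lp_int M p f"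
  unfolding Lp_int_def using assms
  by (simp add: abs_mult powr_mult ennreal_mult nn_integral_cmult)

context sobolev_domain
begin

lemma Lp_int_dom_le:
  assumes "\<Omega> \<subseteq> cball 0 R"
  shows "Lp_int (lebesgue_on \<Omega>) p h \<le> Lp_int (restrict_space lborel (cball 0 R)) p h"
  unfolding Lp_int_def using assms
  by (simp add: nn_integral_restrict_space nn_integral_completion)
     (intro nn_integral_mono, auto simp: indicator_def)

text \<open>
  The approximation is \<open>x \<mapsto> (r * u) (A x)\<close>, where \<open>A\<close> maps the closure of \<open>\<Omega>\<close> into \<open>\<Omega>\<close>. On
  the compact image the distance to the complement is bounded below, so for a small support
  of \<open>r\<close> the partial derivatives of the mollification are the mollified components of the
  weak gradient; the factors \<open>d i\<close> from the chain rule are close to 1.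
\<close>

theorem smooth_dense:
  assumes shrink: "\<And>\<epsilon>. \<epsilon> > 0 \<Longrightarrow> \<exists>d b. (\<forall>l. \<bar>d l - 1\<bar> < \<epsilon>) \<and> norm b < \<epsilon> \<and> diag_affine d b ` closure \<Omega> \<subseteq> \<Omega>"
    and w: "is_weak_gradient \<Omega> p u g" and u: "in_Lp (lebesgue_on \<Omega>) p u" and e: "e > 0"
  obtains v where "smooth v"
    "Lp_int (lebesgue_on \<Omega>) p (\<lambda>x. v x - u x) + Lp_int (lebesgue_on \<Omega>) p (\<lambda>x. grad v x - g x) \<le> ennreal e"
proof -
  obtain R where R: "R > 0" "\<Omega> \<subseteq> cball 0 R" by (rule dom_subset_cball)
  let ?B = "restrict_space lborel (cball (0::real^'n) R)"
  have gp: "in_Lp (lebesgue_on \<Omega>) p g" using w by (simp add: is_weak_gradient_def)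
  obtain f where f: "borel_rep u f" using borel_rep_exists u by (auto simp: in_Lp_def)
  have "\<exists>\<gamma>. borel_rep (\<lambda>x. g x $ i) \<gamma>" for i
    using borel_rep_exists in_Lp_component[OF gp, of i] by (metis in_Lp_def)
  then obtain \<gamma> where \<gamma>: "\<And>i. borel_rep (\<lambda>x. g x $ i) (\<gamma> i)" by metis
  have m[measurable]: "f \<in> borel_measurable borel" "\<gamma> i \<in> borel_measurable borel" for i
    using f \<gamma> by (auto simp: borel_rep_def)
  have fi: "integrable lborel f" by (rule borel_rep_integrable[OF f u])
  have \<gamma>i: "integrable lborel (\<gamma> i)" for i by (rule borel_rep_integrable[OF \<gamma> in_Lp_component[OF gp]])
  have fp: "Lp_int lborel p f < \<infinity>" using u by (simp add: in_Lp_def flip: borel_rep_Lp_int[OF f])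
  have \<gamma>p: "Lp_int lborel p (\<gamma> i) < \<infinity>" for i
    using in_Lp_component[OF gp, of i] by (simp add: in_Lp_def flip: borel_rep_Lp_int[OF \<gamma>])
  have conv: "\<exists>\<eta>>0. \<forall>d b \<delta> r. (\<forall>l. \<bar>d l - 1\<bar> < \<eta>) \<longrightarrow> norm b < \<eta> \<longrightarrow> \<delta> < \<eta> \<longrightarrow> mollifier \<delta> r \<longrightarrow>
       Lp_int ?B p (\<lambda>x. moll r h (diag_affine d b x) - h x) \<le> ennreal \<epsilon>"
    if "h \<in> borel_measurable borel" "integrable lborel h" "Lp_int lborel p h < \<infinity>" "\<epsilon> > 0" for h \<epsilon>
    by (rule moll_diag_affine_converges[OF that(1,2) p_gt_1 that(3,4) R(1)]) blast
  let ?n = "real CARD('n)"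
  define G where "G = (\<Sum>i\<in>UNIV. enn2real (Lp_int lborel p (\<gamma> i)))"
  have Gi: "Lp_int lborel p (\<gamma> i) \<le> ennreal G" for i
  proof -
    have "enn2real (Lp_int lborel p (\<gamma> i)) \<le> G" unfolding G_def by (rule member_le_sum) auto
    then have "ennreal (enn2real (Lp_int lborel p (\<gamma> i))) \<le> ennreal G" by (rule ennreal_leI)
    then show ?thesis using \<gamma>p[of i] by simp
  qed
  have G0: "G \<ge> 0" unfolding G_def by (intro sum_nonneg) auto
  \<comment> \<open>error budget: each component of the gradient may contribute \<open>e1\<close>\<close>
  define e1 where "e1 = e / (2 * ?n powr p * ?n)"
  have e1: "e1 > 0" "?n powr p * (?n * e1) = e / 2" using e by (auto simp: e1_def)
  \<comment> \<open>half of \<open>e1\<close> for the mollification, scaled by factors \<open>d i \<le> 2\<close>, and half for \<open>d i - 1\<close>\<close>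
  define e2 where "e2 = e1 / (2 * 2 powr p * 2 powr p)"
  have e2: "e2 > 0" using e1 by (simp add: e2_def)
  define \<eta>' where "\<eta>' = (e1 / (2 * 2 powr p * (G + 1))) powr (1 / p)"
  have \<eta>': "\<eta>' > 0" "2 powr p * (\<eta>' powr p * G) \<le> e1 / 2"
  proof -
    show "\<eta>' > 0" using e1 G0 by (simp add: \<eta>'_def add_nonneg_pos)
    have "\<eta>' powr p = e1 / (2 * 2 powr p * (G + 1))" using e1 G0 p_gt_1 by (simp add: \<eta>'_def powr_powr)
    then have "2 powr p * (\<eta>' powr p * G) = e1 / 2 * (G / (G + 1))" by simp
    also have "\<dots> \<le> e1 / 2 * 1" using e1 G0 by (intro mult_left_mono) auto
    finally show "2 powr p * (\<eta>' powr p * G) \<le> e1 / 2" by simp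
  qed
  obtain \<eta>f where \<eta>f: "\<eta>f > 0" "\<And>d b \<delta> r. (\<forall>l. \<bar>d l - 1\<bar> < \<eta>f) \<Longrightarrow> norm b < \<eta>f \<Longrightarrow> \<delta> < \<eta>f \<Longrightarrow> mollifier \<delta> r \<Longrightarrow>
       Lp_int ?B p (\<lambda>x. moll r f (diag_affine d b x) - f x) \<le> ennreal (e / 2)"
    using conv[OF m(1) fi fp, of "e / 2"] e by auto
  have "\<forall>i. \<exists>\<eta>>0. \<forall>d b \<delta> r. (\<forall>l. \<bar>d l - 1\<bar> < \<eta>) \<longrightarrow> norm b < \<eta> \<longrightarrow> \<delta> < \<eta> \<longrightarrow> mollifier \<delta> r \<longrightarrow>
       Lp_int ?B p (\<lambda>x. moll r (\<gamma> i) (diag_affine d b x) - \<gamma> i x) \<le> ennreal e2"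
    using conv[OF m(2) \<gamma>i \<gamma>p e2] by blast
  from choice[OF this] obtain \<eta>g where \<eta>g: "\<forall>i. \<eta>g i > 0 \<and> (\<forall>d b \<delta> r. (\<forall>l. \<bar>d l - 1\<bar> < \<eta>g i) \<longrightarrow>
       norm b < \<eta>g i \<longrightarrow> \<delta> < \<eta>g i \<longrightarrow> mollifier \<delta> r \<longrightarrow>
       Lp_int ?B p (\<lambda>x. moll r (\<gamma> i) (diag_affine d b x) - \<gamma> i x) \<le> ennreal e2)" by blast
  define \<eta> where "\<eta> = Min (insert 1 (insert \<eta>' (insert \<eta>f (range \<eta>g))))"
  have \<eta>: "\<eta> > 0" "\<eta> \<le> 1" "\<eta> \<le> \<eta>'" "\<eta> \<le> \<eta>f" "\<And>i. \<eta> \<le> \<eta>g i"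
    unfolding \<eta>_def using \<eta>'(1) \<eta>f(1) \<eta>g by (auto simp: Min_gr_iff min_le_iff_disj intro!: Min_le)
  obtain d b where db: "\<And>l. \<bar>d l - 1\<bar> < \<eta>" "norm b < \<eta>" "diag_affine d b ` closure \<Omega> \<subseteq> \<Omega>"
    using shrink[OF \<eta>(1)] by blast
  let ?A = "diag_affine d b"
  have cA: "compact (?A ` closure \<Omega>)"
    using bounded_dom
    by (intro compact_continuous_image continuous_intros continuous_on_vec_lambda) (simp add: compact_closure)
  obtain \<delta>0 where \<delta>0: "\<delta>0 > 0" "(\<Union>y\<in>?A ` closure \<Omega>. cball y \<delta>0) \<subseteq> \<Omega>"
    by (rule compact_subset_open_imp_cball_epsilon_subset[OF cA open_dom db(3)])
  define \<delta> where "\<delta> = min \<delta>0 (\<eta> / 2)"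
  have \<delta>: "\<delta> > 0" "\<delta> < \<eta>" "\<delta> \<le> \<delta>0" using \<delta>0 \<eta>(1) by (auto simp: \<delta>_def min_less_iff_disj)
  have cb: "cball (?A x) \<delta> \<subseteq> \<Omega>" if "x \<in> \<Omega>" for x
  proof -
    have "cball (?A x) \<delta> \<subseteq> cball (?A x) \<delta>0" using \<delta>(3) by (rule subset_cball)
    also have "\<dots> \<subseteq> (\<Union>y\<in>?A ` closure \<Omega>. cball y \<delta>0)" using that closure_subset by blast
    finally show ?thesis using \<delta>0(2) by blast
  qed
  obtain r :: "real^'n \<Rightarrow> real" where r: "mollifier \<delta> r" using mollifier_exists[OF \<delta>(1)] by blast
  then have rs: "smooth r" "vanishes_outside \<delta> r" by (auto simp: mollifier_def)
  define v where "v x = moll r f (?A x)" for x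
  have sm: "smooth (moll r f)" by (rule smooth_moll[OF fi rs])
  have v: "smooth v" unfolding v_def by (rule smooth_diag_affine[OF sm])
  have gv: "grad v x $ i = d i * moll r (\<gamma> i) (?A x)" if "x \<in> \<Omega>" for x i
  proof -
    have "grad v x $ i = d i * partial_deriv i (moll r f) (?A x)"
      unfolding grad_def v_def by (simp add: partial_deriv_diag_affine smooth_differentiable[OF sm])
    also have "partial_deriv i (moll r f) (?A x) = moll r (\<gamma> i) (?A x)"
      using partial_deriv_moll[OF fi rs, of i] moll_partial_deriv_weak[OF w u f \<gamma> r cb[OF that], of i] by simp
    finally show ?thesis .
  qed
  have 1: "Lp_int (lebesgue_on \<Omega>) p (\<lambda>x. v x - u x) \<le> ennreal (e / 2)"
  proof -
    have "AE x in lebesgue_on \<Omega>. v x - u x = v x - f x"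
      using f by (auto simp: borel_rep_def elim: eventually_mono)
    then have "Lp_int (lebesgue_on \<Omega>) p (\<lambda>x. v x - u x) = Lp_int (lebesgue_on \<Omega>) p (\<lambda>x. v x - f x)"
      by (rule Lp_int_cong_AE)
    also have "\<dots> \<le> Lp_int ?B p (\<lambda>x. v x - f x)" by (rule Lp_int_dom_le[OF R(2)])
    also have "\<dots> \<le> ennreal (e / 2)"
      unfolding v_def using db \<delta> \<eta>(4) r by (intro \<eta>f(2)) (auto intro: less_le_trans)
    finally show ?thesis .
  qed
  have 2: "Lp_int (lebesgue_on \<Omega>) p (\<lambda>x. (grad v x - g x) $ i) \<le> ennreal e1" for i
  proof -
    let ?m = "\<lambda>x. moll r (\<gamma> i) (?A x)"
    have [measurable]: "moll r (\<gamma> i) \<in> borel_measurable borel"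
      by (intro borel_measurable_continuous_onI smooth_continuous smooth_moll[OF \<gamma>i rs])
    have "AE x in lebesgue_on \<Omega>. (grad v x - g x) $ i = d i * (?m x - \<gamma> i x) + (d i - 1) * \<gamma> i x"
    proof -
      have "AE x in lebesgue_on \<Omega>. g x $ i = \<gamma> i x" using \<gamma>[of i] by (simp add: borel_rep_def)
      moreover have "AE x in lebesgue_on \<Omega>. grad v x $ i = d i * ?m x"
        using gv by (intro AE_I2) (simp add: space_restrict_space)
      ultimately show ?thesis by eventually_elim (simp add: algebra_simps)
    qed
    then have "Lp_int (lebesgue_on \<Omega>) p (\<lambda>x. (grad v x - g x) $ i) =
        Lp_int (lebesgue_on \<Omega>) p (\<lambda>x. d i * (?m x - \<gamma> i x) + (d i - 1) * \<gamma> i x)"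
      by (rule Lp_int_cong_AE)
    also have "\<dots> \<le> ennreal (2 powr p) * (Lp_int (lebesgue_on \<Omega>) p (\<lambda>x. d i * (?m x - \<gamma> i x)) +
        Lp_int (lebesgue_on \<Omega>) p (\<lambda>x. (d i - 1) * \<gamma> i x))"
      by (intro Lp_int_add_le borel_measurable_dom) (measurable, use p_gt_1 in simp)
    also have "Lp_int (lebesgue_on \<Omega>) p (\<lambda>x. d i * (?m x - \<gamma> i x)) \<le> ennreal (2 powr p * e2)"
    proof -
      have "Lp_int (lebesgue_on \<Omega>) p (\<lambda>x. d i * (?m x - \<gamma> i x)) =
          ennreal (\<bar>d i\<bar> powr p) * Lp_int (lebesgue_on \<Omega>) p (\<lambda>x. ?m x - \<gamma> i x)"
        by (intro Lp_int_cmult borel_measurable_dom) measurable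
      also have "\<dots> \<le> ennreal (2 powr p) * ennreal e2"
      proof (intro mult_mono)
        have "\<bar>d i\<bar> \<le> 2" using db(1)[of i] \<eta>(2) by linarith
        then show "ennreal (\<bar>d i\<bar> powr p) \<le> ennreal (2 powr p)"
          using p_gt_1 by (intro ennreal_leI powr_mono2) auto
        have "Lp_int (lebesgue_on \<Omega>) p (\<lambda>x. ?m x - \<gamma> i x) \<le> Lp_int ?B p (\<lambda>x. ?m x - \<gamma> i x)"
          by (rule Lp_int_dom_le[OF R(2)])
        also have "\<dots> \<le> ennreal e2"
          using db \<delta> \<eta>(5)[of i] r
          by (intro \<eta>g[THEN spec, THEN conjunct2, rule_format]) (auto intro: less_le_trans)
        finally show "Lp_int (lebesgue_on \<Omega>) p (\<lambda>x. ?m x - \<gamma> i x) \<le> ennreal e2" .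
      qed auto
      finally show ?thesis using e2 by (simp add: ennreal_mult)
    qed
    also have "Lp_int (lebesgue_on \<Omega>) p (\<lambda>x. (d i - 1) * \<gamma> i x) \<le> ennreal (\<eta>' powr p * G)"
    proof -
      have "Lp_int (lebesgue_on \<Omega>) p (\<lambda>x. (d i - 1) * \<gamma> i x) =
          ennreal (\<bar>d i - 1\<bar> powr p) * Lp_int (lebesgue_on \<Omega>) p (\<gamma> i)"
        by (intro Lp_int_cmult borel_measurable_dom) measurable
      also have "\<dots> \<le> ennreal (\<eta>' powr p) * ennreal G"
      proof (intro mult_mono)
        show "ennreal (\<bar>d i - 1\<bar> powr p) \<le> ennreal (\<eta>' powr p)"
          using p_gt_1 db(1)[of i] \<eta>(3) by (intro ennreal_leI powr_mono2) auto
        have "AE x in lebesgue_on \<Omega>. \<gamma> i x = g x $ i" using \<gamma>[of i] by (auto simp: borel_rep_def elim: eventually_mono)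
        then have "Lp_int (lebesgue_on \<Omega>) p (\<gamma> i) = Lp_int lborel p (\<gamma> i)"
          using borel_rep_Lp_int[OF \<gamma>[of i]] Lp_int_cong_AE by metis
        then show "Lp_int (lebesgue_on \<Omega>) p (\<gamma> i) \<le> ennreal G" using Gi by simp
      qed auto
      finally show ?thesis using G0 by (simp add: ennreal_mult)
    qed
    also have "ennreal (2 powr p) * (ennreal (2 powr p * e2) + ennreal (\<eta>' powr p * G)) =
        ennreal (2 powr p * (2 powr p * e2) + 2 powr p * (\<eta>' powr p * G))"
      using e2 G0 by (simp add: ennreal_mult ennreal_plus distrib_left)
    also have "\<dots> \<le> ennreal e1"
    proof (rule ennreal_leI)
      have "2 powr p * (2 powr p * e2) = e1 / 2" by (simp add: e2_def)
      then show "2 powr p * (2 powr p * e2) + 2 powr p * (\<eta>' powr p * G) \<le> e1" using \<eta>'(2) by linarith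
    qed
    finally show ?thesis by (simp add: add_mono mult_left_mono)
  qed
  have "Lp_int (lebesgue_on \<Omega>) p (\<lambda>x. grad v x - g x) \<le>
      ennreal (?n powr p) * (\<Sum>i\<in>UNIV. Lp_int (lebesgue_on \<Omega>) p (\<lambda>x. (grad v x - g x) $ i))"
  proof (rule Lp_int_vec_le)
    show "(\<lambda>x. (grad v x - g x) $ i) \<in> borel_measurable (lebesgue_on \<Omega>)" for i
      unfolding vector_minus_component
      using in_Lp_component[OF gp, of i] in_Lp_component[OF in_Lp_continuous[OF smooth_continuous_grad[OF v]], of i]
      by (intro borel_measurable_diff) (simp_all add: in_Lp_def)
  qed (use p_gt_1 in simp)
  also have "\<dots> \<le> ennreal (?n powr p) * (\<Sum>i\<in>(UNIV::'n set). ennreal e1)"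
    by (intro mult_left_mono sum_mono 2) auto
  also have "\<dots> = ennreal (?n powr p * (?n * e1))"
    using e1(1) by (simp add: ennreal_of_nat_eq_real_of_nat ennreal_mult[symmetric])
  also have "\<dots> = ennreal (e / 2)" by (simp only: e1(2))
  finally have "Lp_int (lebesgue_on \<Omega>) p (\<lambda>x. v x - u x) + Lp_int (lebesgue_on \<Omega>) p (\<lambda>x. grad v x - g x)
      \<le> ennreal (e / 2) + ennreal (e / 2)"
    by (intro add_mono 1)
  also have "\<dots> = ennreal e" using e by (simp flip: ennreal_plus)
  finally show ?thesis using v by (intro that[of v])
qed

lemma sobolev_norm_eq:
  assumes "is_weak_gradient \<Omega> p w g" "in_Lp (lebesgue_on \<Omega>) p w"
  shows "sobolev_norm \<Omega> p w = enn2real (Lp_int (lebesgue_on \<Omega>) p w + Lp_int (lebesgue_on \<Omega>) p g) powr (1 / p)"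
  unfolding sobolev_norm_def Lp_int_weak_gradient[OF assms] ..

lemma sobolev_norm_powr:
  assumes "is_weak_gradient \<Omega> p w g" "in_Lp (lebesgue_on \<Omega>) p w"
  shows "Lp_int (lebesgue_on \<Omega>) p w + Lp_int (lebesgue_on \<Omega>) p g = ennreal (sobolev_norm \<Omega> p w powr p)"
proof -
  have "Lp_int (lebesgue_on \<Omega>) p w + Lp_int (lebesgue_on \<Omega>) p g < \<infinity>"
    using assms by (simp add: in_Lp_def is_weak_gradient_def)
  then show ?thesis unfolding sobolev_norm_eq[OF assms] using p_gt_1 by (simp add: powr_powr)
qed

lemma sobolev_norm_nonneg: "sobolev_norm \<Omega> p w \<ge> 0"
  by (simp add: sobolev_norm_def)

end

section \<open>Upper bounds for the surface measure of a graph\<close>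

lemma hausdorff_outer_le_finite_cover:
  fixes A :: "'a::real_normed_vector set"
  assumes cover: "\<And>\<delta>. \<delta> > 0 \<Longrightarrow> \<exists>(I::'i set) U D. finite I \<and> A \<subseteq> (\<Union>i\<in>I. U i) \<and>
      (\<forall>i\<in>I. bounded (U i) \<and> diameter (U i) \<le> D) \<and> 0 \<le> D \<and> D \<le> \<delta> \<and>
      real (card I) * (unit_ball_vol (real d) * (D / 2) ^ d) \<le> M"
  shows "hausdorff_outer d A \<le> ennreal M"
  unfolding hausdorff_outer_def
proof (rule SUP_least)
  fix \<delta> :: real assume "\<delta> \<in> {0<..}"
  then have "\<delta> > 0" by simp
  from cover[OF this] obtain I :: "'i set" and U D where I: "finite I" "A \<subseteq> (\<Union>i\<in>I. U i)"
    and U: "\<And>i. i \<in> I \<Longrightarrow> bounded (U i)" "\<And>i. i \<in> I \<Longrightarrow> diameter (U i) \<le> D"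
    and D: "0 \<le> D" "D \<le> \<delta>" and M: "real (card I) * (unit_ball_vol (real d) * (D / 2) ^ d) \<le> M"
    by blast
  obtain h where h: "bij_betw h {0..<card I} I" using ex_bij_betw_nat_finite[OF I(1)] by blast
  then have hI: "h k \<in> I" if "k < card I" for k using that by (auto simp: bij_betw_def)
  define V where "V k = (if k < card I then U (h k) else {})" for k
  let ?c = "unit_ball_vol (real d) * (D / 2) ^ d"
  have "A \<subseteq> (\<Union>k. V k)"
  proof
    fix x assume "x \<in> A"
    then obtain i where i: "i \<in> I" "x \<in> U i" using I by blast
    then obtain k where "k < card I" "h k = i" using h by (metis atLeastLessThan_iff bij_betw_iff_bijections)
    then show "x \<in> (\<Union>k. V k)" using i by (auto simp: V_def)
  qed
  moreover have "bounded (V k) \<and> diameter (V k) \<le> \<delta>" for k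
    using U hI D order_trans[OF U(2)[OF hI] D(2)] \<open>\<delta> > 0\<close> by (auto simp: V_def)
  ultimately have "hausdorff_pre d \<delta> A \<le>
      (\<Sum>k. if V k = {} then 0 else ennreal (unit_ball_vol (real d) * (diameter (V k) / 2) ^ d))"
    unfolding hausdorff_pre_def by (intro INF_lower) auto
  also have "\<dots> = (\<Sum>k<card I. if V k = {} then 0 else ennreal (unit_ball_vol (real d) * (diameter (V k) / 2) ^ d))"
    by (intro suminf_finite) (auto simp: V_def)
  also have "\<dots> \<le> (\<Sum>k<card I. ennreal ?c)"
  proof (rule sum_mono)
    fix k assume "k \<in> {..<card I}"
    then have "diameter (V k) \<le> D" "bounded (V k)" using U hI by (auto simp: V_def)
    then have "unit_ball_vol (real d) * (diameter (V k) / 2) ^ d \<le> ?c"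
      by (intro mult_left_mono power_mono) (auto simp: diameter_ge_0)
    then show "(if V k = {} then 0 else ennreal (unit_ball_vol (real d) * (diameter (V k) / 2) ^ d)) \<le> ennreal ?c"
      by (auto intro: ennreal_leI)
  qed
  also have "\<dots> = ennreal (real (card I) * ?c)"
    using D by (simp add: ennreal_of_nat_eq_real_of_nat ennreal_mult[symmetric])
  also have "\<dots> \<le> ennreal M" using M by (rule ennreal_leI)
  finally show "hausdorff_pre d \<delta> A \<le> ennreal M" .
qed

lemma bounded_diameter_leI:
  fixes S :: "'a::real_normed_vector set"
  assumes "\<And>x y. x \<in> S \<Longrightarrow> y \<in> S \<Longrightarrow> norm (x - y) \<le> D" "0 \<le> D"
  shows "bounded S" "diameter S \<le> D"
proof -
  show "bounded S"
  proof (cases "S = {}")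
    case False
    then obtain x where "x \<in> S" by blast
    then show ?thesis using assms(1) by (auto simp: bounded_def dist_norm)
  qed simp
  show "diameter S \<le> D" using assms by (intro diameter_le) auto
qed

text \<open>
  The factor 2 comes from the number of slabs in \<open>hausdorff_outer_graph_cell\<close>, the last power
  from the diameters of their pieces, which are at most \<open>n\<close> times the side; the volume of the
  unit ball is the normalisation of the Hausdorff measure.
\<close>

definition graph_const :: "nat \<Rightarrow> real" where
  "graph_const n = 2 * unit_ball_vol (real (n - 1)) * real n ^ (n - 1)"

lemma graph_const_nonneg: "graph_const n \<ge> 0"
  by (simp add: graph_const_def)

lemma sum_coords_le:
  fixes x y :: "real^'n"
  assumes "\<And>l. \<bar>x $ l - y $ l\<bar> \<le> \<sigma>"
  shows "norm (x - y) \<le> real CARD('n) * \<sigma>"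
proof -
  have "norm (x - y) \<le> (\<Sum>l\<in>UNIV. \<bar>(x - y) $ l\<bar>)" by (rule norm_le_l1_cart)
  also have "\<dots> \<le> (\<Sum>l\<in>(UNIV::'n set). \<sigma>)" using assms by (intro sum_mono) simp
  finally show ?thesis by simp
qed

lemma nat_floor_bounds:
  fixes t \<sigma> :: real
  assumes "0 \<le> t" "\<sigma> > 0"
  shows "real (nat \<lfloor>t / \<sigma>\<rfloor>) * \<sigma> \<le> t" "t \<le> real (nat \<lfloor>t / \<sigma>\<rfloor>) * \<sigma> + \<sigma>"
proof -
  have "real (nat \<lfloor>t / \<sigma>\<rfloor>) \<le> t / \<sigma>" "t / \<sigma> \<le> real (nat \<lfloor>t / \<sigma>\<rfloor>) + 1"
    using assms by (auto simp: of_nat_floor)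
  then show "real (nat \<lfloor>t / \<sigma>\<rfloor>) * \<sigma> \<le> t" "t \<le> real (nat \<lfloor>t / \<sigma>\<rfloor>) * \<sigma> + \<sigma>"
    using assms(2) by (auto simp: field_simps)
qed

text \<open>
  The base is divided into cubes of side \<open>\<sigma>\<close>. Over each of them \<open>A\<close> has vertical extent at
  most \<open>2 K \<sigma>\<close>, so slabs of height \<open>\<sigma>\<close> cut it into at most \<open>2 K + 1\<close> pieces of diameter
  comparable to \<open>\<sigma>\<close>. The bound is linear in \<open>K\<close> although the parametrisation stretches
  lengths by a factor of order \<open>K\<close>, because only one direction is stretched.
\<close>

lemma hausdorff_outer_graph_cell:
  fixes A :: "(real^'n) set" and \<kappa> :: 'n
  assumes s: "s > 0" and K: "K \<ge> 0"
    and A: "\<And>x l. x \<in> A \<Longrightarrow> l \<noteq> \<kappa> \<Longrightarrow> a l \<le> x $ l \<and> x $ l \<le> a l + s"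
    and lip: "\<And>x y t. x \<in> A \<Longrightarrow> y \<in> A \<Longrightarrow> 0 \<le> t \<Longrightarrow> (\<And>l. l \<noteq> \<kappa> \<Longrightarrow> \<bar>x $ l - y $ l\<bar> \<le> t) \<Longrightarrow> \<bar>x $ \<kappa> - y $ \<kappa>\<bar> \<le> K * t"
  shows "hausdorff_outer (CARD('n) - 1) A \<le> ennreal (graph_const CARD('n) * (K + 1) * s ^ (CARD('n) - 1))"
proof (rule hausdorff_outer_le_finite_cover)
  fix \<delta> :: real assume \<delta>: "\<delta> > 0"
  let ?n = "CARD('n)" and ?d = "CARD('n) - 1"
  obtain N0 :: nat where N0: "real ?n * s / \<delta> \<le> real N0" using real_arch_simple by blast
  define N where "N = Suc N0"
  have N: "real N > 0" "real ?n * s / real N \<le> \<delta>"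
    using N0 \<delta> by (auto simp: N_def field_simps)
  define \<sigma> where "\<sigma> = s / real N"
  have \<sigma>: "\<sigma> > 0" "\<sigma> * real N = s" using s N by (auto simp: \<sigma>_def)
  define cell where "cell i = {x \<in> A. \<forall>l. l \<noteq> \<kappa> \<longrightarrow> a l + real (i l) * \<sigma> \<le> x $ l \<and> x $ l \<le> a l + real (i l) * \<sigma> + \<sigma>}" for i :: "'n \<Rightarrow> nat"
  have vert: "\<bar>x $ \<kappa> - y $ \<kappa>\<bar> \<le> K * \<sigma>" if "x \<in> cell i" "y \<in> cell i" for x y i
  proof (rule lip)
    show "x \<in> A" "y \<in> A" using that by (auto simp: cell_def)
    show "\<bar>x $ l - y $ l\<bar> \<le> \<sigma>" if "l \<noteq> \<kappa>" for l
      using \<open>x \<in> cell i\<close> \<open>y \<in> cell i\<close> that by (force simp: cell_def abs_le_iff)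
  qed (use \<sigma> in simp)
  \<comment> \<open>some point of the cell fixes the height from which the slabs are counted; for an empty cell any
    value will do\<close>
  define h where "h i = (SOME x. x \<in> cell i) $ \<kappa> - K * \<sigma>" for i
  define U where "U = (\<lambda>(i, q). {x \<in> cell i. h i + real q * \<sigma> \<le> x $ \<kappa> \<and> x $ \<kappa> \<le> h i + real q * \<sigma> + \<sigma>})"
  define Q where "Q = nat \<lfloor>2 * K\<rfloor>"
  define I where "I = PiE (- {\<kappa>}) (\<lambda>_. {..N}) \<times> {..Q}"
  define D where "D = real ?n * \<sigma>"
  have D: "0 \<le> D" "D \<le> \<delta>" using \<sigma> N s by (auto simp: D_def \<sigma>_def)
  have Ub: "norm (x - y) \<le> D" if "x \<in> U iq" "y \<in> U iq" for x y iq
    unfolding D_def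
  proof (rule sum_coords_le)
    fix l
    show "\<bar>x $ l - y $ l\<bar> \<le> \<sigma>"
      using that by (cases iq; cases "l = \<kappa>") (force simp: U_def cell_def abs_le_iff)+
  qed
  have fin: "finite I" unfolding I_def by (intro finite_cartesian_product finite_PiE) auto
  have cover: "A \<subseteq> (\<Union>iq\<in>I. U iq)"
  proof
    fix x assume x: "x \<in> A"
    define i where "i = restrict (\<lambda>l. nat \<lfloor>(x $ l - a l) / \<sigma>\<rfloor>) (- {\<kappa>})"
    have i: "i \<in> PiE (- {\<kappa>}) (\<lambda>_. {..N})"
    proof -
      have "nat \<lfloor>(x $ l - a l) / \<sigma>\<rfloor> \<le> N" if "l \<noteq> \<kappa>" for l
      proof -
        have "(x $ l - a l) / \<sigma> \<le> real N"
          using A[OF x that] \<sigma> by (simp add: divide_le_eq mult.commute)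
        then show ?thesis by linarith
      qed
      then show ?thesis by (auto simp: i_def)
    qed
    have xc: "x \<in> cell i"
      unfolding cell_def
    proof (intro CollectI conjI allI impI x)
      fix l assume l: "l \<noteq> \<kappa>"
      then have "0 \<le> x $ l - a l" using A[OF x l] by simp
      from nat_floor_bounds[OF this \<sigma>(1)] l
      show "a l + real (i l) * \<sigma> \<le> x $ l" "x $ l \<le> a l + real (i l) * \<sigma> + \<sigma>"
        by (auto simp: i_def)
    qed
    then have "(SOME x. x \<in> cell i) \<in> cell i" by (rule someI)
    from vert[OF xc this] have r: "0 \<le> x $ \<kappa> - h i" "x $ \<kappa> - h i \<le> 2 * K * \<sigma>" by (auto simp: h_def abs_le_iff)
    define q where "q = nat \<lfloor>(x $ \<kappa> - h i) / \<sigma>\<rfloor>"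
    have "(x $ \<kappa> - h i) / \<sigma> \<le> 2 * K" using r \<sigma> by (simp add: divide_le_eq)
    then have "q \<le> Q" unfolding q_def Q_def by (intro nat_mono floor_mono)
    moreover have "x \<in> U (i, q)"
      using nat_floor_bounds[OF r(1) \<sigma>(1)] xc by (auto simp: U_def q_def)
    ultimately show "x \<in> (\<Union>iq\<in>I. U iq)" using i by (auto simp: I_def)
  qed
  have "real (card I) * (unit_ball_vol (real ?d) * (D / 2) ^ ?d) \<le> graph_const ?n * (K + 1) * s ^ ?d"
  proof -
    have "card (- {\<kappa>}) = ?d" by (simp add: Compl_eq_Diff_UNIV card_Diff_singleton)
    then have "card I = (N + 1) ^ ?d * (Q + 1)"
      unfolding I_def by (simp add: card_cartesian_product card_PiE)
    then have "real (card I) = real (N + 1) ^ ?d * real (Q + 1)" by (simp only: of_nat_mult of_nat_power)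
    also have "\<dots> \<le> (2 * real N) ^ ?d * (2 * (K + 1))"
    proof (intro mult_mono power_mono)
      show "real (N + 1) \<le> 2 * real N" by (simp add: N_def)
      have "real Q \<le> 2 * K" using K by (simp add: Q_def of_nat_floor)
      then show "real (Q + 1) \<le> 2 * (K + 1)" by simp
    qed auto
    finally have "real (card I) \<le> (2 * real N) ^ ?d * (2 * (K + 1))" .
    then have "real (card I) * (unit_ball_vol (real ?d) * (D / 2) ^ ?d) \<le>
        (2 * real N) ^ ?d * (2 * (K + 1)) * (unit_ball_vol (real ?d) * (D / 2) ^ ?d)"
      using D by (intro mult_right_mono) auto
    also have "\<dots> = 2 * unit_ball_vol (real ?d) * (K + 1) * ((2 * real N) * (D / 2)) ^ ?d"
      unfolding power_mult_distrib by (simp only: ac_simps)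
    also have "(2 * real N) * (D / 2) = real ?n * s" using N by (simp add: D_def \<sigma>_def)
    also have "2 * unit_ball_vol (real ?d) * (K + 1) * (real ?n * s) ^ ?d = graph_const ?n * (K + 1) * s ^ ?d"
      unfolding graph_const_def power_mult_distrib by (simp only: ac_simps)
    finally show ?thesis .
  qed
  note cnt = this
  show "\<exists>(I::(('n \<Rightarrow> nat) \<times> nat) set) U D. finite I \<and> A \<subseteq> (\<Union>i\<in>I. U i) \<and>
      (\<forall>i\<in>I. bounded (U i) \<and> diameter (U i) \<le> D) \<and> 0 \<le> D \<and> D \<le> \<delta> \<and>
      real (card I) * (unit_ball_vol (real ?d) * (D / 2) ^ ?d) \<le> graph_const ?n * (K + 1) * s ^ ?d"
    by (intro exI[of _ I] exI[of _ U] exI[of _ D] conjI ballI fin cover D cnt bounded_diameter_leI[OF Ub D(1)])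
qed

definition set_coord :: "'n \<Rightarrow> real \<Rightarrow> real^'n \<Rightarrow> real^'n" where
  "set_coord \<kappa> t x = (\<chi> l. if l = \<kappa> then t else x $ l)"

lemma set_coord_nth [simp]: "set_coord \<kappa> t x $ l = (if l = \<kappa> then t else x $ l)"
  by (simp add: set_coord_def)

definition open_cube :: "real \<Rightarrow> (real^'n) set" where
  "open_cube L = {x. \<forall>l. 0 < x $ l \<and> x $ l < L}"

lemma open_cube_eq_box: "open_cube L = box 0 (\<chi> l. L)"
  by (auto simp: open_cube_def mem_box_cart)

lemma emeasure_box_cart:
  fixes a b :: "real^'n"
  assumes "\<And>l. a $ l \<le> b $ l"
  shows "emeasure lborel (box a b) = ennreal (\<Prod>l\<in>UNIV. b $ l - a $ l)"
proof -
  have ne: "cbox a b \<noteq> {}" using assms by (simp add: interval_ne_empty_cart)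
  have "emeasure lborel (box a b) = emeasure lborel (cbox a b)"
    by (simp add: emeasure_lborel_box_eq emeasure_lborel_cbox_eq)
  also have "\<dots> = ennreal (measure lborel (cbox a b))"
    using emeasure_lborel_cbox_finite[of a b] by (simp add: emeasure_eq_ennreal_measure)
  finally show ?thesis using ne by (simp add: content_cbox_cart)
qed

lemma emeasure_open_cube: "0 \<le> L \<Longrightarrow> emeasure lborel (open_cube L :: (real^'n) set) = ennreal (L ^ CARD('n))"
  unfolding open_cube_eq_box by (subst emeasure_box_cart) auto

text \<open>
  The Lipschitz condition is expressed through the coordinates other than \<open>\<kappa>\<close>, in the maximum
  norm. With \<open>t = 0\<close> it also says that \<open>\<gamma>\<close> does not depend on the coordinate \<open>\<kappa>\<close>; this is how
  functions of \<open>n - 1\<close> variables are represented.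
\<close>

lemma coordinate_lipschitz_continuous:
  fixes \<gamma> :: "real^'n \<Rightarrow> real"
  assumes K: "K \<ge> 0"
    and lip: "\<And>x y t. 0 \<le> t \<Longrightarrow> (\<And>l. l \<noteq> \<kappa> \<Longrightarrow> \<bar>x $ l - y $ l\<bar> \<le> t) \<Longrightarrow> \<bar>\<gamma> x - \<gamma> y\<bar> \<le> K * t"
  shows "continuous_on UNIV \<gamma>"
proof (rule continuous_onI)
  fix x :: "real^'n" and e :: real assume "e > 0"
  show "\<exists>d>0. \<forall>y\<in>UNIV. dist y x < d \<longrightarrow> dist (\<gamma> y) (\<gamma> x) \<le> e"
  proof (intro exI[of _ "e / (K + 1)"] conjI ballI impI)
    show "0 < e / (K + 1)" using \<open>e > 0\<close> K by simp
    fix y assume y: "dist y x < e / (K + 1)"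
    have "\<bar>y $ l - x $ l\<bar> \<le> e / (K + 1)" for l
      using component_le_norm_cart[of "y - x" l] y by (simp add: dist_norm)
    then have "\<bar>\<gamma> y - \<gamma> x\<bar> \<le> K * (e / (K + 1))" using \<open>e > 0\<close> K by (intro lip) auto
    also have "\<dots> \<le> e" using \<open>e > 0\<close> K by (simp add: field_simps)
    finally show "dist (\<gamma> y) (\<gamma> x) \<le> e" by (simp add: dist_real_def)
  qed
qed

text \<open>
  The graph is cut into the pieces over the cells of a fine grid. On each piece \<open>F\<close> is almost
  constant and \<open>hausdorff_outer_graph_cell\<close> bounds the measure. The integral over the base is
  written as an integral over the \<open>n\<close>-dimensional cube whose integrand is constant in the
  direction \<open>\<kappa>\<close>, which accounts for the division by \<open>L\<close>.
\<close>

lemma graph_integral_le: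
  fixes \<mu> :: "(real^'n) measure" and \<kappa> :: 'n and \<gamma> F :: "real^'n \<Rightarrow> real"
  assumes \<mu>[measurable_cong]: "sets \<mu> = sets borel"
    and \<mu>le: "\<And>A. A \<in> sets borel \<Longrightarrow> emeasure \<mu> A \<le> hausdorff_outer (CARD('n) - 1) A"
    and L: "L > 0" and K: "K \<ge> 0"
    and lip: "\<And>x y t. 0 \<le> t \<Longrightarrow> (\<And>l. l \<noteq> \<kappa> \<Longrightarrow> \<bar>x $ l - y $ l\<bar> \<le> t) \<Longrightarrow> \<bar>\<gamma> x - \<gamma> y\<bar> \<le> K * t"
    and F: "continuous_on UNIV F" "\<And>x. 0 \<le> F x"
  defines "\<Gamma> \<equiv> {x. (\<forall>l. l \<noteq> \<kappa> \<longrightarrow> 0 \<le> x $ l \<and> x $ l \<le> L) \<and> x $ \<kappa> = \<gamma> x}"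
  shows "\<Gamma> \<in> sets borel"
    and "(\<integral>\<^sup>+x. ennreal (F x) * indicator \<Gamma> x \<partial>\<mu>) \<le> ennreal (graph_const CARD('n) * (K + 1) / L) *
      (\<integral>\<^sup>+x. ennreal (F (set_coord \<kappa> (\<gamma> x) x)) * indicator (open_cube L) x \<partial>lborel)"
proof -
  let ?d = "CARD('n) - 1"
  define B where "B = graph_const CARD('n) * (K + 1)"
  have B: "B \<ge> 0" using K by (simp add: B_def graph_const_nonneg)
  have \<gamma>c: "continuous_on UNIV \<gamma>" by (rule coordinate_lipschitz_continuous[OF K lip])
  define G where "G x = F (set_coord \<kappa> (\<gamma> x) x)" for x
  have Gc: "continuous_on UNIV G"
    unfolding G_def set_coord_def
  proof (intro continuous_on_compose2[OF F(1)] continuous_on_vec_lambda)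
    show "continuous_on UNIV (\<lambda>x. if l = \<kappa> then \<gamma> x else x $ l)" for l
      using \<gamma>c by (cases "l = \<kappa>") (auto intro: continuous_intros)
  qed auto
  have G0: "0 \<le> G x" for x by (simp add: G_def F)
  have [measurable]: "F \<in> borel_measurable borel" "G \<in> borel_measurable borel"
    by (rule borel_measurable_continuous_onI, fact)+
  have "closed \<Gamma>"
    unfolding \<Gamma>_def
    by (intro closed_Collect_conj closed_Collect_all closed_Collect_imp closed_Collect_le closed_Collect_eq
        open_Collect_const continuous_intros \<gamma>c)
  then show \<Gamma>m[measurable]: "\<Gamma> \<in> sets borel" by simp
  have [measurable]: "open_cube L \<in> sets borel" by (simp add: open_cube_eq_box)
  have G\<Gamma>: "F x = G x" if "x \<in> \<Gamma>" for x
  proof -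
    have "set_coord \<kappa> (\<gamma> x) x = x" using that by (auto simp: \<Gamma>_def vec_eq_iff)
    then show ?thesis by (simp add: G_def)
  qed
  \<comment> \<open>\<open>G\<close> does not depend on the coordinate \<open>\<kappa>\<close>, so it is uniformly continuous on the whole slab\<close>
  have unif: "\<exists>\<eta>>0. \<forall>x y. (\<forall>l. l \<noteq> \<kappa> \<longrightarrow> 0 \<le> x $ l \<and> x $ l \<le> L \<and> 0 \<le> y $ l \<and> y $ l \<le> L \<and> \<bar>x $ l - y $ l\<bar> \<le> \<eta>)
      \<longrightarrow> \<bar>G x - G y\<bar> \<le> \<epsilon>" if "\<epsilon> > 0" for \<epsilon>
  proof -
    have flat: "G (set_coord \<kappa> 0 x) = G x" for x
    proof -
      have "\<bar>\<gamma> (set_coord \<kappa> 0 x) - \<gamma> x\<bar> \<le> K * 0" by (intro lip) auto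
      then show ?thesis by (auto simp: G_def vec_eq_iff intro!: arg_cong[where f=F])
    qed
    have "uniformly_continuous_on (cbox 0 (\<chi> l. L)) G"
      by (intro compact_uniformly_continuous continuous_on_subset[OF Gc] compact_cbox) auto
    then have "\<forall>e>0. \<exists>d>0. \<forall>x\<in>cbox 0 (\<chi> l. L). \<forall>y\<in>cbox 0 (\<chi> l. L). dist y x < d \<longrightarrow> dist (G y) (G x) < e"
      unfolding uniformly_continuous_on_def .
    from this[rule_format, OF that] obtain d where d: "d > 0"
      "\<forall>x\<in>cbox 0 (\<chi> l. L). \<forall>y\<in>cbox 0 (\<chi> l. L). dist y x < d \<longrightarrow> dist (G y) (G x) < \<epsilon>" by auto
    define \<eta> where "\<eta> = d / (2 * real CARD('n))"
    have \<eta>: "\<eta> > 0" "real CARD('n) * \<eta> < d" using d(1) by (auto simp: \<eta>_def)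
    show ?thesis
    proof (intro exI[of _ \<eta>] conjI allI impI \<eta>(1))
      fix x y :: "real^'n"
      assume xy: "\<forall>l. l \<noteq> \<kappa> \<longrightarrow> 0 \<le> x $ l \<and> x $ l \<le> L \<and> 0 \<le> y $ l \<and> y $ l \<le> L \<and> \<bar>x $ l - y $ l\<bar> \<le> \<eta>"
      have "norm (set_coord \<kappa> 0 x - set_coord \<kappa> 0 y) \<le> real CARD('n) * \<eta>"
        using xy \<eta> by (intro sum_coords_le) auto
      then have "dist (G (set_coord \<kappa> 0 x)) (G (set_coord \<kappa> 0 y)) < \<epsilon>"
        using xy L \<eta>(2) by (intro d(2)[rule_format]) (auto simp: mem_box_cart dist_norm)
      then show "\<bar>G x - G y\<bar> \<le> \<epsilon>" by (simp add: flat dist_real_def)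
    qed
  qed
  have key: "(\<integral>\<^sup>+x. ennreal (F x) * indicator \<Gamma> x \<partial>\<mu>) \<le> ennreal (B / L) *
      (\<integral>\<^sup>+x. ennreal (G x + 2 * \<epsilon>) * indicator (open_cube L) x \<partial>lborel)" if \<epsilon>: "\<epsilon> > 0" for \<epsilon>
  proof -
    obtain \<eta> where \<eta>: "\<eta> > 0" and osc: "\<And>x y. (\<And>l. l \<noteq> \<kappa> \<Longrightarrow> 0 \<le> x $ l \<and> x $ l \<le> L \<and> 0 \<le> y $ l \<and> y $ l \<le> L \<and> \<bar>x $ l - y $ l\<bar> \<le> \<eta>)
      \<Longrightarrow> \<bar>G x - G y\<bar> \<le> \<epsilon>" using unif[OF \<epsilon>] by metis
    obtain N0 :: nat where N0: "L / \<eta> \<le> real N0" using real_arch_simple by blast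
    define N where "N = Suc N0"
    define \<sigma> where "\<sigma> = L / real N"
    have N: "real N > 0" by (simp add: N_def)
    have \<sigma>: "\<sigma> > 0" "real N * \<sigma> = L" "\<sigma> \<le> \<eta>"
      using L \<eta> N0 by (auto simp: \<sigma>_def N_def field_simps)
    define I where "I = PiE (- {\<kappa>}) (\<lambda>_. {..<N})"
    have fin: "finite I" unfolding I_def by (intro finite_PiE) auto
    have iN: "real (i l) * \<sigma> + \<sigma> \<le> L" if "i \<in> I" "l \<noteq> \<kappa>" for i l
    proof -
      have "i l < N" using that by (auto simp: I_def)
      then have "(real (i l) + 1) * \<sigma> \<le> real N * \<sigma>" using \<sigma> by (intro mult_right_mono) auto
      then show ?thesis using \<sigma> by (simp add: algebra_simps)
    qed
    define \<Gamma>i where "\<Gamma>i i = {x \<in> \<Gamma>. \<forall>l. l \<noteq> \<kappa> \<longrightarrow> real (i l) * \<sigma> \<le> x $ l \<and> x $ l \<le> real (i l) * \<sigma> + \<sigma>}" for i :: "'n \<Rightarrow> nat"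
    define c where "c i = (\<chi> l. if l = \<kappa> then 0 else real (i l) * \<sigma>)" for i :: "'n \<Rightarrow> nat"
    define C where "C i = box (c i) (\<chi> l. if l = \<kappa> then L else real (i l) * \<sigma> + \<sigma>)" for i
    have [measurable]: "C i \<in> sets borel" for i by (simp add: C_def)
    have CD: "real (i l) * \<sigma> < x $ l" "x $ l < real (i l) * \<sigma> + \<sigma>" if "x \<in> C i" "l \<noteq> \<kappa>" for x i l
      using that(1)[unfolded C_def mem_box_cart c_def, rule_format, of l] that(2) by simp_all
    have "closed (\<Gamma>i i)" for i
    proof -
      have "\<Gamma>i i = \<Gamma> \<inter> {x. \<forall>l. l \<noteq> \<kappa> \<longrightarrow> real (i l) * \<sigma> \<le> x $ l \<and> x $ l \<le> real (i l) * \<sigma> + \<sigma>}"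
        by (auto simp: \<Gamma>i_def)
      then show ?thesis
        using \<open>closed \<Gamma>\<close>
        by (auto intro!: closed_Int closed_Collect_conj closed_Collect_all closed_Collect_imp closed_Collect_le
            open_Collect_const continuous_intros)
    qed
    then have \<Gamma>im[measurable]: "\<Gamma>i i \<in> sets borel" for i by simp
    have cov: "\<exists>i\<in>I. x \<in> \<Gamma>i i" if x: "x \<in> \<Gamma>" for x
    proof -
      \<comment> \<open>the minimum takes care of the coordinate \<open>L\<close>, which belongs to the last cell\<close>
      define i where "i = restrict (\<lambda>l. min N0 (nat \<lfloor>x $ l / \<sigma>\<rfloor>)) (- {\<kappa>})"
      have "i \<in> I" by (auto simp: i_def I_def N_def)
      moreover have "x \<in> \<Gamma>i i"
        unfolding \<Gamma>i_def
      proof (intro CollectI conjI allI impI x)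
        fix l assume l: "l \<noteq> \<kappa>"
        then have x0: "0 \<le> x $ l" "x $ l \<le> L" using x by (auto simp: \<Gamma>_def)
        note b = nat_floor_bounds[OF x0(1) \<sigma>(1)]
        have "real (i l) \<le> real (nat \<lfloor>x $ l / \<sigma>\<rfloor>)" using l by (simp add: i_def)
        then have "real (i l) * \<sigma> \<le> real (nat \<lfloor>x $ l / \<sigma>\<rfloor>) * \<sigma>" using \<sigma> by (intro mult_right_mono) auto
        then show "real (i l) * \<sigma> \<le> x $ l" using b by linarith
        show "x $ l \<le> real (i l) * \<sigma> + \<sigma>"
        proof (cases "nat \<lfloor>x $ l / \<sigma>\<rfloor> \<le> N0")
          case True
          then have "i l = nat \<lfloor>x $ l / \<sigma>\<rfloor>" using l by (simp add: i_def)
          then show ?thesis using b(2) by simp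
        next
          case False
          then have "i l = N0" using l by (simp add: i_def)
          then have "real (i l) * \<sigma> + \<sigma> = L" using \<sigma>(2) by (simp add: N_def algebra_simps)
          then show ?thesis using x0 by simp
        qed
      qed
      ultimately show ?thesis by blast
    qed
    have \<mu>i: "emeasure \<mu> (\<Gamma>i i) \<le> ennreal (B * \<sigma> ^ ?d)" for i
    proof -
      have "hausdorff_outer ?d (\<Gamma>i i) \<le> ennreal (graph_const CARD('n) * (K + 1) * \<sigma> ^ ?d)"
      proof (rule hausdorff_outer_graph_cell[OF \<sigma>(1) K, of _ \<kappa> "\<lambda>l. real (i l) * \<sigma>"])
        show "real (i l) * \<sigma> \<le> x $ l \<and> x $ l \<le> real (i l) * \<sigma> + \<sigma>" if "x \<in> \<Gamma>i i" "l \<noteq> \<kappa>" for x l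
          using that by (auto simp: \<Gamma>i_def)
        show "\<bar>x $ \<kappa> - y $ \<kappa>\<bar> \<le> K * t" if "x \<in> \<Gamma>i i" "y \<in> \<Gamma>i i" "0 \<le> t"
          "\<And>l. l \<noteq> \<kappa> \<Longrightarrow> \<bar>x $ l - y $ l\<bar> \<le> t" for x y t
          using lip[OF that(3,4)] that(1,2) by (auto simp: \<Gamma>i_def \<Gamma>_def)
      qed
      then show ?thesis using \<mu>le[OF \<Gamma>im[of i]] unfolding B_def by (rule order_trans[rotated])
    qed
    have Ci: "emeasure lborel (C i) = ennreal (L * \<sigma> ^ ?d)" for i
    proof -
      have "(\<Prod>l\<in>UNIV. (\<chi> l. if l = \<kappa> then L else real (i l) * \<sigma> + \<sigma>) $ l - c i $ l) = (\<Prod>l\<in>UNIV. if l = \<kappa> then L else \<sigma>)"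
        by (intro prod.cong) (auto simp: c_def)
      also have "\<dots> = L * (\<Prod>l\<in>UNIV - {\<kappa>}. if l = \<kappa> then L else \<sigma>)"
        by (subst prod.remove[of _ \<kappa>]) auto
      also have "(\<Prod>l\<in>UNIV - {\<kappa>}. if l = \<kappa> then L else \<sigma>) = (\<Prod>l\<in>UNIV - {\<kappa>}. \<sigma>)"
        by (intro prod.cong) auto
      also have "\<dots> = \<sigma> ^ ?d" by (simp add: card_Diff_singleton)
      finally show ?thesis unfolding C_def using L \<sigma> by (subst emeasure_box_cart) (auto simp: c_def)
    qed
    have disj: "(\<Sum>i\<in>I. indicator (C i) x) \<le> (indicator (open_cube L) x :: ennreal)" for x
    proof (cases "\<exists>i\<in>I. x \<in> C i")
      case True
      then obtain i where i: "i \<in> I" "x \<in> C i" by blast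
      have uniq: "k = i" if k: "k \<in> I" "x \<in> C k" for k
      proof (rule PiE_ext[of k "- {\<kappa>}" "\<lambda>_. {..<N}"])
        show "k \<in> PiE (- {\<kappa>}) (\<lambda>_. {..<N})" "i \<in> PiE (- {\<kappa>}) (\<lambda>_. {..<N})" using k i by (auto simp: I_def)
        fix l assume "l \<in> - {\<kappa>}"
        then have l: "l \<noteq> \<kappa>" by simp
        have a: "real (k l) * \<sigma> < x $ l" "x $ l < real (k l) * \<sigma> + \<sigma>" "real (i l) * \<sigma> < x $ l" "x $ l < real (i l) * \<sigma> + \<sigma>"
          by (rule CD[OF k(2) l] CD[OF i(2) l])+
        have "real (k l) * \<sigma> < (real (i l) + 1) * \<sigma>" "real (i l) * \<sigma> < (real (k l) + 1) * \<sigma>"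
          using a by (auto simp: algebra_simps)
        then have "real (k l) < real (i l) + 1" "real (i l) < real (k l) + 1"
          using \<sigma>(1) by (auto simp: mult_less_cancel_right)
        then show "k l = i l" by linarith
      qed
      have "(\<Sum>k\<in>I. indicator (C k) x) = (\<Sum>k\<in>{i}. indicator (C k) x :: ennreal)"
      proof (rule sum.mono_neutral_right[OF fin])
        show "\<forall>k\<in>I - {i}. indicator (C k) x = (0 :: ennreal)"
          using uniq by (metis DiffD1 DiffD2 indicator_simps(2) singletonI)
      qed (use i in simp)
      also have "\<dots> = 1" using i by simp
      also have "x \<in> open_cube L"
        unfolding open_cube_def
      proof (intro CollectI allI)
        fix l
        show "0 < x $ l \<and> x $ l < L"
        proof (cases "l = \<kappa>")
          case True
          then show ?thesis using i(2)[unfolded C_def mem_box_cart c_def, rule_format, of \<kappa>] by simp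
        next
          case False
          then have "real (i l) * \<sigma> < x $ l" "x $ l < real (i l) * \<sigma> + \<sigma>"
            using CD[OF i(2) False] by simp_all
          moreover have "0 \<le> real (i l) * \<sigma>" using \<sigma> by simp
          ultimately show ?thesis using iN[OF i(1) False] by linarith
        qed
      qed
      then have "1 \<le> (indicator (open_cube L) x :: ennreal)" by simp
      finally show ?thesis .
    next
      case False
      then show ?thesis by (auto simp: indicator_def intro!: sum.neutral)
    qed
    have near: "\<bar>G x - G (c i)\<bar> \<le> \<epsilon>" if i: "i \<in> I"
      and x: "\<And>l. l \<noteq> \<kappa> \<Longrightarrow> real (i l) * \<sigma> \<le> x $ l \<and> x $ l \<le> real (i l) * \<sigma> + \<sigma>" for i x
    proof (rule osc)
      fix l assume l: "l \<noteq> \<kappa>"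
      have "0 \<le> real (i l) * \<sigma>" using \<sigma> by simp
      moreover have "c i $ l = real (i l) * \<sigma>" using l by (simp add: c_def)
      ultimately show "0 \<le> x $ l \<and> x $ l \<le> L \<and> 0 \<le> c i $ l \<and> c i $ l \<le> L \<and> \<bar>x $ l - c i $ l\<bar> \<le> \<eta>"
        using x[OF l] iN[OF i l] \<sigma>(1,3) by (simp only: abs_le_iff) (intro conjI TrueI; linarith)
    qed
    have "(\<integral>\<^sup>+x. ennreal (F x) * indicator \<Gamma> x \<partial>\<mu>) \<le> (\<integral>\<^sup>+x. (\<Sum>i\<in>I. ennreal (G (c i) + \<epsilon>) * indicator (\<Gamma>i i) x) \<partial>\<mu>)"
    proof (rule nn_integral_mono)
      fix x
      show "ennreal (F x) * indicator \<Gamma> x \<le> (\<Sum>i\<in>I. ennreal (G (c i) + \<epsilon>) * indicator (\<Gamma>i i) x)"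
      proof (cases "x \<in> \<Gamma>")
        case True
        then obtain i where i: "i \<in> I" "x \<in> \<Gamma>i i" using cov by blast
        then have "\<bar>G x - G (c i)\<bar> \<le> \<epsilon>" by (intro near) (auto simp: \<Gamma>i_def)
        then have "ennreal (F x) \<le> ennreal (G (c i) + \<epsilon>)" using G\<Gamma>[OF True] by (intro ennreal_leI) auto
        then have "ennreal (F x) * indicator \<Gamma> x \<le> ennreal (G (c i) + \<epsilon>) * indicator (\<Gamma>i i) x"
          using True i by simp
        also have "\<dots> \<le> (\<Sum>i\<in>I. ennreal (G (c i) + \<epsilon>) * indicator (\<Gamma>i i) x)"
          using i fin by (intro member_le_sum) auto
        finally show ?thesis .
      qed simp
    qed
    also have "\<dots> = (\<Sum>i\<in>I. ennreal (G (c i) + \<epsilon>) * emeasure \<mu> (\<Gamma>i i))"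
      by (subst nn_integral_sum) (auto simp: nn_integral_cmult \<mu>)
    also have "\<dots> \<le> (\<Sum>i\<in>I. ennreal (G (c i) + \<epsilon>) * ennreal (B * \<sigma> ^ ?d))"
      by (intro sum_mono mult_left_mono \<mu>i) auto
    also have "\<dots> = (\<Sum>i\<in>I. ennreal (B / L) * (ennreal (G (c i) + \<epsilon>) * emeasure lborel (C i)))"
    proof (rule sum.cong)
      fix i
      have "B * \<sigma> ^ ?d = B / L * (L * \<sigma> ^ ?d)" using L by simp
      then have "ennreal (B * \<sigma> ^ ?d) = ennreal (B / L) * emeasure lborel (C i)"
        unfolding Ci using B L \<sigma> by (simp add: ennreal_mult[symmetric])
      then show "ennreal (G (c i) + \<epsilon>) * ennreal (B * \<sigma> ^ ?d) = ennreal (B / L) * (ennreal (G (c i) + \<epsilon>) * emeasure lborel (C i))"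
        by (simp add: ac_simps)
    qed simp
    also have "\<dots> = ennreal (B / L) * (\<integral>\<^sup>+x. (\<Sum>i\<in>I. ennreal (G (c i) + \<epsilon>) * indicator (C i) x) \<partial>lborel)"
      by (subst nn_integral_sum) (auto simp: nn_integral_cmult sum_distrib_left)
    also have "\<dots> \<le> ennreal (B / L) * (\<integral>\<^sup>+x. ennreal (G x + 2 * \<epsilon>) * indicator (open_cube L) x \<partial>lborel)"
    proof (intro mult_left_mono nn_integral_mono)
      fix x
      have "(\<Sum>i\<in>I. ennreal (G (c i) + \<epsilon>) * indicator (C i) x) \<le> (\<Sum>i\<in>I. ennreal (G x + 2 * \<epsilon>) * indicator (C i) x)"
      proof (rule sum_mono)
        fix i assume i: "i \<in> I"
        show "ennreal (G (c i) + \<epsilon>) * indicator (C i) x \<le> ennreal (G x + 2 * \<epsilon>) * indicator (C i) x"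
        proof (cases "x \<in> C i")
          case True
          then have "real (i l) * \<sigma> \<le> x $ l \<and> x $ l \<le> real (i l) * \<sigma> + \<sigma>" if "l \<noteq> \<kappa>" for l
            using CD[OF True that] by simp
          from near[OF i this] have "\<bar>G x - G (c i)\<bar> \<le> \<epsilon>" by simp
          then show ?thesis using True by (auto intro!: ennreal_leI)
        qed simp
      qed
      also have "\<dots> = ennreal (G x + 2 * \<epsilon>) * (\<Sum>i\<in>I. indicator (C i) x)" by (simp add: sum_distrib_left)
      also have "\<dots> \<le> ennreal (G x + 2 * \<epsilon>) * indicator (open_cube L) x" by (intro mult_left_mono disj) auto
      finally show "(\<Sum>i\<in>I. ennreal (G (c i) + \<epsilon>) * indicator (C i) x) \<le> ennreal (G x + 2 * \<epsilon>) * indicator (open_cube L) x" .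
    qed auto
    finally show ?thesis .
  qed
  let ?X = "\<integral>\<^sup>+x. ennreal (G x) * indicator (open_cube L) x \<partial>lborel"
  let ?V = "L ^ CARD('n)"
  have "(\<integral>\<^sup>+x. ennreal (F x) * indicator \<Gamma> x \<partial>\<mu>) \<le> ennreal (B / L) * ?X"
  proof (rule ennreal_le_epsilon)
    fix e :: real assume e: "e > 0"
    define \<epsilon> where "\<epsilon> = e / (2 * (B / L) * ?V + 1)"
    have den: "2 * (B / L) * ?V + 1 > 0" using B L by (intro add_nonneg_pos mult_nonneg_nonneg) auto
    have \<epsilon>: "\<epsilon> > 0" using e den by (simp add: \<epsilon>_def)
    have le: "B / L * (2 * \<epsilon> * ?V) \<le> e"
    proof -
      have "B / L * (2 * \<epsilon> * ?V) = \<epsilon> * (2 * (B / L) * ?V)" by (simp only: ac_simps times_divide_eq_left times_divide_eq_right)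
      also have "\<dots> \<le> \<epsilon> * (2 * (B / L) * ?V + 1)" using \<epsilon> by (intro mult_left_mono) auto
      also have "\<dots> = e" using den by (simp add: \<epsilon>_def)
      finally show ?thesis .
    qed
    have "(\<integral>\<^sup>+x. ennreal (G x + 2 * \<epsilon>) * indicator (open_cube L) x \<partial>lborel) =
        (\<integral>\<^sup>+x. ennreal (G x) * indicator (open_cube L) x + ennreal (2 * \<epsilon>) * indicator (open_cube L) x \<partial>lborel)"
      using G0 \<epsilon> by (intro nn_integral_cong) (simp add: ennreal_plus distrib_right)
    also have "\<dots> = ?X + ennreal (2 * \<epsilon> * ?V)"
      using L \<epsilon> by (subst nn_integral_add) (auto simp: nn_integral_cmult emeasure_open_cube ennreal_mult)
    finally have split: "(\<integral>\<^sup>+x. ennreal (G x + 2 * \<epsilon>) * indicator (open_cube L) x \<partial>lborel) = ?X + ennreal (2 * \<epsilon> * ?V)" .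
    have "ennreal (B / L * (2 * \<epsilon> * ?V)) = ennreal (B / L) * ennreal (2 * \<epsilon> * ?V)"
      using B L \<epsilon> by (intro ennreal_mult) auto
    then have "ennreal (B / L) * (\<integral>\<^sup>+x. ennreal (G x + 2 * \<epsilon>) * indicator (open_cube L) x \<partial>lborel) =
        ennreal (B / L) * ?X + ennreal (B / L * (2 * \<epsilon> * ?V))"
      unfolding split by (simp only: distrib_left)
    also have "\<dots> \<le> ennreal (B / L) * ?X + ennreal e"
      using le by (intro add_mono ennreal_leI) auto
    finally show "(\<integral>\<^sup>+x. ennreal (F x) * indicator \<Gamma> x \<partial>\<mu>) \<le> ennreal (B / L) * ?X + ennreal e"
      using key[OF \<epsilon>] by (rule order_trans[rotated])
  qed
  then show "(\<integral>\<^sup>+x. ennreal (F x) * indicator \<Gamma> x \<partial>\<mu>) \<le> ennreal (graph_const CARD('n) * (K + 1) / L) *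
      (\<integral>\<^sup>+x. ennreal (F (set_coord \<kappa> (\<gamma> x) x)) * indicator (open_cube L) x \<partial>lborel)"
    by (simp add: B_def G_def)
qed

lemma sets_hausdorff_measure [measurable_cong]: "sets (hausdorff_measure d) = sets borel"
proof -
  have "sigma_sets UNIV (sets (borel :: 'a measure)) = sets borel"
    using sets.sigma_sets_eq[of "borel :: 'a measure"] by simp
  then show ?thesis by (simp add: hausdorff_measure_def)
qed

text \<open>
  There are two cases in the definition by \<open>measure_of\<close>: if the outer measure is countably
  additive on the Borel sets, the two sides agree there, and otherwise the left-hand side is
  0.
\<close>

lemma emeasure_hausdorff_measure_le: "emeasure (hausdorff_measure d) A \<le> hausdorff_outer d A"
  unfolding hausdorff_measure_def by (simp add: emeasure_measure_of_conv)

section \<open>A trace inequality of Poincare type\<close>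

text \<open>
  The fundamental theorem of calculus and Jensen's inequality on the unit interval. The open
  interval is used because an endpoint of the segment may lie on the boundary of the domain
  in the applications.
\<close>

lemma segment_powr_le:
  fixes v :: "real^'n \<Rightarrow> real" and G :: "real^'n \<Rightarrow> real^'n"
  assumes p: "p > 1" and d: "\<And>x. (v has_derivative (\<lambda>h. G x \<bullet> h)) (at x)" and c: "continuous_on UNIV G"
  shows "ennreal (\<bar>v y - v x\<bar> powr p) \<le>
    (\<integral>\<^sup>+t. ennreal (\<bar>G (x + t *\<^sub>R (y - x)) \<bullet> (y - x)\<bar> powr p) * indicator {0<..<1} t \<partial>lborel)"
proof -
  let ?f = "\<lambda>t::real. G (x + t *\<^sub>R (y - x)) \<bullet> (y - x)"
  have fc: "continuous_on UNIV ?f"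
    by (intro continuous_intros continuous_on_compose2[OF c]) auto
  have [measurable]: "?f \<in> borel_measurable borel" by (rule borel_measurable_continuous_onI[OF fc])
  have der: "((\<lambda>t. v (x + t *\<^sub>R (y - x))) has_real_derivative ?f t) (at t)" for t
  proof -
    have "((\<lambda>t. x + t *\<^sub>R (y - x)) has_derivative (\<lambda>h. h *\<^sub>R (y - x))) (at t)"
      by (auto intro!: derivative_eq_intros)
    from has_derivative_compose[OF this d] show ?thesis
      unfolding has_field_derivative_def
      by (rule has_derivative_eq_rhs) (auto simp: fun_eq_iff)
  qed
  have "(\<integral>t. ?f t * indicator {0..1} t \<partial>lborel) = v (x + 1 *\<^sub>R (y - x)) - v (x + 0 *\<^sub>R (y - x))"
    using fc by (intro integral_FTC_Icc_real der) (auto simp: continuous_on_eq_continuous_at)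
  moreover have "(\<integral>t. ?f t * indicator {0..1} t \<partial>lborel) = (\<integral>t. ?f t * indicator {0<..<1} t \<partial>lborel)"
  proof (rule integral_cong_AE)
    have "AE t in lborel. t \<noteq> (0::real)" "AE t in lborel. t \<noteq> (1::real)" by (rule AE_lborel_singleton)+
    then show "AE t in lborel. ?f t * indicator {0..1} t = ?f t * indicator {0<..<1} t"
      by eventually_elim (auto simp: indicator_def)
  qed simp_all
  moreover have "(\<integral>t. ?f t * indicator {0<..<1} t \<partial>lborel) = (\<integral>t. ?f t \<partial>restrict_space lborel {0<..<1})"
    by (subst integral_restrict_space) (auto simp: mult.commute)
  ultimately have eq: "v y - v x = (\<integral>t. ?f t \<partial>restrict_space lborel {0<..<1})" by simp
  have "ennreal (\<bar>\<integral>t. ?f t \<partial>restrict_space lborel {0<..<1}\<bar> powr p) \<le> ennreal (1 powr (p - 1)) *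
      (\<integral>\<^sup>+t. ennreal (\<bar>?f t\<bar> powr p) \<partial>restrict_space lborel {0<..<1})"
    using p by (intro powr_integral_le borel_measurable_restrict_lborel)
      (auto simp: emeasure_restrict_space space_restrict_space)
  also have "\<dots> = (\<integral>\<^sup>+t. ennreal (\<bar>?f t\<bar> powr p) * indicator {0<..<1} t \<partial>lborel)"
    by (simp add: nn_integral_restrict_space)
  finally show ?thesis unfolding eq .
qed

lemma open_cube_measurable [measurable, simp]: "open_cube L \<in> sets borel"
  by (simp add: open_cube_eq_box)

lemma convex_open_cube: "convex (open_cube L)"
  by (simp add: open_cube_eq_box convex_box)

text \<open>
  After \<open>segment_powr_le\<close> it remains to integrate \<open>H (x + t (y - x))\<close> over \<open>x\<close>, \<open>y\<close> and \<open>t\<close>.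
  For \<open>t \<ge> 1/2\<close> the substitution in \<open>y\<close> has a Jacobian of at least \<open>2\<^bsup>-n\<^esup>\<close>, and for \<open>t \<le> 1/2\<close>
  the one in \<open>x\<close> does.
\<close>

lemma Poincare_cube_double:
  fixes v :: "real^'n \<Rightarrow> real" and G :: "real^'n \<Rightarrow> real^'n"
  assumes p: "p > 1" and d: "\<And>x. (v has_derivative (\<lambda>h. G x \<bullet> h)) (at x)" and c: "continuous_on UNIV G"
    and L: "L > 0"
  shows "(\<integral>\<^sup>+x. (\<integral>\<^sup>+y. ennreal (\<bar>v x - v y\<bar> powr p) * indicator (open_cube L) y \<partial>lborel) * indicator (open_cube L) x \<partial>lborel)
    \<le> ennreal ((real CARD('n) * L) powr p * 2 ^ CARD('n) * L ^ CARD('n)) *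
      (\<integral>\<^sup>+x. ennreal (norm (G x) powr p) * indicator (open_cube L) x \<partial>lborel)"
proof -
  let ?Q = "open_cube L :: (real^'n) set" and ?D = "real CARD('n) * L"
  have [measurable]: "v \<in> borel_measurable borel"
    using d by (intro borel_measurable_continuous_onI)
      (auto simp: continuous_on_eq_continuous_at intro: has_derivative_continuous)
  have [measurable]: "G \<in> borel_measurable borel" by (rule borel_measurable_continuous_onI[OF c])
  define H where "H z = ennreal (norm (G z) powr p) * indicator ?Q z" for z
  have [measurable]: "H \<in> borel_measurable borel" unfolding H_def by measurable
  define I where "I = (\<integral>\<^sup>+x. H x \<partial>lborel)"
  let ?i = "indicator ?Q :: real^'n \<Rightarrow> ennreal" and ?j = "indicator {0<..<1} :: real \<Rightarrow> ennreal"
  have pt: "ennreal (\<bar>v x - v y\<bar> powr p) \<le> (\<integral>\<^sup>+t. ennreal (?D powr p) * H (x + t *\<^sub>R (y - x)) * ?j t \<partial>lborel)"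
    if x: "x \<in> ?Q" and y: "y \<in> ?Q" for x y
  proof -
    have D: "norm (y - x) \<le> ?D"
    proof (rule sum_coords_le)
      fix l
      have "0 < x $ l" "x $ l < L" "0 < y $ l" "y $ l < L" using x y by (auto simp: open_cube_def)
      then show "\<bar>y $ l - x $ l\<bar> \<le> L" by linarith
    qed
    have "ennreal (\<bar>v x - v y\<bar> powr p) = ennreal (\<bar>v y - v x\<bar> powr p)" by (simp add: abs_minus_commute)
    also have "\<dots> \<le> (\<integral>\<^sup>+t. ennreal (\<bar>G (x + t *\<^sub>R (y - x)) \<bullet> (y - x)\<bar> powr p) * ?j t \<partial>lborel)"
      by (rule segment_powr_le[OF p d c])
    also have "\<dots> \<le> (\<integral>\<^sup>+t. ennreal (?D powr p) * H (x + t *\<^sub>R (y - x)) * ?j t \<partial>lborel)"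
    proof (intro nn_integral_mono)
      fix t :: real
      show "ennreal (\<bar>G (x + t *\<^sub>R (y - x)) \<bullet> (y - x)\<bar> powr p) * ?j t \<le> ennreal (?D powr p) * H (x + t *\<^sub>R (y - x)) * ?j t"
      proof (cases "t \<in> {0<..<1}")
        case True
        let ?z = "x + t *\<^sub>R (y - x)"
        have "(1 - t) *\<^sub>R x + t *\<^sub>R y \<in> ?Q"
          using True by (intro convexD_alt[OF convex_open_cube x y]) auto
        then have z: "?z \<in> ?Q" by (simp add: algebra_simps)
        have "\<bar>G ?z \<bullet> (y - x)\<bar> \<le> norm (G ?z) * norm (y - x)" by (rule Cauchy_Schwarz_ineq2)
        also have "\<dots> \<le> norm (G ?z) * ?D" using D by (intro mult_left_mono) auto
        finally have "\<bar>G ?z \<bullet> (y - x)\<bar> powr p \<le> (norm (G ?z) * ?D) powr p"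
          using p by (intro powr_mono2) auto
        also have "\<dots> = ?D powr p * norm (G ?z) powr p" using L by (simp add: powr_mult)
        finally show ?thesis using z True by (simp add: H_def ennreal_mult[symmetric] ennreal_leI)
      qed simp
    qed
    finally show ?thesis .
  qed
  have half1: "(\<integral>\<^sup>+y. H (x + t *\<^sub>R (y - x)) \<partial>lborel) \<le> ennreal (2 ^ CARD('n)) * I" if "t \<ge> 1 / 2" for x t
  proof -
    have "x + t *\<^sub>R (y - x) = diag_affine (\<lambda>_. t) ((1 - t) *\<^sub>R x) y" for y
      by (simp add: vec_eq_iff algebra_simps)
    then show ?thesis unfolding I_def using that by (simp only:) (intro nn_integral_diag_affine_le, auto)
  qed
  have half2: "(\<integral>\<^sup>+x. H (x + t *\<^sub>R (y - x)) \<partial>lborel) \<le> ennreal (2 ^ CARD('n)) * I" if "t \<le> 1 / 2" for y t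
  proof -
    have "x + t *\<^sub>R (y - x) = diag_affine (\<lambda>_. 1 - t) (t *\<^sub>R y) x" for x
      by (simp add: vec_eq_iff algebra_simps)
    then show ?thesis unfolding I_def using that by (simp only:) (intro nn_integral_diag_affine_le, auto)
  qed
  have V: "(\<integral>\<^sup>+x. A * ?i x \<partial>lborel) = A * ennreal (L ^ CARD('n))" for A
    using L by (simp add: nn_integral_cmult emeasure_open_cube)
  have inner: "(\<integral>\<^sup>+x. (\<integral>\<^sup>+y. H (x + t *\<^sub>R (y - x)) * (?i x * ?i y) \<partial>lborel) \<partial>lborel) \<le>
      ennreal (2 ^ CARD('n)) * I * ennreal (L ^ CARD('n))" for t
  proof (cases "t \<ge> 1 / 2")
    case True
    have "(\<integral>\<^sup>+x. (\<integral>\<^sup>+y. H (x + t *\<^sub>R (y - x)) * (?i x * ?i y) \<partial>lborel) \<partial>lborel) \<le>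
        (\<integral>\<^sup>+x. (\<integral>\<^sup>+y. H (x + t *\<^sub>R (y - x)) * ?i x \<partial>lborel) \<partial>lborel)"
      by (intro nn_integral_mono) (auto simp: indicator_def)
    also have "\<dots> = (\<integral>\<^sup>+x. (\<integral>\<^sup>+y. H (x + t *\<^sub>R (y - x)) \<partial>lborel) * ?i x \<partial>lborel)"
      by (simp add: nn_integral_multc)
    also have "\<dots> \<le> (\<integral>\<^sup>+x. ennreal (2 ^ CARD('n)) * I * ?i x \<partial>lborel)"
      using True by (intro nn_integral_mono mult_right_mono half1) auto
    finally show ?thesis unfolding V .
  next
    case False
    have "(\<integral>\<^sup>+x. (\<integral>\<^sup>+y. H (x + t *\<^sub>R (y - x)) * (?i x * ?i y) \<partial>lborel) \<partial>lborel) =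
        (\<integral>\<^sup>+y. (\<integral>\<^sup>+x. H (x + t *\<^sub>R (y - x)) * (?i x * ?i y) \<partial>lborel) \<partial>lborel)"
      by (rule lborel_pair.Fubini') measurable
    also have "\<dots> \<le> (\<integral>\<^sup>+y. (\<integral>\<^sup>+x. H (x + t *\<^sub>R (y - x)) * ?i y \<partial>lborel) \<partial>lborel)"
      by (intro nn_integral_mono) (auto simp: indicator_def)
    also have "\<dots> = (\<integral>\<^sup>+y. (\<integral>\<^sup>+x. H (x + t *\<^sub>R (y - x)) \<partial>lborel) * ?i y \<partial>lborel)"
      by (simp add: nn_integral_multc)
    also have "\<dots> \<le> (\<integral>\<^sup>+y. ennreal (2 ^ CARD('n)) * I * ?i y \<partial>lborel)"
      using False by (intro nn_integral_mono mult_right_mono half2) auto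
    finally show ?thesis unfolding V .
  qed
  have "(\<integral>\<^sup>+x. (\<integral>\<^sup>+y. ennreal (\<bar>v x - v y\<bar> powr p) * ?i y \<partial>lborel) * ?i x \<partial>lborel) =
      (\<integral>\<^sup>+x. (\<integral>\<^sup>+y. ennreal (\<bar>v x - v y\<bar> powr p) * (?i x * ?i y) \<partial>lborel) \<partial>lborel)"
    by (subst nn_integral_multc[symmetric]) (auto simp: ac_simps)
  also have "\<dots> \<le> (\<integral>\<^sup>+x. (\<integral>\<^sup>+y. (\<integral>\<^sup>+t. ennreal (?D powr p) * ?j t * (H (x + t *\<^sub>R (y - x)) * (?i x * ?i y)) \<partial>lborel) \<partial>lborel) \<partial>lborel)"
  proof (intro nn_integral_mono)
    fix x y
    show "ennreal (\<bar>v x - v y\<bar> powr p) * (?i x * ?i y) \<le>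
       (\<integral>\<^sup>+t. ennreal (?D powr p) * ?j t * (H (x + t *\<^sub>R (y - x)) * (?i x * ?i y)) \<partial>lborel)"
      using pt[of x y] by (cases "x \<in> ?Q"; cases "y \<in> ?Q") (auto simp: ac_simps)
  qed
  also have "\<dots> = (\<integral>\<^sup>+x. (\<integral>\<^sup>+t. (\<integral>\<^sup>+y. ennreal (?D powr p) * ?j t * (H (x + t *\<^sub>R (y - x)) * (?i x * ?i y)) \<partial>lborel) \<partial>lborel) \<partial>lborel)"
    by (intro nn_integral_cong lborel_pair.Fubini') measurable
  also have "\<dots> = (\<integral>\<^sup>+t. (\<integral>\<^sup>+x. (\<integral>\<^sup>+y. ennreal (?D powr p) * ?j t * (H (x + t *\<^sub>R (y - x)) * (?i x * ?i y)) \<partial>lborel) \<partial>lborel) \<partial>lborel)"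
    by (rule lborel_pair.Fubini') measurable
  also have "\<dots> = (\<integral>\<^sup>+t. ennreal (?D powr p) * ?j t * (\<integral>\<^sup>+x. (\<integral>\<^sup>+y. H (x + t *\<^sub>R (y - x)) * (?i x * ?i y) \<partial>lborel) \<partial>lborel) \<partial>lborel)"
    by (simp add: nn_integral_cmult)
  also have "\<dots> \<le> (\<integral>\<^sup>+t. ennreal (?D powr p) * ?j t * (ennreal (2 ^ CARD('n)) * I * ennreal (L ^ CARD('n))) \<partial>lborel)"
    by (intro nn_integral_mono mult_left_mono inner) auto
  also have "\<dots> = ennreal (?D powr p) * (ennreal (2 ^ CARD('n)) * I * ennreal (L ^ CARD('n)))"
    by (simp add: nn_integral_multc nn_integral_cmult)
  also have "\<dots> = ennreal (?D powr p * 2 ^ CARD('n) * L ^ CARD('n)) * I"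
    using L by (simp add: ennreal_mult ac_simps)
  finally show ?thesis unfolding I_def H_def .
qed

definition cube_mean :: "real \<Rightarrow> (real^'n \<Rightarrow> real) \<Rightarrow> real" where
  "cube_mean L v = (\<integral>x. v x \<partial>lebesgue_on (open_cube L)) / L ^ CARD('n)"

lemma emeasure_space_cube:
  "L > 0 \<Longrightarrow> emeasure (lebesgue_on (open_cube L :: (real^'n) set)) (space (lebesgue_on (open_cube L))) = ennreal (L ^ CARD('n))"
  by (simp add: emeasure_restrict_space space_restrict_space emeasure_open_cube)

lemma cube_mean_powr_le:
  fixes v :: "real^'n \<Rightarrow> real"
  assumes p: "p > 1" and L: "L > 0" and m: "v \<in> borel_measurable (lebesgue_on (open_cube L))"
  shows "ennreal (\<bar>cube_mean L v\<bar> powr p) \<le>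
    ennreal (1 / L ^ CARD('n)) * (\<integral>\<^sup>+y. ennreal (\<bar>v y\<bar> powr p) * indicator (open_cube L) y \<partial>lborel)"
proof -
  let ?m = "L ^ CARD('n)" and ?M = "lebesgue_on (open_cube L :: (real^'n) set)"
  have m0: "?m > 0" using L by simp
  have "ennreal (\<bar>cube_mean L v\<bar> powr p) = ennreal (1 / ?m powr p) * ennreal (\<bar>\<integral>x. v x \<partial>?M\<bar> powr p)"
    using m0 by (simp add: cube_mean_def powr_divide ennreal_mult[symmetric] del: powr_realpow)
  also have "\<dots> \<le> ennreal (1 / ?m powr p) * (ennreal (?m powr (p - 1)) * (\<integral>\<^sup>+x. ennreal (\<bar>v x\<bar> powr p) \<partial>?M))"
    using L by (intro mult_left_mono powr_integral_le[OF p m] emeasure_space_cube) auto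
  also have "\<dots> = ennreal (1 / ?m powr p * ?m powr (p - 1)) * (\<integral>\<^sup>+x. ennreal (\<bar>v x\<bar> powr p) \<partial>?M)"
    by (subst ennreal_mult) (auto simp: mult.assoc)
  also have "1 / ?m powr p * ?m powr (p - 1) = 1 / ?m"
    using m0 by (simp add: powr_diff del: powr_realpow)
  also have "(\<integral>\<^sup>+x. ennreal (\<bar>v x\<bar> powr p) \<partial>?M) = (\<integral>\<^sup>+y. ennreal (\<bar>v y\<bar> powr p) * indicator (open_cube L) y \<partial>lborel)"
    by (simp add: nn_integral_restrict_space nn_integral_completion)
  finally show ?thesis .
qed

lemma cube_mean_diff:
  fixes v :: "real^'n \<Rightarrow> real"
  assumes "integrable (lebesgue_on (open_cube L)) u" "integrable (lebesgue_on (open_cube L)) v"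
  shows "cube_mean L (\<lambda>y. u y - v y) = cube_mean L u - cube_mean L v"
  using assms by (simp add: cube_mean_def diff_divide_distrib)

lemma finite_measure_cube: "L > 0 \<Longrightarrow> finite_measure (lebesgue_on (open_cube L :: (real^'n) set))"
  using emeasure_space_cube[of L, where 'n='n] by (intro finite_measureI) simp

lemma cube_mean_const:
  assumes "L > 0"
  shows "cube_mean L (\<lambda>y :: real^'n. a) = a"
proof -
  have "measure (lebesgue_on (open_cube L :: (real^'n) set)) (space (lebesgue_on (open_cube L))) = L ^ CARD('n)"
    using emeasure_space_cube[OF assms, where 'n='n] assms by (simp add: measure_def)
  then show ?thesis using assms by (simp add: cube_mean_def)
qed

text \<open>
  The integral of \<open>|G|\<^sup>p\<close> along the vertical line through \<open>x\<close> is written as the integral over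
  \<open>s\<close> of a function of \<open>x + s e\<close>. Tonelli's theorem in the pair \<open>(x, s)\<close> and the invariance
  under translations then reduce it to an integral over the domain, without splitting off a
  coordinate of \<open>x\<close>.
\<close>

lemma vertical_powr_le:
  fixes v :: "real^'n \<Rightarrow> real" and G :: "real^'n \<Rightarrow> real^'n" and \<kappa> :: 'n
  assumes p: "p > 1" and d: "\<And>x. (v has_derivative (\<lambda>h. G x \<bullet> h)) (at x)" and c: "continuous_on UNIV G"
    and L: "L > 0" and \<gamma>: "\<And>x. 0 \<le> \<gamma> x" "\<And>x. \<gamma> x \<le> 2 * L"
    and \<gamma>m: "\<gamma> \<in> borel_measurable borel"
    and indep: "\<And>x y. (\<And>l. l \<noteq> \<kappa> \<Longrightarrow> x $ l = y $ l) \<Longrightarrow> \<gamma> x = \<gamma> y"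
    and W: "W \<in> sets borel" "{x. (\<forall>l. l \<noteq> \<kappa> \<longrightarrow> 0 < x $ l \<and> x $ l < L) \<and> 0 < x $ \<kappa> \<and> x $ \<kappa> < max L (\<gamma> x)} \<subseteq> W"
  shows "(\<integral>\<^sup>+x. ennreal (\<bar>v (set_coord \<kappa> (\<gamma> x) x) - v x\<bar> powr p) * indicator (open_cube L) x \<partial>lborel) \<le>
    ennreal ((2 * L) powr p) * (\<integral>\<^sup>+x. ennreal (norm (G x) powr p) * indicator W x \<partial>lborel)"
proof -
  let ?e = "axis \<kappa> (1::real)" and ?Q = "open_cube L :: (real^'n) set"
  note [measurable] = \<gamma>m W(1)
  have [measurable]: "G \<in> borel_measurable borel" by (rule borel_measurable_continuous_onI[OF c])
  define H where "H z = ennreal (norm (G z) powr p) * indicator W z" for z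
  have [measurable]: "H \<in> borel_measurable borel" unfolding H_def by measurable
  define I where "I = (\<integral>\<^sup>+x. H x \<partial>lborel)"
  have pt: "ennreal (\<bar>v (set_coord \<kappa> (\<gamma> x) x) - v x\<bar> powr p) \<le> ennreal ((2 * L) powr (p - 1)) * (\<integral>\<^sup>+s. H (x + s *\<^sub>R ?e) \<partial>lborel)"
    if x: "x \<in> ?Q" for x
  proof -
    define a where "a = \<gamma> x - x $ \<kappa>"
    have xk: "0 < x $ \<kappa>" "x $ \<kappa> < L" using x by (auto simp: open_cube_def)
    have a: "\<bar>a\<bar> \<le> 2 * L" using \<gamma>[of x] xk L unfolding a_def by linarith
    have y: "set_coord \<kappa> (\<gamma> x) x = x + a *\<^sub>R ?e" by (auto simp: vec_eq_iff a_def axis_def)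
    show ?thesis
    proof (cases "a = 0")
      case True
      then show ?thesis by (simp add: y)
    next
      case False
      let ?j = "indicator {0<..<1} :: real \<Rightarrow> ennreal"
      have "ennreal (\<bar>v (set_coord \<kappa> (\<gamma> x) x) - v x\<bar> powr p) \<le>
          (\<integral>\<^sup>+t. ennreal (\<bar>G (x + t *\<^sub>R (a *\<^sub>R ?e)) \<bullet> (a *\<^sub>R ?e)\<bar> powr p) * ?j t \<partial>lborel)"
        using segment_powr_le[OF p d c, of "x + a *\<^sub>R ?e" x] by (simp add: y)
      also have "\<dots> \<le> (\<integral>\<^sup>+t. ennreal (\<bar>a\<bar> powr p) * H (x + (0 + a * t) *\<^sub>R ?e) \<partial>lborel)"
      proof (rule nn_integral_mono)
        fix t :: real
        show "ennreal (\<bar>G (x + t *\<^sub>R (a *\<^sub>R ?e)) \<bullet> (a *\<^sub>R ?e)\<bar> powr p) * ?j t \<le> ennreal (\<bar>a\<bar> powr p) * H (x + (0 + a * t) *\<^sub>R ?e)"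
        proof (cases "t \<in> {0<..<1}")
          case True
          let ?z = "x + (a * t) *\<^sub>R ?e"
          have zl: "?z $ l = x $ l" if "l \<noteq> \<kappa>" for l using that by (simp add: axis_def)
          have zk: "?z $ \<kappa> = x $ \<kappa> + a * t" by (simp add: axis_def)
          have g: "\<gamma> ?z = \<gamma> x" by (rule indep) (rule zl)
          have "?z \<in> W"
          proof (rule subsetD[OF W(2)], intro CollectI conjI allI impI)
            fix l assume l: "l \<noteq> \<kappa>"
            show "0 < ?z $ l" "?z $ l < L" unfolding zl[OF l] using x by (auto simp: open_cube_def)
          next
            have conv: "x $ \<kappa> + a * t = (1 - t) * x $ \<kappa> + t * \<gamma> x" by (simp add: a_def algebra_simps)
            have "0 < (1 - t) * x $ \<kappa>" using True xk by simp
            moreover have "0 \<le> t * \<gamma> x" using True \<gamma>(1)[of x] by simp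
            ultimately show "0 < ?z $ \<kappa>" unfolding zk conv by linarith
            have "(1 - t) * x $ \<kappa> < (1 - t) * max L (\<gamma> x)" using True xk by (intro mult_strict_left_mono) auto
            moreover have "t * \<gamma> x \<le> t * max L (\<gamma> x)" using True by (intro mult_left_mono) auto
            ultimately have "(1 - t) * x $ \<kappa> + t * \<gamma> x < (1 - t) * max L (\<gamma> x) + t * max L (\<gamma> x)" by linarith
            then show "?z $ \<kappa> < max L (\<gamma> ?z)" unfolding zk conv g by (simp add: algebra_simps)
          qed
          moreover have "\<bar>G ?z \<bullet> (a *\<^sub>R ?e)\<bar> powr p \<le> \<bar>a\<bar> powr p * norm (G ?z) powr p"
          proof -
            have "\<bar>G ?z \<bullet> (a *\<^sub>R ?e)\<bar> \<le> \<bar>a\<bar> * norm (G ?z)"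
              using Cauchy_Schwarz_ineq2[of "G ?z" "a *\<^sub>R ?e"] by (simp add: mult.commute)
            then have "\<bar>G ?z \<bullet> (a *\<^sub>R ?e)\<bar> powr p \<le> (\<bar>a\<bar> * norm (G ?z)) powr p"
              using p by (intro powr_mono2) auto
            then show ?thesis by (simp add: powr_mult)
          qed
          ultimately show ?thesis
            using True by (simp add: H_def ennreal_mult[symmetric] ennreal_leI mult.commute)
        qed simp
      qed
      also have "\<dots> = ennreal (\<bar>a\<bar> powr (p - 1)) * (ennreal \<bar>a\<bar> * (\<integral>\<^sup>+t. H (x + (0 + a * t) *\<^sub>R ?e) \<partial>lborel))"
      proof -
        have "\<bar>a\<bar> powr p = \<bar>a\<bar> powr (p - 1) * \<bar>a\<bar>" using False by (simp add: powr_diff)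
        then show ?thesis by (simp add: nn_integral_cmult ennreal_mult mult.assoc)
      qed
      also have "ennreal \<bar>a\<bar> * (\<integral>\<^sup>+t. H (x + (0 + a * t) *\<^sub>R ?e) \<partial>lborel) = (\<integral>\<^sup>+s. H (x + s *\<^sub>R ?e) \<partial>lborel)"
        using False by (intro nn_integral_real_affine[symmetric]) auto
      also have "ennreal (\<bar>a\<bar> powr (p - 1)) * \<dots> \<le> ennreal ((2 * L) powr (p - 1)) * \<dots>"
        using a p by (intro mult_right_mono ennreal_leI powr_mono2) auto
      finally show ?thesis .
    qed
  qed
  let ?i = "indicator ?Q :: real^'n \<Rightarrow> ennreal"
  have "(\<integral>\<^sup>+x. ennreal (\<bar>v (set_coord \<kappa> (\<gamma> x) x) - v x\<bar> powr p) * ?i x \<partial>lborel) \<le>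
      (\<integral>\<^sup>+x. ennreal ((2 * L) powr (p - 1)) * ((\<integral>\<^sup>+s. H (x + s *\<^sub>R ?e) \<partial>lborel) * ?i x) \<partial>lborel)"
    using pt by (intro nn_integral_mono) (auto simp: indicator_def)
  also have "\<dots> = ennreal ((2 * L) powr (p - 1)) * (\<integral>\<^sup>+x. (\<integral>\<^sup>+s. H (x + s *\<^sub>R ?e) * ?i x \<partial>lborel) \<partial>lborel)"
    by (simp add: nn_integral_cmult nn_integral_multc)
  also have "(\<integral>\<^sup>+x. (\<integral>\<^sup>+s. H (x + s *\<^sub>R ?e) * ?i x \<partial>lborel) \<partial>lborel) =
      (\<integral>\<^sup>+s. (\<integral>\<^sup>+x. H (x + s *\<^sub>R ?e) * ?i x \<partial>lborel) \<partial>lborel)"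
    by (rule lborel_pair.Fubini') measurable
  also have "\<dots> = (\<integral>\<^sup>+s. (\<integral>\<^sup>+x. H x * ?i (x - s *\<^sub>R ?e) \<partial>lborel) \<partial>lborel)"
  proof (rule nn_integral_cong)
    fix s :: real
    show "(\<integral>\<^sup>+x. H (x + s *\<^sub>R ?e) * ?i x \<partial>lborel) = (\<integral>\<^sup>+x. H x * ?i (x - s *\<^sub>R ?e) \<partial>lborel)"
      using nn_integral_shift[of "\<lambda>x. H x * ?i (x - s *\<^sub>R ?e)" "s *\<^sub>R ?e"] by simp
  qed
  also have "\<dots> = (\<integral>\<^sup>+x. (\<integral>\<^sup>+s. H x * ?i (x - s *\<^sub>R ?e) \<partial>lborel) \<partial>lborel)"
    by (rule lborel_pair.Fubini') measurable
  also have "\<dots> \<le> (\<integral>\<^sup>+x. H x * ennreal L \<partial>lborel)"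
  proof (rule nn_integral_mono)
    fix x
    have "(\<integral>\<^sup>+s. H x * ?i (x - s *\<^sub>R ?e) \<partial>lborel) \<le> (\<integral>\<^sup>+s. H x * indicator {x $ \<kappa> - L<..<x $ \<kappa>} s \<partial>lborel)"
    proof (intro nn_integral_mono mult_left_mono)
      fix s :: real
      have "(x - s *\<^sub>R ?e) $ \<kappa> = x $ \<kappa> - s" by (simp add: axis_def)
      then have "x - s *\<^sub>R ?e \<in> ?Q \<Longrightarrow> s \<in> {x $ \<kappa> - L<..<x $ \<kappa>}"
        unfolding open_cube_def by (smt (verit) greaterThanLessThan_iff mem_Collect_eq)
      then show "?i (x - s *\<^sub>R ?e) \<le> indicator {x $ \<kappa> - L<..<x $ \<kappa>} s" by (auto simp: indicator_def)
    qed auto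
    also have "\<dots> = H x * ennreal L" using L by (simp add: nn_integral_cmult)
    finally show "(\<integral>\<^sup>+s. H x * ?i (x - s *\<^sub>R ?e) \<partial>lborel) \<le> H x * ennreal L" .
  qed
  also have "\<dots> = I * ennreal L" by (simp add: nn_integral_multc I_def)
  also have "ennreal ((2 * L) powr (p - 1)) * (I * ennreal L) \<le> ennreal ((2 * L) powr p) * I"
  proof -
    have "(2 * L) powr (p - 1) * L \<le> (2 * L) powr (p - 1) * (2 * L)" using L by (intro mult_left_mono) auto
    also have "\<dots> = (2 * L) powr p" using L by (simp add: powr_diff)
    finally have "ennreal ((2 * L) powr (p - 1) * L) * I \<le> ennreal ((2 * L) powr p) * I"
      by (intro mult_right_mono ennreal_leI) auto
    then show ?thesis using L by (simp add: ennreal_mult ac_simps)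
  qed
  finally show ?thesis by (simp add: mult_left_mono I_def H_def)
qed

text \<open>
  The distance of a number to the mean is at most the mean of the distances, in the sense of
  \<open>p\<close>-th powers.
\<close>

lemma Poincare_cube:
  fixes v :: "real^'n \<Rightarrow> real" and G :: "real^'n \<Rightarrow> real^'n"
  assumes p: "p > 1" and d: "\<And>x. (v has_derivative (\<lambda>h. G x \<bullet> h)) (at x)" and c: "continuous_on UNIV G"
    and L: "L > 0" and int: "integrable (lebesgue_on (open_cube L)) v"
  shows "(\<integral>\<^sup>+x. ennreal (\<bar>v x - cube_mean L v\<bar> powr p) * indicator (open_cube L) x \<partial>lborel)
    \<le> ennreal ((real CARD('n) * L) powr p * 2 ^ CARD('n)) *
      (\<integral>\<^sup>+x. ennreal (norm (G x) powr p) * indicator (open_cube L) x \<partial>lborel)"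
proof -
  let ?Q = "open_cube L :: (real^'n) set" and ?m = "L ^ CARD('n)"
  have m: "?m > 0" using L by simp
  have vm[measurable]: "v \<in> borel_measurable borel"
    using d by (intro borel_measurable_continuous_onI)
      (auto simp: continuous_on_eq_continuous_at intro: has_derivative_continuous)
  interpret finite_measure "lebesgue_on ?Q" by (rule finite_measure_cube[OF L])
  have pt: "ennreal (\<bar>a - cube_mean L v\<bar> powr p) \<le>
      ennreal (1 / ?m) * (\<integral>\<^sup>+y. ennreal (\<bar>a - v y\<bar> powr p) * indicator ?Q y \<partial>lborel)" for a
  proof -
    have i: "integrable (lebesgue_on ?Q) (\<lambda>y. a - v y)" using int by simp
    have "cube_mean L (\<lambda>y. a - v y) = a - cube_mean L v"
      using int by (subst cube_mean_diff) (simp_all add: cube_mean_const[OF L])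
    then show ?thesis
      using cube_mean_powr_le[OF p L borel_measurable_integrable[OF i]] by simp
  qed
  have "(\<integral>\<^sup>+x. ennreal (\<bar>v x - cube_mean L v\<bar> powr p) * indicator ?Q x \<partial>lborel) \<le>
      (\<integral>\<^sup>+x. ennreal (1 / ?m) * ((\<integral>\<^sup>+y. ennreal (\<bar>v x - v y\<bar> powr p) * indicator ?Q y \<partial>lborel) * indicator ?Q x) \<partial>lborel)"
    using pt by (intro nn_integral_mono) (auto simp: indicator_def)
  also have "\<dots> = ennreal (1 / ?m) * (\<integral>\<^sup>+x. (\<integral>\<^sup>+y. ennreal (\<bar>v x - v y\<bar> powr p) * indicator ?Q y \<partial>lborel) * indicator ?Q x \<partial>lborel)"
    by (intro nn_integral_cmult) measurable
  also have "\<dots> \<le> ennreal (1 / ?m) * (ennreal ((real CARD('n) * L) powr p * 2 ^ CARD('n) * ?m) *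
      (\<integral>\<^sup>+x. ennreal (norm (G x) powr p) * indicator ?Q x \<partial>lborel))"
    by (intro mult_left_mono Poincare_cube_double p d c L) auto
  also have "\<dots> = ennreal (1 / ?m * ((real CARD('n) * L) powr p * 2 ^ CARD('n) * ?m)) *
      (\<integral>\<^sup>+x. ennreal (norm (G x) powr p) * indicator ?Q x \<partial>lborel)"
    using m by (subst ennreal_mult) (auto simp: mult.assoc)
  also have "1 / ?m * ((real CARD('n) * L) powr p * 2 ^ CARD('n) * ?m) = (real CARD('n) * L) powr p * 2 ^ CARD('n)"
    using m by simp
  finally show ?thesis .
qed

text \<open>
  The factor \<open>2 n\<close> is the number of faces; the last factor collects the vertical segments
  (\<open>2\<^sup>p\<close>) and the Poincare inequality on the cube.
\<close>

definition trace_const :: "nat \<Rightarrow> real \<Rightarrow> real" where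
  "trace_const n p = 2 * real n * graph_const n * (2 powr p * (2 powr p + real n powr p * 2 ^ n))"

lemma trace_const_nonneg: "trace_const n p \<ge> 0"
  by (auto simp: trace_const_def graph_const_nonneg intro!: mult_nonneg_nonneg add_nonneg_nonneg)

text \<open>
  A domain that lies below the graph of \<open>g\<close>, which is described by its open part and its
  closure only: it contains the open region below the graph, and its closure is contained in
  the closed one. The condition on the edge says that the lateral faces are those of the
  cube.
\<close>

locale subgraph_domain = sobolev_domain \<Omega> p for \<Omega> :: "(real^'n) set" and p :: real +
  fixes \<kappa> :: 'n and L K :: real and g :: "real^'n \<Rightarrow> real"
  assumes L_pos: "L > 0" and K_nonneg: "K \<ge> 0"
    and g_lip: "\<And>x y t. 0 \<le> t \<Longrightarrow> (\<And>l. l \<noteq> \<kappa> \<Longrightarrow> \<bar>x $ l - y $ l\<bar> \<le> t) \<Longrightarrow> \<bar>g x - g y\<bar> \<le> K * t"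
    and g_ge: "\<And>x. L \<le> g x" and g_le: "\<And>x. g x \<le> 2 * L"
    and subgraph: "{x. (\<forall>l. l \<noteq> \<kappa> \<longrightarrow> 0 < x $ l \<and> x $ l < L) \<and> 0 < x $ \<kappa> \<and> x $ \<kappa> < g x} \<subseteq> \<Omega>"
    and closure_subset_subgraph: "closure \<Omega> \<subseteq> {x. (\<forall>l. l \<noteq> \<kappa> \<longrightarrow> 0 \<le> x $ l \<and> x $ l \<le> L) \<and> 0 \<le> x $ \<kappa> \<and> x $ \<kappa> \<le> g x}"
    and g_edge: "\<And>x l. l \<noteq> \<kappa> \<Longrightarrow> x $ l = 0 \<or> x $ l = L \<Longrightarrow> g x = L"
begin

lemma cube_subset: "open_cube L \<subseteq> \<Omega>"
proof
  fix x :: "real^'n" assume x: "x \<in> open_cube L"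
  then have "x $ \<kappa> < g x" using g_ge[of x] by (auto simp: open_cube_def intro: less_le_trans)
  then show "x \<in> \<Omega>" using x subgraph by (auto simp: open_cube_def)
qed

text \<open>
  A pair of a direction and a side indexes each of the \<open>2 n\<close> faces. All of them are graphs
  over a face of the cube; only the upper one in the direction \<open>\<kappa>\<close> is not flat.
\<close>

definition face_fun :: "'n \<times> bool \<Rightarrow> real^'n \<Rightarrow> real" where
  "face_fun f x = (if snd f then if fst f = \<kappa> then g x else L else 0)"

definition face :: "'n \<times> bool \<Rightarrow> (real^'n) set" where
  "face f = {x. (\<forall>l. l \<noteq> fst f \<longrightarrow> 0 \<le> x $ l \<and> x $ l \<le> L) \<and> x $ fst f = face_fun f x}"

lemma face_fun_lip:
  assumes "0 \<le> t" "\<And>l. l \<noteq> fst f \<Longrightarrow> \<bar>x $ l - y $ l\<bar> \<le> t"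
  shows "\<bar>face_fun f x - face_fun f y\<bar> \<le> K * t"
  using assms g_lip[of t x y] K_nonneg by (auto simp: face_fun_def)

lemma frontier_subset_faces: "frontier \<Omega> \<subseteq> (\<Union>f. face f)"
proof
  fix x assume "x \<in> frontier \<Omega>"
  then have xc: "x \<in> closure \<Omega>" and xn: "x \<notin> \<Omega>"
    using open_dom by (auto simp: frontier_def interior_open)
  from xc closure_subset_subgraph
  have x: "\<And>l. l \<noteq> \<kappa> \<Longrightarrow> 0 \<le> x $ l \<and> x $ l \<le> L" "0 \<le> x $ \<kappa>" "x $ \<kappa> \<le> g x" by auto
  from xn subgraph have "(\<exists>l. l \<noteq> \<kappa> \<and> \<not> (0 < x $ l \<and> x $ l < L)) \<or> \<not> 0 < x $ \<kappa> \<or> \<not> x $ \<kappa> < g x" by blast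
  then consider l where "l \<noteq> \<kappa>" "x $ l = 0 \<or> x $ l = L" | "x $ \<kappa> = 0" | "x $ \<kappa> = g x"
    using x by (metis antisym_conv2 order_le_less)
  then show "x \<in> (\<Union>f. face f)"
  proof cases
    case 1
    from g_edge[OF 1] have "x $ \<kappa> \<le> L" using x(3) by simp
    then have "0 \<le> x $ m \<and> x $ m \<le> L" for m using x(1)[of m] x(2) by (cases "m = \<kappa>") auto
    then have "x \<in> face (l, x $ l = L)"
      using 1 L_pos unfolding face_def face_fun_def by auto
    then show ?thesis by blast
  next
    case 2
    then have "x \<in> face (\<kappa>, False)" using x by (auto simp: face_def face_fun_def)
    then show ?thesis by blast
  next
    case 3
    then have "x \<in> face (\<kappa>, True)" using x by (auto simp: face_def face_fun_def)
    then show ?thesis by blast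
  qed
qed

abbreviation "\<H> \<equiv> hausdorff_measure (CARD('n) - 1) :: (real^'n) measure"

lemma face_integral_le:
  assumes F: "continuous_on UNIV F" "\<And>x. 0 \<le> F x"
  shows "face f \<in> sets borel"
    and "(\<integral>\<^sup>+x. ennreal (F x) * indicator (face f) x \<partial>\<H>) \<le> ennreal (graph_const CARD('n) * (K + 1) / L) *
      (\<integral>\<^sup>+x. ennreal (F (set_coord (fst f) (face_fun f x) x)) * indicator (open_cube L) x \<partial>lborel)"
proof -
  note graph = graph_integral_le[where \<kappa>="fst f" and \<gamma>="face_fun f" and F=F and \<mu>="\<H>"]
  show "face f \<in> sets borel" unfolding face_def
    by (rule graph(1)[OF sets_hausdorff_measure emeasure_hausdorff_measure_le L_pos K_nonneg face_fun_lip F])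
  show "(\<integral>\<^sup>+x. ennreal (F x) * indicator (face f) x \<partial>\<H>) \<le> ennreal (graph_const CARD('n) * (K + 1) / L) *
      (\<integral>\<^sup>+x. ennreal (F (set_coord (fst f) (face_fun f x) x)) * indicator (open_cube L) x \<partial>lborel)"
    unfolding face_def
    by (rule graph(2)[OF sets_hausdorff_measure emeasure_hausdorff_measure_le L_pos K_nonneg face_fun_lip F])
qed

lemma Lp_int_surface_le:
  assumes F: "continuous_on UNIV F"
  shows "Lp_int (surface_measure \<Omega>) p F \<le> (\<Sum>f\<in>UNIV. \<integral>\<^sup>+x. ennreal (norm (F x) powr p) * indicator (face f) x \<partial>\<H>)"
proof -
  have Fp: "continuous_on UNIV (\<lambda>x. norm (F x) powr p)"
    using p_gt_1 by (intro continuous_on_powr' continuous_intros F) auto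
  have Fm: "(\<lambda>x. norm (F x) powr p) \<in> borel_measurable borel" by (rule borel_measurable_continuous_onI[OF Fp])
  have fm: "face f \<in> sets borel" for f by (rule face_integral_le(1)[OF Fp]) simp
  have "frontier \<Omega> \<inter> space \<H> \<in> sets \<H>"
    using frontier_closed[of \<Omega>] by (simp add: sets_hausdorff_measure space_borel sets_eq_imp_space_eq[OF sets_hausdorff_measure])
  then have "Lp_int (surface_measure \<Omega>) p F = (\<integral>\<^sup>+x. ennreal (norm (F x) powr p) * indicator (frontier \<Omega>) x \<partial>\<H>)"
    by (simp add: Lp_int_def surface_measure_def nn_integral_restrict_space)
  also have "\<dots> \<le> (\<integral>\<^sup>+x. (\<Sum>f\<in>UNIV. ennreal (norm (F x) powr p) * indicator (face f) x) \<partial>\<H>)"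
  proof (rule nn_integral_mono)
    fix x
    show "ennreal (norm (F x) powr p) * indicator (frontier \<Omega>) x \<le>
        (\<Sum>f\<in>UNIV. ennreal (norm (F x) powr p) * indicator (face f) x)"
    proof (cases "x \<in> frontier \<Omega>")
      case True
      then obtain f where "x \<in> face f" using frontier_subset_faces by blast
      then have "ennreal (norm (F x) powr p) * indicator (frontier \<Omega>) x \<le> ennreal (norm (F x) powr p) * indicator (face f) x"
        by (simp add: indicator_def)
      also have "\<dots> \<le> (\<Sum>f\<in>UNIV. ennreal (norm (F x) powr p) * indicator (face f) x)"
        by (rule member_le_sum) auto
      finally show ?thesis .
    qed simp
  qed
  also have "\<dots> = (\<Sum>f\<in>UNIV. \<integral>\<^sup>+x. ennreal (norm (F x) powr p) * indicator (face f) x \<partial>\<H>)"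
  proof (rule nn_integral_sum)
    fix f
    show "(\<lambda>x. ennreal (norm (F x) powr p) * indicator (face f) x) \<in> borel_measurable \<H>"
      unfolding measurable_cong_sets[OF sets_hausdorff_measure refl]
      using Fm fm by measurable
  qed
  finally show ?thesis .
qed

lemma nn_integral_dom: "(\<integral>\<^sup>+x. f x * indicator \<Omega> x \<partial>lborel) = (\<integral>\<^sup>+x. f x \<partial>lebesgue_on \<Omega>)"
  by (simp add: nn_integral_restrict_space nn_integral_completion)

lemma integrable_cube:
  assumes "in_Lp (lebesgue_on \<Omega>) p u"
  shows "integrable (lebesgue_on (open_cube L)) (u :: real^'n \<Rightarrow> real)"
proof -
  have "integrable (lebesgue_on \<Omega>) u"
    using p_gt_1 by (intro integrable_in_Lp[OF finite_measure_dom assms]) simp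
  then have "set_integrable lebesgue \<Omega> u"
    by (simp add: integrable_restrict_space set_integrable_def)
  then have "set_integrable lebesgue (open_cube L) u"
    by (rule set_integrable_subset) (use cube_subset in auto)
  then show ?thesis by (simp add: integrable_restrict_space set_integrable_def)
qed

text \<open>
  Every face is compared with the cube: the value at the boundary point in the same column as
  \<open>x\<close> differs from \<open>v x\<close> by the integral along a segment, and \<open>v x\<close> from the mean value by
  the Poincare inequality. Both contribute \<open>L\<^sup>p\<close> times the energy; the factor \<open>(K + 1) / L\<close>
  comes from \<open>graph_integral_le\<close>.
\<close>

theorem boundary_deviation_le:
  assumes d: "\<And>x. (v has_derivative (\<lambda>h. G x \<bullet> h)) (at x)" and c: "continuous_on UNIV G"
  shows "Lp_int (surface_measure \<Omega>) p (\<lambda>x. v x - cube_mean L v) \<le>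
    ennreal (trace_const CARD('n) p * (K + 1) * L powr (p - 1)) * Lp_int (lebesgue_on \<Omega>) p G"
proof -
  let ?n = "real CARD('n)" and ?Q = "open_cube L :: (real^'n) set"
  define a where "a = cube_mean L v"
  define E where "E = 2 powr p * (2 powr p + ?n powr p * 2 ^ CARD('n))"
  define I where "I = Lp_int (lebesgue_on \<Omega>) p G"
  have I: "(\<integral>\<^sup>+x. ennreal (norm (G x) powr p) * indicator \<Omega> x \<partial>lborel) = I"
    unfolding I_def Lp_int_def by (rule nn_integral_dom)
  have vc: "continuous_on UNIV v"
    using d by (auto simp: continuous_on_eq_continuous_at intro: has_derivative_continuous)
  have vm[measurable]: "v \<in> borel_measurable borel" by (rule borel_measurable_continuous_onI[OF vc])
  have vi: "integrable (lebesgue_on ?Q) v" by (rule integrable_cube[OF in_Lp_continuous[OF vc]])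
  have Fc: "continuous_on UNIV (\<lambda>x. norm (v x - a) powr p)"
    using p_gt_1 by (intro continuous_on_powr' continuous_intros vc) auto
  have face: "(\<integral>\<^sup>+x. ennreal (norm (v (set_coord (fst f) (face_fun f x) x) - a) powr p) * indicator ?Q x \<partial>lborel) \<le>
      ennreal (E * L powr p) * I" for f
  proof -
    let ?y = "\<lambda>x. set_coord (fst f) (face_fun f x) x"
    have fc: "continuous_on UNIV (face_fun f)"
      by (rule coordinate_lipschitz_continuous[OF K_nonneg face_fun_lip])
    have fm[measurable]: "face_fun f \<in> borel_measurable borel" by (rule borel_measurable_continuous_onI[OF fc])
    have "continuous_on UNIV ?y"
      unfolding set_coord_def
    proof (rule continuous_on_vec_lambda)
      show "continuous_on UNIV (\<lambda>x. if l = fst f then face_fun f x else x $ l)" for l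
        using fc by (cases "l = fst f") (auto intro: continuous_intros)
    qed
    then have ym[measurable]: "?y \<in> borel_measurable borel" by (rule borel_measurable_continuous_onI)
    have 1: "(\<integral>\<^sup>+x. ennreal (\<bar>v (?y x) - v x\<bar> powr p) * indicator ?Q x \<partial>lborel) \<le> ennreal ((2 * L) powr p) * I"
      unfolding I[symmetric]
    proof (rule vertical_powr_le[OF p_gt_1 d c L_pos])
      show "0 \<le> face_fun f x" "face_fun f x \<le> 2 * L" for x
        using L_pos g_ge[of x] g_le[of x] by (auto simp: face_fun_def)
      show "face_fun f x = face_fun f y" if "\<And>l. l \<noteq> fst f \<Longrightarrow> x $ l = y $ l" for x y
        using face_fun_lip[of 0 f x y] that by simp
      show "{x. (\<forall>l. l \<noteq> fst f \<longrightarrow> 0 < x $ l \<and> x $ l < L) \<and> 0 < x $ fst f \<and> x $ fst f < max L (face_fun f x)} \<subseteq> \<Omega>"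
      proof
        fix x assume x: "x \<in> {x. (\<forall>l. l \<noteq> fst f \<longrightarrow> 0 < x $ l \<and> x $ l < L) \<and> 0 < x $ fst f \<and> x $ fst f < max L (face_fun f x)}"
        show "x \<in> \<Omega>"
        proof (cases "snd f \<and> fst f = \<kappa>")
          case True
          then have "face_fun f x = g x" by (simp add: face_fun_def)
          then show ?thesis using x True g_ge[of x] subgraph by (auto simp: max_def)
        next
          case False
          then have "max L (face_fun f x) = L" using L_pos by (auto simp: face_fun_def)
          then have "x \<in> open_cube L" using x unfolding open_cube_def by auto metis+
          then show ?thesis using cube_subset by blast
        qed
      qed
    qed auto
    have 2: "(\<integral>\<^sup>+x. ennreal (\<bar>v x - a\<bar> powr p) * indicator ?Q x \<partial>lborel) \<le> ennreal ((?n * L) powr p * 2 ^ CARD('n)) * I"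
    proof -
      have "(\<integral>\<^sup>+x. ennreal (\<bar>v x - a\<bar> powr p) * indicator ?Q x \<partial>lborel) \<le>
        ennreal ((?n * L) powr p * 2 ^ CARD('n)) * (\<integral>\<^sup>+x. ennreal (norm (G x) powr p) * indicator ?Q x \<partial>lborel)"
        unfolding a_def by (rule Poincare_cube[OF p_gt_1 d c L_pos vi])
      also have "\<dots> \<le> ennreal ((?n * L) powr p * 2 ^ CARD('n)) * I"
        unfolding I[symmetric] using cube_subset
        by (intro mult_left_mono nn_integral_mono) (auto simp: indicator_def)
      finally show ?thesis .
    qed
    have "(\<integral>\<^sup>+x. ennreal (norm (v (?y x) - a) powr p) * indicator ?Q x \<partial>lborel) \<le>
        (\<integral>\<^sup>+x. ennreal (2 powr p) * (ennreal (\<bar>v (?y x) - v x\<bar> powr p) * indicator ?Q x + ennreal (\<bar>v x - a\<bar> powr p) * indicator ?Q x) \<partial>lborel)"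
    proof (rule nn_integral_mono)
      fix x
      have "norm ((v (?y x) - v x) + (v x - a)) powr p \<le> 2 powr p * (norm (v (?y x) - v x) powr p + norm (v x - a) powr p)"
        using p_gt_1 by (intro norm_add_powr_le) simp
      then have "ennreal (norm (v (?y x) - a) powr p) \<le> ennreal (2 powr p) * (ennreal (\<bar>v (?y x) - v x\<bar> powr p) + ennreal (\<bar>v x - a\<bar> powr p))"
        by (simp add: ennreal_mult[symmetric] ennreal_plus[symmetric] ennreal_leI del: ennreal_plus)
      then show "ennreal (norm (v (?y x) - a) powr p) * indicator ?Q x \<le>
          ennreal (2 powr p) * (ennreal (\<bar>v (?y x) - v x\<bar> powr p) * indicator ?Q x + ennreal (\<bar>v x - a\<bar> powr p) * indicator ?Q x)"
        by (auto simp: indicator_def)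
    qed
    also have "\<dots> = ennreal (2 powr p) * ((\<integral>\<^sup>+x. ennreal (\<bar>v (?y x) - v x\<bar> powr p) * indicator ?Q x \<partial>lborel) +
        (\<integral>\<^sup>+x. ennreal (\<bar>v x - a\<bar> powr p) * indicator ?Q x \<partial>lborel))"
      by (simp add: nn_integral_cmult nn_integral_add)
    also have "\<dots> \<le> ennreal (2 powr p) * (ennreal ((2 * L) powr p) * I + ennreal ((?n * L) powr p * 2 ^ CARD('n)) * I)"
      by (intro mult_left_mono add_mono 1 2) auto
    also have "\<dots> = ennreal (2 powr p * ((2 * L) powr p + (?n * L) powr p * 2 ^ CARD('n))) * I"
      by (simp add: ennreal_mult ennreal_plus distrib_left distrib_right ac_simps)
    also have "2 powr p * ((2 * L) powr p + (?n * L) powr p * 2 ^ CARD('n)) = E * L powr p"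
      using L_pos by (simp add: E_def powr_mult algebra_simps)
    finally show ?thesis .
  qed
  let ?B = "graph_const CARD('n) * (K + 1)"
  have B: "?B \<ge> 0" using K_nonneg by (simp add: graph_const_nonneg)
  have E: "E \<ge> 0" by (simp add: E_def)
  have "Lp_int (surface_measure \<Omega>) p (\<lambda>x. v x - a) \<le>
      (\<Sum>f\<in>UNIV. \<integral>\<^sup>+x. ennreal (norm (v x - a) powr p) * indicator (face f) x \<partial>\<H>)"
    by (intro Lp_int_surface_le continuous_intros vc)
  also have "\<dots> \<le> (\<Sum>f\<in>(UNIV :: ('n \<times> bool) set). ennreal (?B / L) * (ennreal (E * L powr p) * I))"
  proof (rule sum_mono)
    fix f :: "'n \<times> bool"
    have "(\<integral>\<^sup>+x. ennreal (norm (v x - a) powr p) * indicator (face f) x \<partial>\<H>) \<le> ennreal (?B / L) *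
      (\<integral>\<^sup>+x. ennreal (norm (v (set_coord (fst f) (face_fun f x) x) - a) powr p) * indicator ?Q x \<partial>lborel)"
      by (rule face_integral_le(2)[OF Fc]) simp
    also have "\<dots> \<le> ennreal (?B / L) * (ennreal (E * L powr p) * I)"
      by (intro mult_left_mono face) auto
    finally show "(\<integral>\<^sup>+x. ennreal (norm (v x - a) powr p) * indicator (face f) x \<partial>\<H>) \<le> \<dots>" .
  qed
  also have "\<dots> = ennreal (2 * ?n) * (ennreal (?B / L) * (ennreal (E * L powr p) * I))"
    by (simp add: card_UNIV_bool card_cartesian_product[of "UNIV::'n set" "UNIV::bool set", simplified] ennreal_of_nat_eq_real_of_nat ennreal_mult ac_simps)
  also have "\<dots> = ennreal (2 * ?n * (?B / L * (E * L powr p))) * I"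
  proof -
    have split: "ennreal x * (ennreal y * (ennreal z * I)) = ennreal (x * (y * z)) * I"
      if "0 \<le> x" "0 \<le> y" "0 \<le> z" for x y z
      using that by (simp add: ennreal_mult mult.assoc)
    show ?thesis using B E L_pos by (intro split) auto
  qed
  also have "2 * ?n * (?B / L * (E * L powr p)) = trace_const CARD('n) p * (K + 1) * L powr (p - 1)"
    using L_pos by (simp add: trace_const_def E_def powr_diff)
  finally show ?thesis by (simp add: a_def I_def)
qed

lemma surface_finite: "emeasure (surface_measure \<Omega>) (space (surface_measure \<Omega>)) < \<infinity>"
proof -
  have "emeasure (surface_measure \<Omega>) (space (surface_measure \<Omega>)) = Lp_int (surface_measure \<Omega>) p (\<lambda>x. 1 :: real)"
    by (simp add: Lp_int_def)
  also have "\<dots> \<le> (\<Sum>f\<in>UNIV. \<integral>\<^sup>+x. ennreal (norm (1::real) powr p) * indicator (face f) x \<partial>\<H>)"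
    by (intro Lp_int_surface_le continuous_intros)
  also have "\<dots> \<le> (\<Sum>f\<in>(UNIV::('n \<times> bool) set). ennreal (graph_const CARD('n) * (K + 1) / L) * ennreal (L ^ CARD('n)))"
  proof (rule sum_mono)
    fix f :: "'n \<times> bool"
    show "(\<integral>\<^sup>+x. ennreal (norm (1::real) powr p) * indicator (face f) x \<partial>\<H>) \<le> ennreal (graph_const CARD('n) * (K + 1) / L) * ennreal (L ^ CARD('n))"
      using face_integral_le(2)[of "\<lambda>_. 1" f] L_pos by (simp add: emeasure_open_cube)
  qed
  also have "\<dots> < \<infinity>" by (simp add: ennreal_mult_less_top of_nat_less_top)
  finally show ?thesis .
qed

end

section \<open>Traces\<close>

text \<open>
  The completeness of \<open>L\<^sup>p\<close> for a rapidly converging sequence. The weights \<open>2\<^sup>k\<close> still leave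
  a convergent series of integrals, so at almost every point the increments decay
  geometrically; Fatou's lemma gives the rate of convergence to the pointwise limit.
\<close>

lemma Lp_complete_geometric:
  fixes f :: "nat \<Rightarrow> 'a \<Rightarrow> real"
  assumes m[measurable]: "\<And>k. f k \<in> borel_measurable M" and p: "p \<ge> 1"
    and le: "\<And>k l. k \<le> l \<Longrightarrow> Lp_int M p (\<lambda>x. f k x - f l x) \<le> ennreal (((1 / 4) ^ k) powr p)"
  obtains h where "h \<in> borel_measurable M" "\<And>k. Lp_int M p (\<lambda>x. f k x - h x) \<le> ennreal (((1 / 4) ^ k) powr p)"
proof -
  define h where "h x = lim (\<lambda>k. f k x)" for x
  have hm[measurable]: "h \<in> borel_measurable M" unfolding h_def by measurable
  define a where "a k x = \<bar>f k x - f (Suc k) x\<bar>" for k x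
  have [measurable]: "a k \<in> borel_measurable M" for k unfolding a_def by measurable
  have "(\<integral>\<^sup>+x. (\<Sum>k. ennreal ((2 ^ k * a k x) powr p)) \<partial>M) = (\<Sum>k. \<integral>\<^sup>+x. ennreal ((2 ^ k * a k x) powr p) \<partial>M)"
    by (rule nn_integral_suminf) measurable
  also have "\<dots> \<le> (\<Sum>k. ennreal ((1 / 2) ^ k))"
  proof (rule suminf_le)
    fix k
    have "(\<integral>\<^sup>+x. ennreal ((2 ^ k * a k x) powr p) \<partial>M) = (\<integral>\<^sup>+x. ennreal ((2 ^ k) powr p) * ennreal (a k x powr p) \<partial>M)"
      by (intro nn_integral_cong) (simp add: a_def powr_mult ennreal_mult)
    also have "\<dots> = ennreal ((2 ^ k) powr p) * Lp_int M p (\<lambda>x. f k x - f (Suc k) x)"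
      by (simp add: nn_integral_cmult Lp_int_def a_def)
    also have "\<dots> \<le> ennreal ((2 ^ k) powr p) * ennreal (((1 / 4) ^ k) powr p)"
      by (intro mult_left_mono le) auto
    also have "\<dots> = ennreal ((2 ^ k * (1 / 4) ^ k) powr p)" by (simp add: powr_mult ennreal_mult)
    also have "(2::real) ^ k * (1 / 4) ^ k = (1 / 2) ^ k" by (simp flip: power_mult_distrib)
    also have "((1 / 2 :: real) ^ k) powr p \<le> ((1 / 2) ^ k) powr 1"
      using p by (intro powr_mono') (auto simp: power_le_one)
    finally show "(\<integral>\<^sup>+x. ennreal ((2 ^ k * a k x) powr p) \<partial>M) \<le> ennreal ((1 / 2) ^ k)"
      by (simp add: ennreal_leI)
  qed auto
  also have "\<dots> = ennreal (1 / (1 - 1 / 2))"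
    by (intro suminf_ennreal_eq geometric_sums) auto
  also have "\<dots> < \<infinity>" by simp
  finally have "AE x in M. (\<Sum>k. ennreal ((2 ^ k * a k x) powr p)) \<noteq> \<infinity>"
    by (intro nn_integral_PInf_AE) auto
  then have conv: "AE x in M. (\<lambda>k. f k x) \<longlonglongrightarrow> h x"
  proof eventually_elim
    case (elim x)
    define B where "B = enn2real (\<Sum>k. ennreal ((2 ^ k * a k x) powr p))"
    have B: "B \<ge> 0" "(\<Sum>k. ennreal ((2 ^ k * a k x) powr p)) = ennreal B"
      unfolding B_def by (rule enn2real_nonneg, rule ennreal_enn2real[symmetric], use elim in \<open>simp only: less_top infinity_ennreal_def\<close>)
    have bd: "a k x \<le> B powr (1 / p) * (1 / 2) ^ k" for k
    proof -
      have "(\<Sum>k\<in>{k}. ennreal ((2 ^ k * a k x) powr p)) \<le> (\<Sum>k. ennreal ((2 ^ k * a k x) powr p))"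
        by (rule sum_le_suminf) (simp_all add: summableI)
      then have "ennreal ((2 ^ k * a k x) powr p) \<le> (\<Sum>k. ennreal ((2 ^ k * a k x) powr p))"
        by (simp only: sum.insert[OF finite.emptyI] sum.empty add_0_right empty_iff not_False_eq_True)
      then have "(2 ^ k * a k x) powr p \<le> B" unfolding B(2) using B(1) by simp
      then have "((2 ^ k * a k x) powr p) powr (1 / p) \<le> B powr (1 / p)"
        using p by (intro powr_mono2) auto
      moreover have "((2 ^ k * a k x) powr p) powr (1 / p) = 2 ^ k * a k x"
        using p by (simp add: powr_powr a_def)
      ultimately have "2 ^ k * a k x \<le> B powr (1 / p)" by simp
      then have "(1 / 2) ^ k * (2 ^ k * a k x) \<le> (1 / 2) ^ k * B powr (1 / p)" by (intro mult_left_mono) auto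
      moreover have "(1 / 2) ^ k * (2 ^ k * a k x) = a k x"
        by (simp add: mult.assoc[symmetric] flip: power_mult_distrib)
      ultimately show ?thesis by (simp only: mult.commute)
    qed
    have "summable (\<lambda>k. f (Suc k) x - f k x)"
    proof (rule summable_comparison_test')
      show "summable (\<lambda>k. B powr (1 / p) * (1 / 2) ^ k)" by (intro summable_mult summable_geometric) simp
      show "norm (f (Suc k) x - f k x) \<le> B powr (1 / p) * (1 / 2) ^ k" for k
        using bd[of k] by (simp add: a_def abs_minus_commute)
    qed
    then have "(\<lambda>n. (\<Sum>k<n. f (Suc k) x - f k x) + f 0 x) \<longlonglongrightarrow> (\<Sum>k. f (Suc k) x - f k x) + f 0 x"
      by (intro tendsto_add summable_LIMSEQ tendsto_const)
    moreover have "(\<Sum>k<n. f (Suc k) x - f k x) + f 0 x = f n x" for n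
      using sum_lessThan_telescope[of "\<lambda>n. f n x" n] by simp
    ultimately have "convergent (\<lambda>k. f k x)" by (auto simp: convergent_def)
    then show ?case unfolding h_def by (simp add: convergent_LIMSEQ_iff)
  qed
  have "Lp_int M p (\<lambda>x. f k x - h x) \<le> ennreal (((1 / 4) ^ k) powr p)" for k
  proof -
    have "Lp_int M p (\<lambda>x. f k x - h x) = (\<integral>\<^sup>+x. liminf (\<lambda>l. ennreal (\<bar>f k x - f l x\<bar> powr p)) \<partial>M)"
      unfolding Lp_int_def
    proof (rule nn_integral_cong_AE)
      show "AE x in M. ennreal (norm (f k x - h x) powr p) = liminf (\<lambda>l. ennreal (\<bar>f k x - f l x\<bar> powr p))"
        using conv
      proof eventually_elim
        case (elim x)
        have "(\<lambda>l. \<bar>f k x - f l x\<bar> powr p) \<longlonglongrightarrow> \<bar>f k x - h x\<bar> powr p"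
          using p by (intro tendsto_powr2 tendsto_intros elim) auto
        then have "(\<lambda>l. ennreal (\<bar>f k x - f l x\<bar> powr p)) \<longlonglongrightarrow> ennreal (\<bar>f k x - h x\<bar> powr p)"
          by (rule tendsto_ennrealI)
        from lim_imp_Liminf[OF _ this] show ?case by simp
      qed
    qed
    also have "\<dots> \<le> liminf (\<lambda>l. \<integral>\<^sup>+x. ennreal (\<bar>f k x - f l x\<bar> powr p) \<partial>M)"
      by (rule nn_integral_liminf) measurable
    also have "\<dots> \<le> limsup (\<lambda>l. \<integral>\<^sup>+x. ennreal (\<bar>f k x - f l x\<bar> powr p) \<partial>M)"
      by (rule Liminf_le_Limsup) simp
    also have "\<dots> \<le> ennreal (((1 / 4) ^ k) powr p)"
    proof (rule Limsup_bounded)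
      show "\<forall>\<^sub>F l in sequentially. (\<integral>\<^sup>+x. ennreal (\<bar>f k x - f l x\<bar> powr p) \<partial>M) \<le> ennreal (((1 / 4) ^ k) powr p)"
        using eventually_ge_at_top[of k] by eventually_elim (use le in \<open>simp add: Lp_int_def\<close>)
    qed
    finally show ?thesis .
  qed
  with hm show ?thesis by (rule that)
qed

context subgraph_domain
begin

text \<open>
  The horizontal coordinates are contracted towards the centre of the cube by the factor \<open>1 -
  t\<close>. This may lower the graph by up to \<open>K t L / 2\<close>, so the vertical coordinate has to be
  contracted by a larger amount \<open>s = t (2 + K)\<close>; then it is moved up by \<open>t L\<close> to leave the
  bottom.
\<close>

lemma shrink:
  assumes "\<epsilon> > 0"
  shows "\<exists>d b. (\<forall>l. \<bar>d l - 1\<bar> < \<epsilon>) \<and> norm b < \<epsilon> \<and> diag_affine d b ` closure \<Omega> \<subseteq> \<Omega>"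
proof -
  let ?n = "real CARD('n)"
  define t where "t = min \<epsilon> 1 / 2 / (2 + K + ?n * L)"
  have den: "2 + K + ?n * L > 0" using K_nonneg L_pos by (intro add_pos_nonneg) auto
  have t: "t > 0" using assms den by (simp add: t_def)
  have tt: "t * (2 + K + ?n * L) = min \<epsilon> 1 / 2" using den t_def nonzero_eq_divide_eq[of "2 + K + ?n * L" t "min \<epsilon> 1 / 2"] by simp
  define s where "s = t * (2 + K)"
  have s: "t \<le> s" "s < \<epsilon>" "s < 1" "?n * (t * L) < \<epsilon>"
  proof -
    have "t * (2 + K) + ?n * (t * L) = min \<epsilon> 1 / 2" using tt by (simp add: algebra_simps)
    moreover have "0 < ?n * (t * L)" using t L_pos by simp
    moreover have "0 < t * (2 + K)" using t K_nonneg by simp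
    moreover have "min \<epsilon> 1 / 2 < \<epsilon>" "min \<epsilon> 1 / 2 < 1" using assms by auto
    ultimately show "s < \<epsilon>" "s < 1" "?n * (t * L) < \<epsilon>" unfolding s_def by linarith+
    have "t * 1 \<le> t * (2 + K)" using t K_nonneg by (intro mult_left_mono) auto
    then show "t \<le> s" by (simp add: s_def)
  qed
  define d where "d l = (if l = \<kappa> then 1 - s else 1 - t)" for l
  define b where "b = (\<chi> l. if l = \<kappa> then t * L else t * L / 2)"
  have nb: "norm b < \<epsilon>"
  proof -
    have "norm (b - 0) \<le> ?n * (t * L)"
      using t L_pos by (intro sum_coords_le) (auto simp: b_def)
    then show ?thesis using s(4) by simp
  qed
  have "diag_affine d b x \<in> \<Omega>" if "x \<in> closure \<Omega>" for x
  proof -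
    let ?y = "diag_affine d b x"
    have x: "\<And>l. l \<noteq> \<kappa> \<Longrightarrow> 0 \<le> x $ l \<and> x $ l \<le> L" "0 \<le> x $ \<kappa>" "x $ \<kappa> \<le> g x"
      using that closure_subset_subgraph by auto
    have yl: "?y $ l = x $ l + t * (L / 2 - x $ l)" if "l \<noteq> \<kappa>" for l
      using that by (simp add: d_def b_def algebra_simps)
    have yk: "?y $ \<kappa> = (1 - s) * x $ \<kappa> + t * L" by (simp add: d_def b_def)
    have t1: "t < 1" using s by linarith
    have "\<bar>g x - g ?y\<bar> \<le> K * (t * L / 2)"
    proof (rule g_lip)
      show "\<bar>x $ l - ?y $ l\<bar> \<le> t * L / 2" if l: "l \<noteq> \<kappa>" for l
      proof -
        have "\<bar>x $ l - ?y $ l\<bar> = t * \<bar>L / 2 - x $ l\<bar>" unfolding yl[OF l] using t by (simp add: abs_mult)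
        also have "\<dots> \<le> t * (L / 2)"
        proof (rule mult_left_mono)
          show "\<bar>L / 2 - x $ l\<bar> \<le> L / 2" using x(1)[OF l] by linarith
        qed (use t in simp)
        finally show ?thesis by simp
      qed
    qed (use t L_pos in simp)
    then have gy: "g ?y \<ge> g x - K * (t * L / 2)" by linarith
    have "(1 - s) * x $ \<kappa> \<le> (1 - s) * g x" using x(3) s(3) by (intro mult_left_mono) auto
    also have "\<dots> \<le> g x - s * L"
    proof -
      have "s * L \<le> s * g x" using g_ge[of x] s(1) t by (intro mult_left_mono) auto
      then show ?thesis by (simp add: algebra_simps)
    qed
    also have "s * L = 2 * (t * L) + K * (t * L)" by (simp add: s_def algebra_simps)
    finally have "?y $ \<kappa> \<le> g x - t * L - K * (t * L)" unfolding yk by linarith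
    moreover have "0 < t * L" "0 \<le> K * (t * L)" using t L_pos K_nonneg by auto
    moreover have "K * (t * L / 2) = K * (t * L) / 2" by simp
    ultimately have up: "?y $ \<kappa> < g ?y" using gy by linarith
    have low: "0 < ?y $ \<kappa>"
      unfolding yk using x(2) s(3) t L_pos by (intro add_nonneg_pos mult_nonneg_nonneg) auto
    have "0 < ?y $ l \<and> ?y $ l < L" if l: "l \<noteq> \<kappa>" for l
    proof -
      have "?y $ l = (1 - t) * x $ l + t * (L / 2)" unfolding yl[OF l] by (simp add: algebra_simps)
      moreover have "0 \<le> (1 - t) * x $ l" "(1 - t) * x $ l \<le> (1 - t) * L"
        using x(1)[OF l] t1 by (auto intro: mult_left_mono)
      moreover have "0 < t * (L / 2)" "t * (L / 2) < t * L" using t L_pos by auto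
      moreover have "(1 - t) * L + t * L = L" by (simp add: algebra_simps)
      ultimately show ?thesis by linarith
    qed
    with up low show ?thesis using subgraph by blast
  qed
  moreover have "\<bar>d l - 1\<bar> < \<epsilon>" for l using s t by (auto simp: d_def)
  ultimately show ?thesis using nb by (intro exI[of _ d] exI[of _ b]) auto
qed

lemma borel_measurable_surface: "h \<in> borel_measurable borel \<Longrightarrow> h \<in> borel_measurable (surface_measure \<Omega>)"
  unfolding surface_measure_def
  by (intro measurable_restrict_space1) (simp add: measurable_cong_sets[OF sets_hausdorff_measure refl])

definition surface_area :: real where
  "surface_area = enn2real (emeasure (surface_measure \<Omega>) (space (surface_measure \<Omega>)))"

lemma Lp_int_surface_const:
  "Lp_int (surface_measure \<Omega>) p (\<lambda>x. c :: real) = ennreal (\<bar>c\<bar> powr p) * ennreal surface_area"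
  using surface_finite by (simp add: Lp_int_def surface_area_def)

lemma surface_area_nonneg: "surface_area \<ge> 0"
  by (simp add: surface_area_def)

lemma mean_powr_le:
  assumes "in_Lp (lebesgue_on \<Omega>) p u"
  shows "ennreal (\<bar>cube_mean L u\<bar> powr p) \<le> ennreal (1 / L ^ CARD('n)) * Lp_int (lebesgue_on \<Omega>) p u"
proof -
  have "ennreal (\<bar>cube_mean L u\<bar> powr p) \<le>
    ennreal (1 / L ^ CARD('n)) * (\<integral>\<^sup>+y. ennreal (\<bar>u y\<bar> powr p) * indicator (open_cube L) y \<partial>lborel)"
    by (intro cube_mean_powr_le p_gt_1 L_pos borel_measurable_integrable integrable_cube assms)
  also have "\<dots> \<le> ennreal (1 / L ^ CARD('n)) * (\<integral>\<^sup>+y. ennreal (\<bar>u y\<bar> powr p) * indicator \<Omega> y \<partial>lborel)"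
    using cube_subset by (intro mult_left_mono nn_integral_mono) (auto simp: indicator_def)
  finally show ?thesis unfolding nn_integral_dom by (simp add: Lp_int_def)
qed

definition energy :: "(real^'n \<Rightarrow> real) \<Rightarrow> (real^'n \<Rightarrow> real^'n) \<Rightarrow> ennreal" where
  "energy u w = Lp_int (lebesgue_on \<Omega>) p u + Lp_int (lebesgue_on \<Omega>) p w"

text \<open>
  Only an upper bound \<open>T\<close> of the constant is fixed, since the constant itself is a term that
  obscures the computations.
\<close>

context
  fixes T :: real
  assumes T: "trace_const CARD('n) p * (K + 1) * L powr (p - 1) \<le> T"
begin

lemma T_nonneg: "T \<ge> 0"
proof -
  have "0 \<le> trace_const CARD('n) p * (K + 1) * L powr (p - 1)"
    using K_nonneg trace_const_nonneg by simp
  then show ?thesis using T by linarith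
qed

lemma boundary_le:
  assumes d: "\<And>x. (v has_derivative (\<lambda>h. G x \<bullet> h)) (at x)" and c: "continuous_on UNIV G"
  shows "Lp_int (surface_measure \<Omega>) p v \<le> ennreal (2 powr p) *
    (ennreal T * Lp_int (lebesgue_on \<Omega>) p G + ennreal (\<bar>cube_mean L v\<bar> powr p) * ennreal surface_area)"
proof -
  have vc: "continuous_on UNIV v"
    using d by (auto simp: continuous_on_eq_continuous_at intro: has_derivative_continuous)
  have vm: "v \<in> borel_measurable borel" by (rule borel_measurable_continuous_onI[OF vc])
  let ?a = "cube_mean L v"
  have "Lp_int (surface_measure \<Omega>) p (\<lambda>x. (v x - ?a) + ?a) \<le>
      ennreal (2 powr p) * (Lp_int (surface_measure \<Omega>) p (\<lambda>x. v x - ?a) + Lp_int (surface_measure \<Omega>) p (\<lambda>x. ?a))"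
    using vm p_gt_1 by (intro Lp_int_add_le borel_measurable_surface) auto
  also have "\<dots> \<le> ennreal (2 powr p) * (ennreal T * Lp_int (lebesgue_on \<Omega>) p G + ennreal (\<bar>?a\<bar> powr p) * ennreal surface_area)"
    unfolding Lp_int_surface_const
  proof (intro mult_left_mono add_mono order_refl)
    have "Lp_int (surface_measure \<Omega>) p (\<lambda>x. v x - ?a) \<le>
        ennreal (trace_const CARD('n) p * (K + 1) * L powr (p - 1)) * Lp_int (lebesgue_on \<Omega>) p G"
      by (rule boundary_deviation_le[OF d c])
    also have "\<dots> \<le> ennreal T * Lp_int (lebesgue_on \<Omega>) p G"
      using T by (intro mult_right_mono ennreal_leI) auto
    finally show "Lp_int (surface_measure \<Omega>) p (\<lambda>x. v x - ?a) \<le> \<dots>" .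
  qed auto
  finally show ?thesis by simp
qed

text \<open>
  The trace operator is bounded on differences of smooth functions; this makes the traces of
  an approximating sequence a Cauchy sequence.
\<close>

lemma boundary_diff_le:
  assumes v: "smooth v" and w: "smooth w"
  shows "Lp_int (surface_measure \<Omega>) p (\<lambda>x. v x - w x) \<le>
    ennreal (2 powr p * (T + surface_area / L ^ CARD('n))) * energy (\<lambda>x. v x - w x) (\<lambda>x. grad v x - grad w x)"
proof -
  let ?f = "\<lambda>x. v x - w x" and ?G = "\<lambda>x. grad v x - grad w x"
  let ?X = "Lp_int (lebesgue_on \<Omega>) p ?f" and ?Y = "Lp_int (lebesgue_on \<Omega>) p ?G"
  have d: "(?f has_derivative (\<lambda>h. ?G x \<bullet> h)) (at x)" for x
    unfolding inner_diff_left by (intro has_derivative_diff smooth_has_grad v w)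
  have c: "continuous_on UNIV ?G" by (intro continuous_on_diff smooth_continuous_grad v w)
  have f: "in_Lp (lebesgue_on \<Omega>) p ?f" by (intro in_Lp_continuous continuous_on_diff smooth_continuous v w)
  have "Lp_int (surface_measure \<Omega>) p ?f \<le> ennreal (2 powr p) *
      (ennreal T * ?Y + ennreal (\<bar>cube_mean L ?f\<bar> powr p) * ennreal surface_area)"
    by (rule boundary_le[OF d c])
  also have "\<dots> \<le> ennreal (2 powr p) * (ennreal T * ?Y + (ennreal (1 / L ^ CARD('n)) * ?X) * ennreal surface_area)"
    by (intro mult_left_mono add_mono mult_right_mono mean_powr_le f) auto
  also have "(ennreal (1 / L ^ CARD('n)) * ?X) * ennreal surface_area = ennreal (surface_area / L ^ CARD('n)) * ?X"
  proof -
    have "surface_area / L ^ CARD('n) = 1 / L ^ CARD('n) * surface_area" by simp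
    then have "ennreal (surface_area / L ^ CARD('n)) = ennreal (1 / L ^ CARD('n)) * ennreal surface_area"
      using surface_area_nonneg L_pos by (simp only:) (intro ennreal_mult, auto)
    then show ?thesis by (simp only: ac_simps)
  qed
  also have "ennreal T * ?Y + ennreal (surface_area / L ^ CARD('n)) * ?X \<le>
      ennreal (T + surface_area / L ^ CARD('n)) * ?Y + ennreal (T + surface_area / L ^ CARD('n)) * ?X"
    using T_nonneg surface_area_nonneg L_pos by (intro add_mono mult_right_mono ennreal_leI) auto
  also have "\<dots> = ennreal (T + surface_area / L ^ CARD('n)) * energy ?f ?G"
    by (simp add: energy_def distrib_left add.commute)
  finally have "Lp_int (surface_measure \<Omega>) p ?f \<le> ennreal (2 powr p) * (ennreal (T + surface_area / L ^ CARD('n)) * energy ?f ?G)"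
    by (simp add: mult_left_mono)
  also have "\<dots> = ennreal (2 powr p * (T + surface_area / L ^ CARD('n))) * energy ?f ?G"
    using T_nonneg surface_area_nonneg L_pos by (subst ennreal_mult) (auto simp: mult.assoc)
  finally show ?thesis .
qed

lemma energy_diff_le:
  assumes "in_Lp (lebesgue_on \<Omega>) p a" "in_Lp (lebesgue_on \<Omega>) p b" "in_Lp (lebesgue_on \<Omega>) p u"
    "in_Lp (lebesgue_on \<Omega>) p ga" "in_Lp (lebesgue_on \<Omega>) p gb" "in_Lp (lebesgue_on \<Omega>) p gu"
  shows "energy (\<lambda>x. a x - b x) (\<lambda>x. ga x - gb x) \<le> ennreal (2 powr p) *
    (energy (\<lambda>x. a x - u x) (\<lambda>x. ga x - gu x) + energy (\<lambda>x. b x - u x) (\<lambda>x. gb x - gu x))"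
proof -
  have gen: "Lp_int (lebesgue_on \<Omega>) p (\<lambda>x. a x - b x) \<le> ennreal (2 powr p) *
      (Lp_int (lebesgue_on \<Omega>) p (\<lambda>x. a x - u x) + Lp_int (lebesgue_on \<Omega>) p (\<lambda>x. b x - u x))"
    if "in_Lp (lebesgue_on \<Omega>) p a" "in_Lp (lebesgue_on \<Omega>) p b" "in_Lp (lebesgue_on \<Omega>) p u"
    for a b u :: "real^'n \<Rightarrow> 'z::euclidean_space"
    using Lp_int_diff_le[of "\<lambda>x. a x - u x" "lebesgue_on \<Omega>" "\<lambda>x. b x - u x" p] that p_gt_1
    by (auto simp: in_Lp_def)
  show ?thesis
    using add_mono[OF gen[OF assms(1-3)] gen[OF assms(4-6)]]
    by (simp add: energy_def distrib_left ac_simps)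
qed

text \<open>
  The approximations \<open>v k\<close> are chosen so close to \<open>u\<close> that their boundary values satisfy the
  hypothesis of \<open>Lp_complete_geometric\<close>.
\<close>

theorem trace_exists:
  assumes "u \<in> sobolev \<Omega> p"
  shows "\<exists>h. is_trace \<Omega> p u h"
proof -
  have u: "in_Lp (lebesgue_on \<Omega>) p u" using assms by (simp add: sobolev_def)
  define gu where "gu = weak_gradient \<Omega> p u"
  have w: "is_weak_gradient \<Omega> p u gu" unfolding gu_def by (rule is_weak_gradient_weak_gradient[OF assms])
  have gup: "in_Lp (lebesgue_on \<Omega>) p gu" using w by (simp add: is_weak_gradient_def)
  define A where "A = 2 powr p * (T + surface_area / L ^ CARD('n))"
  have A: "A \<ge> 0" using T_nonneg surface_area_nonneg L_pos by (simp add: A_def)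
  \<comment> \<open>\<open>A\<close> bounds the trace operator and \<open>2\<^sup>p \<cdot> 2 \<epsilon> k\<close> the energy of \<open>v k - v l\<close>; 1 is added because \<open>A\<close>
    may be 0\<close>
  define \<epsilon> where "\<epsilon> k = ((1 / 4) ^ k) powr p / (A * 2 powr p * 2 + 1)" for k :: nat
  have den: "A * 2 powr p * 2 + 1 > 0" using A by (intro add_nonneg_pos) auto
  have \<epsilon>: "\<epsilon> k > 0" for k using den by (simp add: \<epsilon>_def)
  have \<epsilon>mono: "\<epsilon> l \<le> \<epsilon> k" if "k \<le> l" for k l
    unfolding \<epsilon>_def using den p_gt_1 that by (intro divide_right_mono powr_mono2 power_decreasing) auto
  have "\<exists>v. smooth v \<and> energy (\<lambda>x. v x - u x) (\<lambda>x. grad v x - gu x) \<le> ennreal (\<epsilon> k)" for k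
    using smooth_dense[OF shrink w u \<epsilon>[of k]] unfolding energy_def by metis
  then obtain v where v: "\<And>k. smooth (v k)"
    and ev: "\<And>k. energy (\<lambda>x. v k x - u x) (\<lambda>x. grad (v k) x - gu x) \<le> ennreal (\<epsilon> k)" by metis
  have vp: "in_Lp (lebesgue_on \<Omega>) p (v k)" "in_Lp (lebesgue_on \<Omega>) p (grad (v k))" for k
    by (intro in_Lp_continuous smooth_continuous smooth_continuous_grad v)+
  have vm: "v k \<in> borel_measurable (surface_measure \<Omega>)" for k
    by (intro borel_measurable_surface borel_measurable_continuous_onI smooth_continuous v)
  have cauchy: "Lp_int (surface_measure \<Omega>) p (\<lambda>x. v k x - v l x) \<le> ennreal (((1 / 4) ^ k) powr p)"
    if "k \<le> l" for k l
  proof -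
    have "Lp_int (surface_measure \<Omega>) p (\<lambda>x. v k x - v l x) \<le>
        ennreal A * energy (\<lambda>x. v k x - v l x) (\<lambda>x. grad (v k) x - grad (v l) x)"
      unfolding A_def by (rule boundary_diff_le[OF v v])
    also have "\<dots> \<le> ennreal A * (ennreal (2 powr p) * (ennreal (\<epsilon> k) + ennreal (\<epsilon> k)))"
    proof (rule mult_left_mono)
      have "energy (\<lambda>x. v k x - v l x) (\<lambda>x. grad (v k) x - grad (v l) x) \<le> ennreal (2 powr p) *
         (energy (\<lambda>x. v k x - u x) (\<lambda>x. grad (v k) x - gu x) + energy (\<lambda>x. v l x - u x) (\<lambda>x. grad (v l) x - gu x))"
        by (rule energy_diff_le[OF vp(1) vp(1) u vp(2) vp(2) gup])
      also have "\<dots> \<le> ennreal (2 powr p) * (ennreal (\<epsilon> k) + ennreal (\<epsilon> k))"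
        using ev \<epsilon>mono[OF that] by (intro mult_left_mono add_mono) (auto intro: order_trans ennreal_leI)
      finally show "energy (\<lambda>x. v k x - v l x) (\<lambda>x. grad (v k) x - grad (v l) x) \<le> \<dots>" .
    qed simp
    also have "\<dots> = ennreal (A * 2 powr p * 2 * \<epsilon> k)"
      using A \<epsilon>[of k] by (simp add: ennreal_mult ennreal_plus[symmetric] mult.assoc del: ennreal_plus)
    also have "\<dots> \<le> ennreal (((1 / 4) ^ k) powr p)"
    proof (rule ennreal_leI)
      have "A * 2 powr p * 2 * \<epsilon> k \<le> (A * 2 powr p * 2 + 1) * \<epsilon> k" using \<epsilon>[of k] by (intro mult_right_mono) auto
      also have "\<dots> = ((1 / 4) ^ k) powr p" using den by (simp add: \<epsilon>_def)
      finally show "A * 2 powr p * 2 * \<epsilon> k \<le> ((1 / 4) ^ k) powr p" .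
    qed
    finally show ?thesis .
  qed
  obtain h where h: "h \<in> borel_measurable (surface_measure \<Omega>)"
    and lim: "\<And>k. Lp_int (surface_measure \<Omega>) p (\<lambda>x. v k x - h x) \<le> ennreal (((1 / 4) ^ k) powr p)"
    using Lp_complete_geometric[OF vm _ cauchy] p_gt_1 by (metis less_imp_le)
  have geo: "(\<lambda>k. ((1 / 4 :: real) ^ k) powr p) \<longlonglongrightarrow> 0"
    using tendsto_powr2[OF LIMSEQ_realpow_zero[of "1 / 4 :: real"] tendsto_const[of p]] p_gt_1 by simp
  have "is_trace \<Omega> p u h"
    unfolding is_trace_def
  proof (intro conjI exI[of _ v] allI v)
    have "Lp_int (surface_measure \<Omega>) p (v 0) < \<infinity>"
    proof -
      have "Lp_int (surface_measure \<Omega>) p (v 0) \<le> ennreal (2 powr p) *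
        (ennreal T * Lp_int (lebesgue_on \<Omega>) p (grad (v 0)) + ennreal (\<bar>cube_mean L (v 0)\<bar> powr p) * ennreal surface_area)"
        by (rule boundary_le[OF smooth_has_grad[OF v] smooth_continuous_grad[OF v]])
      also have "\<dots> < \<infinity>" using vp(2)[of 0] by (simp add: in_Lp_def ennreal_mult_less_top)
      finally show ?thesis .
    qed
    moreover have "Lp_int (surface_measure \<Omega>) p (\<lambda>x. v 0 x - h x) < \<infinity>"
      using lim[of 0] by (rule le_less_trans) simp
    moreover have "Lp_int (surface_measure \<Omega>) p (\<lambda>x. v 0 x - (v 0 x - h x)) \<le>
        ennreal (2 powr p) * (Lp_int (surface_measure \<Omega>) p (v 0) + Lp_int (surface_measure \<Omega>) p (\<lambda>x. v 0 x - h x))"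
      using vm h p_gt_1 by (intro Lp_int_diff_le borel_measurable_diff) auto
    ultimately have "Lp_int (surface_measure \<Omega>) p h < \<infinity>"
      by (auto simp: ennreal_mult_less_top intro: le_less_trans)
    then show "in_Lp (surface_measure \<Omega>) p h" using h by (simp add: in_Lp_def)
    show "v k \<in> sobolev \<Omega> p" for k by (rule smooth_weak_gradient(2)[OF v])
    show "(\<lambda>k. Lp_int (surface_measure \<Omega>) p (\<lambda>x. v k x - h x)) \<longlonglongrightarrow> 0"
    proof (rule tendsto_sandwich[OF _ _ tendsto_const])
      show "(\<lambda>k. ennreal (((1 / 4) ^ k) powr p)) \<longlonglongrightarrow> 0" using tendsto_ennrealI[OF geo] by simp
    qed (use lim in auto)
    show "(\<lambda>k. sobolev_norm \<Omega> p (\<lambda>x. v k x - u x)) \<longlonglongrightarrow> 0"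
    proof -
      have eq: "sobolev_norm \<Omega> p (\<lambda>x. v k x - u x) = enn2real (energy (\<lambda>x. v k x - u x) (\<lambda>x. grad (v k) x - gu x)) powr (1 / p)" for k
        unfolding energy_def
        by (rule sobolev_norm_eq[OF is_weak_gradient_diff(2)[OF u w vp(1) smooth_weak_gradient(1)[OF v]]
              is_weak_gradient_diff(1)[OF u w vp(1) smooth_weak_gradient(1)[OF v]]])
      have "sobolev_norm \<Omega> p (\<lambda>x. v k x - u x) \<le> (((1 / 4) ^ k) powr p) powr (1 / p)" for k
      proof -
        have "enn2real (energy (\<lambda>x. v k x - u x) (\<lambda>x. grad (v k) x - gu x)) \<le> \<epsilon> k"
          using ev[of k] \<epsilon>[of k] by (intro enn2real_leI) auto
        also have "\<dots> \<le> ((1 / 4) ^ k) powr p"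
        proof -
          have "\<epsilon> k \<le> ((1 / 4) ^ k) powr p / 1"
            unfolding \<epsilon>_def using A by (intro divide_left_mono) (auto intro!: add_nonneg_pos)
          then show ?thesis by simp
        qed
        finally show ?thesis unfolding eq using p_gt_1 by (intro powr_mono2) auto
      qed
      moreover have "(((1 / 4 :: real) ^ k) powr p) powr (1 / p) = (1 / 4) ^ k" for k
        using p_gt_1 by (simp add: powr_powr)
      ultimately have le: "sobolev_norm \<Omega> p (\<lambda>x. v k x - u x) \<le> (1 / 4) ^ k" for k by simp
      show ?thesis
        by (rule tendsto_sandwich[OF _ _ tendsto_const LIMSEQ_realpow_zero[of "1 / 4 :: real"]])
           (use le sobolev_norm_nonneg in auto)
    qed
  qed
  then show ?thesis by blast
qed

text \<open>
  Smooth functions \<open>v k\<close> that witness the trace of \<open>u\<close> satisfy the boundary inequality up to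
  a term with their mean value over the cube. The mean values converge to that of \<open>u\<close>, which
  is 0, and the limit \<open>k \<rightarrow> \<infinity>\<close> yields the claim.
\<close>

theorem trace_Poincare:
  assumes "u \<in> sobolev \<Omega> p" and mean: "cube_mean L u = 0"
  shows "Lp_int (surface_measure \<Omega>) p (sobolev_trace \<Omega> p u) \<le>
      ennreal (8 powr p * T) * Lp_int (lebesgue_on \<Omega>) p (weak_gradient \<Omega> p u)"
    and "Lp_int (surface_measure \<Omega>) p (sobolev_trace \<Omega> p u) < \<infinity>"
proof -
  have u: "in_Lp (lebesgue_on \<Omega>) p u" using assms by (simp add: sobolev_def)
  define gu where "gu = weak_gradient \<Omega> p u"
  have w: "is_weak_gradient \<Omega> p u gu" unfolding gu_def by (rule is_weak_gradient_weak_gradient[OF assms(1)])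
  have gup: "in_Lp (lebesgue_on \<Omega>) p gu" using w by (simp add: is_weak_gradient_def)
  define h where "h = sobolev_trace \<Omega> p u"
  have "is_trace \<Omega> p u h" unfolding h_def sobolev_trace_def by (rule someI_ex[OF trace_exists[OF assms(1)]])
  then obtain v where hp: "in_Lp (surface_measure \<Omega>) p h"
    and v: "\<And>k. smooth (v k)"
    and sn: "(\<lambda>k. sobolev_norm \<Omega> p (\<lambda>x. v k x - u x)) \<longlonglongrightarrow> 0"
    and tr: "(\<lambda>k. Lp_int (surface_measure \<Omega>) p (\<lambda>x. v k x - h x)) \<longlonglongrightarrow> 0"
    unfolding is_trace_def by blast
  show "Lp_int (surface_measure \<Omega>) p (sobolev_trace \<Omega> p u) < \<infinity>"
    using hp by (simp add: h_def in_Lp_def)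
  let ?S = "surface_measure \<Omega>" and ?D = "lebesgue_on \<Omega>"
  define e where "e k = energy (\<lambda>x. v k x - u x) (\<lambda>x. grad (v k) x - gu x)" for k
  have vp: "in_Lp ?D p (v k)" "in_Lp ?D p (grad (v k))" for k
    by (intro in_Lp_continuous smooth_continuous smooth_continuous_grad v)+
  have vm: "v k \<in> borel_measurable ?S" for k
    by (intro borel_measurable_surface borel_measurable_continuous_onI smooth_continuous v)
  note diff = is_weak_gradient_diff[OF u w vp(1) smooth_weak_gradient(1)[OF v]]
  have e: "e \<longlonglongrightarrow> 0"
  proof -
    have "e = (\<lambda>k. ennreal (sobolev_norm \<Omega> p (\<lambda>x. v k x - u x) powr p))"
      unfolding e_def energy_def by (intro ext sobolev_norm_powr[OF diff(2) diff(1)])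
    moreover have "(\<lambda>k. sobolev_norm \<Omega> p (\<lambda>x. v k x - u x) powr p) \<longlonglongrightarrow> 0"
      using tendsto_powr2[OF sn tendsto_const[of p]] p_gt_1 sobolev_norm_nonneg by simp
    ultimately show ?thesis
      using tendsto_ennrealI[of "\<lambda>k. sobolev_norm \<Omega> p (\<lambda>x. v k x - u x) powr p" 0 sequentially] by simp
  qed
  let ?X = "Lp_int ?D p gu" and ?c = "surface_area / L ^ CARD('n)"
  have c0: "?c \<ge> 0" using surface_area_nonneg L_pos by simp
  have step: "Lp_int ?S p h \<le> ennreal (2 powr p) * (Lp_int ?S p (\<lambda>x. v k x - h x) +
      ennreal (2 powr p) * (ennreal T * (ennreal (2 powr p) * (e k + ?X)) + ennreal ?c * e k))" for k
  proof -
    have "Lp_int ?S p (\<lambda>x. v k x - (v k x - h x)) \<le> ennreal (2 powr p) * (Lp_int ?S p (v k) + Lp_int ?S p (\<lambda>x. v k x - h x))"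
      using vm hp p_gt_1 by (intro Lp_int_diff_le borel_measurable_diff) (auto simp: in_Lp_def)
    also have "\<dots> \<le> ennreal (2 powr p) * (ennreal (2 powr p) * (ennreal T * (ennreal (2 powr p) * (e k + ?X)) + ennreal ?c * e k)
        + Lp_int ?S p (\<lambda>x. v k x - h x))"
    proof (intro mult_left_mono add_right_mono)
      have "Lp_int ?S p (v k) \<le> ennreal (2 powr p) *
        (ennreal T * Lp_int ?D p (grad (v k)) + ennreal (\<bar>cube_mean L (v k)\<bar> powr p) * ennreal surface_area)"
        by (rule boundary_le[OF smooth_has_grad[OF v] smooth_continuous_grad[OF v]])
      also have "\<dots> \<le> ennreal (2 powr p) * (ennreal T * (ennreal (2 powr p) * (e k + ?X)) + ennreal ?c * e k)"
      proof (intro mult_left_mono add_mono)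
        have "Lp_int ?D p (\<lambda>x. (grad (v k) x - gu x) + gu x) \<le>
            ennreal (2 powr p) * (Lp_int ?D p (\<lambda>x. grad (v k) x - gu x) + ?X)"
          using vp gup p_gt_1 by (intro Lp_int_add_le borel_measurable_diff) (auto simp: in_Lp_def)
        also have "\<dots> \<le> ennreal (2 powr p) * (e k + ?X)"
          unfolding e_def energy_def by (intro mult_left_mono add_mono) (auto intro: add_increasing)
        finally show "Lp_int ?D p (grad (v k)) \<le> ennreal (2 powr p) * (e k + ?X)" by simp
        have "cube_mean L (v k) = cube_mean L (\<lambda>x. v k x - u x)"
          using mean by (subst cube_mean_diff) (auto intro!: integrable_cube vp u)
        then have "ennreal (\<bar>cube_mean L (v k)\<bar> powr p) \<le> ennreal (1 / L ^ CARD('n)) * Lp_int ?D p (\<lambda>x. v k x - u x)"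
          using mean_powr_le[OF diff(1)] by simp
        also have "\<dots> \<le> ennreal (1 / L ^ CARD('n)) * e k"
          unfolding e_def energy_def by (intro mult_left_mono) (auto intro: add_increasing2)
        finally have "ennreal (\<bar>cube_mean L (v k)\<bar> powr p) * ennreal surface_area \<le>
            ennreal (1 / L ^ CARD('n)) * e k * ennreal surface_area" by (rule mult_right_mono) simp
        also have "\<dots> = ennreal ?c * e k"
        proof -
          have "?c = 1 / L ^ CARD('n) * surface_area" by simp
          then have "ennreal ?c = ennreal (1 / L ^ CARD('n)) * ennreal surface_area"
            using surface_area_nonneg L_pos by (simp only:) (intro ennreal_mult, auto)
          then show ?thesis by (simp only: ac_simps)
        qed
        finally show "ennreal (\<bar>cube_mean L (v k)\<bar> powr p) * ennreal surface_area \<le> ennreal ?c * e k" .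
      qed auto
      finally show "Lp_int ?S p (v k) \<le> \<dots>" .
    qed auto
    finally show ?thesis by (simp add: add.commute)
  qed
  have "(\<lambda>k. ennreal (2 powr p) * (Lp_int ?S p (\<lambda>x. v k x - h x) +
      ennreal (2 powr p) * (ennreal T * (ennreal (2 powr p) * (e k + ?X)) + ennreal ?c * e k)))
     \<longlonglongrightarrow> ennreal (2 powr p) * (0 + ennreal (2 powr p) * (ennreal T * (ennreal (2 powr p) * (0 + ?X)) + ennreal ?c * 0))"
    by (intro ennreal_tendsto_cmult tendsto_add tr e tendsto_const) auto
  then have "Lp_int ?S p h \<le> ennreal (2 powr p) * (0 + ennreal (2 powr p) * (ennreal T * (ennreal (2 powr p) * (0 + ?X)) + ennreal ?c * 0))"
    by (rule LIMSEQ_le_const) (use step in blast)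
  also have "\<dots> = ennreal (2 powr p * (2 powr p * (T * 2 powr p))) * ?X"
  proof -
    have q: "0 \<le> 2 powr p" by simp
    show ?thesis using T_nonneg by (simp add: ennreal_mult[OF q] ennreal_mult[OF T_nonneg q] mult.assoc)
  qed
  also have "2 powr p * (2 powr p * (T * 2 powr p)) = 8 powr p * T"
  proof -
    have "(8::real) powr p = (2 * 2 * 2) powr p" by simp
    also have "\<dots> = 2 powr p * 2 powr p * 2 powr p" by (simp only: powr_mult)
    finally show ?thesis by (simp only: ac_simps)
  qed
  finally show "Lp_int ?S p (sobolev_trace \<Omega> p u) \<le> ennreal (8 powr p * T) * Lp_int ?D p (weak_gradient \<Omega> p u)"
    by (simp add: h_def gu_def)
qed

section \<open>The second eigenvalue\<close>

lemma continuous_map_cube_mean: "continuous_map (sobolev_topology \<Omega> p) euclideanreal (cube_mean L)"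
  unfolding continuous_map_def
proof (intro conjI allI impI)
  show "cube_mean L \<in> topspace (sobolev_topology \<Omega> p) \<rightarrow> topspace euclideanreal" by simp
  fix U :: "real set" assume "openin euclideanreal U"
  then have U: "open U" by simp
  show "openin (sobolev_topology \<Omega> p) {u \<in> topspace (sobolev_topology \<Omega> p). cube_mean L u \<in> U}"
    unfolding openin_sobolev_topology topspace_sobolev_topology
  proof (intro conjI ballI)
    fix u assume "u \<in> {u \<in> sobolev \<Omega> p. cube_mean L u \<in> U}"
    then have us: "u \<in> sobolev \<Omega> p" and uU: "cube_mean L u \<in> U" by auto
    then obtain e where e: "e > 0" "ball (cube_mean L u) e \<subseteq> U" using U open_contains_ball by blast
    have u: "in_Lp (lebesgue_on \<Omega>) p u" using us by (simp add: sobolev_def)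
    define m where "m = L ^ CARD('n)"
    have m: "m > 0" using L_pos by (simp add: m_def)
    show "\<exists>r>0. \<forall>v\<in>sobolev \<Omega> p. sobolev_norm \<Omega> p (\<lambda>x. v x - u x) < r \<longrightarrow> v \<in> {u \<in> sobolev \<Omega> p. cube_mean L u \<in> U}"
    proof (intro exI[of _ "e * m powr (1 / p)"] conjI ballI impI)
      show "e * m powr (1 / p) > 0" using e m by simp
      fix v assume vs: "v \<in> sobolev \<Omega> p" and lt: "sobolev_norm \<Omega> p (\<lambda>x. v x - u x) < e * m powr (1 / p)"
      have v: "in_Lp (lebesgue_on \<Omega>) p v" using vs by (simp add: sobolev_def)
      note diff = is_weak_gradient_diff[OF u is_weak_gradient_weak_gradient[OF us] v is_weak_gradient_weak_gradient[OF vs]]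
      let ?N = "sobolev_norm \<Omega> p (\<lambda>x. v x - u x)"
      have "ennreal (\<bar>cube_mean L (\<lambda>x. v x - u x)\<bar> powr p) \<le> ennreal (1 / m) * Lp_int (lebesgue_on \<Omega>) p (\<lambda>x. v x - u x)"
        unfolding m_def by (rule mean_powr_le[OF diff(1)])
      also have "\<dots> \<le> ennreal (1 / m) * ennreal (?N powr p)"
        unfolding sobolev_norm_powr[OF diff(2) diff(1), symmetric] by (intro mult_left_mono) (auto intro: add_increasing2)
      also have "\<dots> = ennreal (1 / m * ?N powr p)" using m by (subst ennreal_mult) auto
      finally have "\<bar>cube_mean L (\<lambda>x. v x - u x)\<bar> powr p \<le> 1 / m * ?N powr p" using m by simp
      also have "\<dots> < 1 / m * (e * m powr (1 / p)) powr p"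
        using m lt p_gt_1 sobolev_norm_nonneg by (intro mult_strict_left_mono powr_less_mono2) auto
      also have "(e * m powr (1 / p)) powr p = e powr p * m"
        using e m p_gt_1 by (simp add: powr_mult powr_powr)
      finally have "\<bar>cube_mean L (\<lambda>x. v x - u x)\<bar> powr p < e powr p" using m by simp
      then have "\<bar>cube_mean L (\<lambda>x. v x - u x)\<bar> < e"
        using e p_gt_1 by (meson abs_ge_zero less_imp_le not_le order.strict_trans powr_mono2 zero_less_one)
      moreover have "cube_mean L (\<lambda>x. v x - u x) = cube_mean L v - cube_mean L u"
        by (intro cube_mean_diff integrable_cube u v)
      ultimately have "cube_mean L v \<in> ball (cube_mean L u) e" by (simp add: dist_real_def abs_minus_commute)
      then show "v \<in> {u \<in> sobolev \<Omega> p. cube_mean L u \<in> U}" using e(2) vs by auto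
    qed
  qed auto
qed

text \<open>
  Otherwise the mean value over the cube would be a continuous odd map of \<open>F\<close> into the
  punctured line.
\<close>

lemma genus_ge_2_imp_mean_zero:
  assumes F: "F \<in> Gamma \<Omega> p 2"
  shows "\<exists>u\<in>F. cube_mean L u = 0"
proof (rule ccontr)
  assume contra: "\<not> (\<exists>u\<in>F. cube_mean L u = 0)"
  have G: "genus (sobolev_topology \<Omega> p) F \<ge> enat 2"
    using F by (auto simp: Gamma_def)
  define f where "f u = (\<lambda>i::nat. if i = 0 then cube_mean L u else 0)" for u :: "real^'n \<Rightarrow> real"
  have "continuous_map (subtopology (sobolev_topology \<Omega> p) F) (Euclidean_space 1) f"
    unfolding Euclidean_space_def continuous_map_in_subtopology continuous_map_componentwise_UNIV
  proof (intro conjI allI)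
    show "continuous_map (subtopology (sobolev_topology \<Omega> p) F) euclideanreal (\<lambda>u. f u i)" for i
      unfolding f_def
      by (cases "i = 0") (auto intro: continuous_map_from_subtopology continuous_map_cube_mean)
    show "f \<in> topspace (subtopology (sobolev_topology \<Omega> p) F) \<rightarrow> {x. \<forall>i\<ge>1. x i = 0}"
      by (auto simp: f_def)
  qed
  moreover have "f u \<noteq> (\<lambda>_. 0)" if "u \<in> F" for u
    using contra that by (auto simp: f_def fun_eq_iff intro!: exI[of _ 0])
  moreover have "f (\<lambda>x. - u x) = (\<lambda>i. - f u i)" for u
    by (auto simp: f_def cube_mean_def)
  ultimately have "enat 1 \<in> enat ` {l. l \<ge> 1 \<and> (\<exists>f. continuous_map (subtopology (sobolev_topology \<Omega> p) F) (Euclidean_space l) f \<and>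
            (\<forall>u\<in>F. f u \<noteq> (\<lambda>_. 0)) \<and> (\<forall>u\<in>F. f (\<lambda>x. - u x) = (\<lambda>i. - f u i)))}"
    by (intro imageI CollectI conjI exI[of _ f]) auto
  then have "genus (sobolev_topology \<Omega> p) F \<le> enat 1"
    unfolding genus_def by (rule Inf_lower)
  with G have "enat 2 \<le> enat 1" by (rule order_trans)
  then show False by simp
qed

theorem steklov_eigenvalue_ge:
  assumes "T > 0"
  shows "ennreal (1 / (8 powr p * T)) \<le> steklov_eigenvalue \<Omega> p 2"
  unfolding steklov_eigenvalue_def
proof (rule INF_greatest)
  let ?C = "8 powr p * T"
  have C: "?C > 0" using assms by simp
  fix F assume F: "F \<in> Gamma \<Omega> p 2"
  then obtain u where u: "u \<in> F" "cube_mean L u = 0"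
    using genus_ge_2_imp_mean_zero by blast
  then have us: "u \<in> sobolev \<Omega> p" using F by (auto simp: Gamma_def)
  let ?b = "Lp_int (surface_measure \<Omega>) p (sobolev_trace \<Omega> p u)"
  let ?X = "Lp_int (lebesgue_on \<Omega>) p (weak_gradient \<Omega> p u)"
  have "ennreal (1 / ?C) \<le> rayleigh \<Omega> p u"
  proof (cases "?b = 0")
    case False
    have fin: "?b < \<infinity>" by (rule trace_Poincare(2)[OF us u(2)])
    have "?b \<le> ennreal ?C * ?X" by (rule trace_Poincare(1)[OF us u(2)])
    then have "ennreal (1 / ?C) * ?b \<le> ennreal (1 / ?C) * (ennreal ?C * ?X)" by (rule mult_left_mono) simp
    also have "\<dots> = ?X"
      using assms by (simp add: mult.assoc[symmetric] ennreal_mult[symmetric])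
    finally have "ennreal (1 / ?C) * ?b \<le> ?X" .
    then have "ennreal (1 / ?C) * ?b / ?b \<le> ?X / ?b" by (rule divide_right_mono_ennreal)
    also have "ennreal (1 / ?C) * ?b / ?b = ennreal (1 / ?C)"
      using False fin by (simp add: ennreal_mult_divide_eq)
    finally show ?thesis using False by (simp add: rayleigh_def)
  qed (simp add: rayleigh_def)
  also have "\<dots> \<le> (SUP u\<in>F. rayleigh \<Omega> p u)" using u(1) by (rule SUP_upper)
  finally show "ennreal (1 / ?C) \<le> (SUP u\<in>F. rayleigh \<Omega> p u)" .
qed

end

end

section \<open>The domains as subgraphs\<close>

text \<open>
  The distance of a coordinate to the grid of multiples of \<open>w\<close>. On the cell with centre \<open>c\<close>
  it is \<open>w/2 - |t - c|\<close>, the profile of a pyramid, and as a distance it is Lipschitz without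
  a discussion of cells.
\<close>

definition grid_dist :: "real \<Rightarrow> real \<Rightarrow> real" where
  "grid_dist w t = infdist t (range (\<lambda>k::int. w * of_int k))"

lemma grid_dist_nonneg: "0 \<le> grid_dist w t"
  by (simp add: grid_dist_def infdist_nonneg)

lemma grid_dist_lip: "\<bar>grid_dist w s - grid_dist w t\<bar> \<le> \<bar>s - t\<bar>"
  unfolding grid_dist_def using infdist_triangle_abs[of s _ t] by (simp add: dist_real_def)

lemma grid_dist_le: "grid_dist w t \<le> \<bar>t - w * of_int k\<bar>"
  unfolding grid_dist_def dist_real_def[symmetric] by (intro infdist_le) auto

lemma grid_dist_le_half:
  assumes "w > 0"
  shows "grid_dist w t \<le> w / 2"
proof -
  have "\<bar>t - w * of_int (round (t / w))\<bar> = w * \<bar>of_int (round (t / w)) - t / w\<bar>"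
    using assms by (simp add: abs_mult_pos' right_diff_distrib abs_minus_commute)
  also have "\<dots> \<le> w * (1 / 2)" using assms of_int_round_abs_le by (intro mult_left_mono) auto
  finally show ?thesis using grid_dist_le[of w t "round (t / w)"] by simp
qed

lemma grid_dist_grid [simp]: "grid_dist w (w * real k) = 0"
  using grid_dist_le[of w "w * real k" "int k"] grid_dist_nonneg[of w "w * real k"] by simp

lemma grid_dist_ge:
  assumes "w > 0"
  shows "w / 2 - \<bar>t - w * (1 / 2 + real i)\<bar> \<le> grid_dist w t"
proof -
  have "w / 2 - \<bar>t - w * (1 / 2 + real i)\<bar> \<le> dist t (w * of_int k)" for k :: int
  proof -
    have "1 / 2 \<le> \<bar>1 / 2 + real i - of_int k\<bar>"
    proof (cases "k \<le> int i")
      case True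
      then have "(of_int k :: real) \<le> real i" by linarith
      then show ?thesis by linarith
    next
      case False
      then have "(of_int k :: real) \<ge> real i + 1" by linarith
      then show ?thesis by linarith
    qed
    then have "w * (1 / 2) \<le> w * \<bar>1 / 2 + real i - of_int k\<bar>" using assms by (intro mult_left_mono) auto
    also have "\<dots> = \<bar>w * (1 / 2 + real i) - w * of_int k\<bar>"
      using assms by (simp add: abs_mult_pos' right_diff_distrib)
    finally show ?thesis unfolding dist_real_def by linarith
  qed
  moreover have "range (\<lambda>k::int. w * of_int k) \<noteq> {}" by simp
  ultimately show ?thesis
    unfolding grid_dist_def infdist_def by (auto intro!: cINF_greatest)
qed

lemma grid_dist_cell_le:
  assumes "w > 0" "w * real i \<le> t" "t \<le> w * real i + w"
  shows "grid_dist w t \<le> w / 2 - \<bar>t - w * (1 / 2 + real i)\<bar>"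
proof -
  have "grid_dist w t \<le> \<bar>t - w * of_int (int i)\<bar>" "grid_dist w t \<le> \<bar>t - w * of_int (int i + 1)\<bar>"
    by (rule grid_dist_le)+
  moreover have "w * of_int (int i) = w * real i" "w * of_int (int i + 1) = w * real i + w"
    "w * (1 / 2 + real i) = w * real i + w / 2" by (simp_all add: algebra_simps)
  ultimately show ?thesis using assms by linarith
qed

locale pyramid_domain =
  fixes \<alpha> \<beta> :: real and \<kappa> :: "'n :: finite" and j :: nat
  assumes card_ge: "CARD('n) \<ge> 2" and \<beta>_gt: "\<beta> > real CARD('n)"
    and \<alpha>_eq: "\<alpha> = \<beta> - real CARD('n) + 1" and j_ge: "j \<ge> 1"
begin

definition "len = 1 / real j"
definition "height = 1 / real j powr \<alpha>"
definition "width = len / real (num_div \<beta> j)"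
definition "slope = 2 * height / width"

text \<open>
  The minimum over the horizontal coordinates; a level set within a cell is the boundary of a
  cube, the horizontal section of a pyramid.
\<close>

definition tent :: "real^'n \<Rightarrow> real" where
  "tent x = Min ((\<lambda>l. grid_dist width (x $ l)) ` (- {\<kappa>}))"

definition top :: "real^'n \<Rightarrow> real" where
  "top x = len + slope * tent x"

lemma pos: "len > 0" "height > 0" "width > 0" "slope > 0" "real (num_div \<beta> j) > 0"
proof -
  show m: "real (num_div \<beta> j) > 0" unfolding of_nat_0_less_iff by (simp add: num_div_def)
  show "len > 0" "height > 0" using j_ge by (auto simp: len_def height_def)
  then show "width > 0" "slope > 0" using m by (auto simp: width_def slope_def)
qed

lemma len_eq: "width * real (num_div \<beta> j) = len"
  using pos by (simp add: width_def)

lemma height_le: "height \<le> len"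
proof -
  have "real j powr 1 \<le> real j powr \<alpha>" using j_ge \<beta>_gt \<alpha>_eq by (intro powr_mono) auto
  then show ?thesis using j_ge by (simp add: height_def len_def frac_le)
qed

lemma slope_half: "slope * (width / 2) = height"
  using pos by (simp add: slope_def)

lemma coords_nonempty: "- {\<kappa>} \<noteq> {}"
proof
  assume "- {\<kappa>} = {}"
  then have "(UNIV :: 'n set) = {\<kappa>}" by blast
  then have "CARD('n) = 1" by (metis card_1_singleton_iff One_nat_def)
  with card_ge show False by simp
qed

lemma le_tent_iff: "c \<le> tent x \<longleftrightarrow> (\<forall>l. l \<noteq> \<kappa> \<longrightarrow> c \<le> grid_dist width (x $ l))"
  unfolding tent_def using coords_nonempty by (subst Min_ge_iff) auto

lemma tent_le: "l \<noteq> \<kappa> \<Longrightarrow> tent x \<le> grid_dist width (x $ l)"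
  using le_tent_iff[of "tent x" x] by auto

lemma tent_lip:
  assumes "\<And>l. l \<noteq> \<kappa> \<Longrightarrow> \<bar>x $ l - y $ l\<bar> \<le> t"
  shows "\<bar>tent x - tent y\<bar> \<le> t"
proof -
  have one: "tent x - t \<le> tent y" if "\<And>l. l \<noteq> \<kappa> \<Longrightarrow> \<bar>x $ l - y $ l\<bar> \<le> t" for x y :: "real^'n"
    unfolding le_tent_iff
  proof (intro allI impI)
    fix l assume l: "l \<noteq> \<kappa>"
    show "tent x - t \<le> grid_dist width (y $ l)"
      using tent_le[OF l, of x] grid_dist_lip[of width "x $ l" "y $ l"] that[OF l] by linarith
  qed
  have "\<bar>y $ l - x $ l\<bar> \<le> t" if "l \<noteq> \<kappa>" for l using assms[OF that] by linarith
  from one[OF assms] one[OF this] show ?thesis by linarith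
qed

lemma tent_nonneg: "0 \<le> tent x"
  by (simp add: le_tent_iff grid_dist_nonneg)

lemma tent_le_half: "tent x \<le> width / 2"
proof -
  obtain l where "l \<noteq> \<kappa>" using coords_nonempty by blast
  then show ?thesis using tent_le grid_dist_le_half[OF pos(3)] order_trans by blast
qed

lemma top_lip:
  assumes "0 \<le> t" "\<And>l. l \<noteq> \<kappa> \<Longrightarrow> \<bar>x $ l - y $ l\<bar> \<le> t"
  shows "\<bar>top x - top y\<bar> \<le> slope * t"
proof -
  have "\<bar>top x - top y\<bar> = slope * \<bar>tent x - tent y\<bar>"
    using pos(4) by (simp add: top_def abs_mult_pos' right_diff_distrib)
  also have "\<dots> \<le> slope * t" using tent_lip[OF assms(2)] pos(4) by (intro mult_left_mono) auto
  finally show ?thesis .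
qed

lemma continuous_top: "continuous_on UNIV top"
  by (rule coordinate_lipschitz_continuous[OF less_imp_le[OF pos(4)] top_lip])

lemma top_ge: "len \<le> top x"
  using pos(4) tent_nonneg[of x] by (simp add: top_def)

lemma top_le: "top x \<le> len + height"
proof -
  have "slope * tent x \<le> slope * (width / 2)" using pos(4) tent_le_half by (intro mult_left_mono) auto
  then show ?thesis unfolding slope_half by (simp add: top_def)
qed

lemma top_edge:
  assumes "l \<noteq> \<kappa>" "x $ l = 0 \<or> x $ l = len"
  shows "top x = len"
proof -
  have "grid_dist width (x $ l) = 0"
    using assms(2) grid_dist_grid[of width 0] grid_dist_grid[of width "num_div \<beta> j"] len_eq by auto
  then have "tent x = 0" using tent_le[OF assms(1), of x] tent_nonneg[of x] by simp
  then show ?thesis by (simp add: top_def)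
qed

lemma le_top_iff: "len + s \<le> top x \<longleftrightarrow> (\<forall>l. l \<noteq> \<kappa> \<longrightarrow> s \<le> slope * grid_dist width (x $ l))"
proof -
  have "len + s \<le> top x \<longleftrightarrow> s / slope \<le> tent x"
    using pos(4) by (simp add: top_def divide_le_eq mult.commute)
  also have "\<dots> \<longleftrightarrow> (\<forall>l. l \<noteq> \<kappa> \<longrightarrow> s / slope \<le> grid_dist width (x $ l))" by (rule le_tent_iff)
  finally show ?thesis using pos(4) by (simp add: divide_le_eq mult.commute)
qed

lemma centre_eq: "centre \<beta> j i = width * (1 / 2 + real i)"
  by (simp add: centre_def width_def len_def)

lemma half_width_eq: "1 / (2 * real j * real (num_div \<beta> j)) = width / 2"
  by (simp add: width_def len_def)

lemma cube_eq: "cube j = open_cube len"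
  by (simp add: cube_def open_cube_def len_def)

lemma closure_cube: "closure (cube j) = {x :: real^'n. \<forall>l. 0 \<le> x $ l \<and> x $ l \<le> len}"
proof -
  have "box 0 (\<chi> l. len) \<noteq> ({} :: (real^'n) set)" using pos(1) by (simp add: interval_ne_empty_cart)
  then have "closure (cube j) = cbox 0 (\<chi> l. len :: real^'n)"
    unfolding cube_eq open_cube_eq_box by (rule closure_box)
  then show ?thesis by (auto simp: mem_box_cart)
qed

text \<open>
  The pyramid over a cell, described by the inequalities of its lateral faces and of its
  base.
\<close>

definition cone :: "('n \<Rightarrow> nat) \<Rightarrow> (real^'n) set" where
  "cone i = {x. len \<le> x $ \<kappa> \<and>
     (\<forall>l. l \<noteq> \<kappa> \<longrightarrow> \<bar>x $ l - centre \<beta> j (i l)\<bar> \<le> width / 2 - (x $ \<kappa> - len) / slope)}"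

lemma convex_cone: "convex (cone i)"
proof (rule convexI)
  fix x y and u v :: real
  assume x: "x \<in> cone i" and y: "y \<in> cone i" and uv: "0 \<le> u" "0 \<le> v" "u + v = 1"
  let ?z = "u *\<^sub>R x + v *\<^sub>R y"
  have v: "v = 1 - u" using uv by simp
  have "u * len + v * len \<le> u * x $ \<kappa> + v * y $ \<kappa>"
    using x y uv by (intro add_mono mult_left_mono) (auto simp: cone_def)
  then have 1: "len \<le> ?z $ \<kappa>" by (simp add: v algebra_simps)
  have 2: "\<bar>?z $ l - centre \<beta> j (i l)\<bar> \<le> width / 2 - (?z $ \<kappa> - len) / slope" if l: "l \<noteq> \<kappa>" for l
  proof -
    let ?c = "centre \<beta> j (i l)"
    have "?z $ l - ?c = u * (x $ l - ?c) + v * (y $ l - ?c)" by (simp add: v algebra_simps)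
    then have "\<bar>?z $ l - ?c\<bar> \<le> u * \<bar>x $ l - ?c\<bar> + v * \<bar>y $ l - ?c\<bar>"
      using uv abs_triangle_ineq[of "u * (x $ l - ?c)" "v * (y $ l - ?c)"] by (simp add: abs_mult)
    also have "\<dots> \<le> u * (width / 2 - (x $ \<kappa> - len) / slope) + v * (width / 2 - (y $ \<kappa> - len) / slope)"
      using x y uv l by (intro add_mono mult_left_mono) (auto simp: cone_def)
    also have "\<dots> = width / 2 - (?z $ \<kappa> - len) / slope"
      using pos(4) by (simp add: v field_simps)
    finally show ?thesis .
  qed
  show "?z \<in> cone i" using 1 2 by (simp add: cone_def)
qed

lemma closed_cone: "closed (cone i)"
  unfolding cone_def
  by (intro closed_Collect_conj closed_Collect_all closed_Collect_imp closed_Collect_le open_Collect_const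
      continuous_intros) (use pos(4) in auto)

lemma closed_pyramid_subset_cone: "closed_pyramid \<alpha> \<beta> \<kappa> j i \<subseteq> cone i"
  unfolding closed_pyramid_def
proof (rule hull_minimal)
  have "pyramid_base \<beta> \<kappa> j i \<subseteq> cone i"
  proof
    fix x assume "x \<in> pyramid_base \<beta> \<kappa> j i"
    then have x: "x $ \<kappa> = len" "\<And>l. l \<noteq> \<kappa> \<Longrightarrow> centre \<beta> j (i l) - width / 2 < x $ l \<and> x $ l < centre \<beta> j (i l) + width / 2"
      unfolding pyramid_base_def half_width_eq by (auto simp: len_def)
    have "\<bar>x $ l - centre \<beta> j (i l)\<bar> \<le> width / 2" if "l \<noteq> \<kappa>" for l using x(2)[OF that] by linarith
    then show "x \<in> cone i" using x(1) by (simp add: cone_def)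
  qed
  then have "closure (pyramid_base \<beta> \<kappa> j i) \<subseteq> cone i" by (rule closure_minimal) (rule closed_cone)
  moreover have "pyramid_vertex \<alpha> \<beta> \<kappa> j i \<in> cone i"
  proof -
    have "height / slope = width / 2" using pos by (simp add: slope_def)
    then show ?thesis using pos(2) by (simp add: cone_def pyramid_vertex_def len_def[symmetric] height_def[symmetric])
  qed
  ultimately show "insert (pyramid_vertex \<alpha> \<beta> \<kappa> j i) (closure (pyramid_base \<beta> \<kappa> j i)) \<subseteq> cone i" by blast
qed (rule convex_cone)

definition closed_region :: "(real^'n) set" where
  "closed_region = {x. (\<forall>l. l \<noteq> \<kappa> \<longrightarrow> 0 \<le> x $ l \<and> x $ l \<le> len) \<and> 0 \<le> x $ \<kappa> \<and> x $ \<kappa> \<le> top x}"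

definition open_region :: "(real^'n) set" where
  "open_region = {x. (\<forall>l. l \<noteq> \<kappa> \<longrightarrow> 0 < x $ l \<and> x $ l < len) \<and> 0 < x $ \<kappa> \<and> x $ \<kappa> < top x}"

lemma closed_closed_region: "closed closed_region"
  unfolding closed_region_def
  by (intro closed_Collect_conj closed_Collect_all closed_Collect_imp closed_Collect_le open_Collect_const
      continuous_intros continuous_top)

lemma open_open_region: "open open_region"
proof -
  have "open_region = (\<Inter>l\<in>- {\<kappa>}. {x. 0 < x $ l} \<inter> {x. x $ l < len}) \<inter> {x. 0 < x $ \<kappa>} \<inter> {x. x $ \<kappa> < top x}"
    by (auto simp: open_region_def)
  then show ?thesis
    by (auto intro!: open_Int open_INT open_Collect_less continuous_intros continuous_top)
qed

text \<open>
  Half the width minus the distance to the centre of a cell is a lower bound for the distance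
  to the grid, also for coordinates outside of the cell.
\<close>

lemma cone_subset_closed_region:
  assumes i: "\<And>l. l \<noteq> \<kappa> \<Longrightarrow> i l < num_div \<beta> j"
  shows "cone i \<subseteq> closed_region"
proof
  fix x assume "x \<in> cone i"
  then have x: "len \<le> x $ \<kappa>" "\<And>l. l \<noteq> \<kappa> \<Longrightarrow> \<bar>x $ l - width * (1 / 2 + real (i l))\<bar> \<le> width / 2 - (x $ \<kappa> - len) / slope"
    by (auto simp: cone_def centre_eq)
  have q: "0 \<le> (x $ \<kappa> - len) / slope" using x(1) pos(4) by simp
  have "0 \<le> x $ l \<and> x $ l \<le> len" if l: "l \<noteq> \<kappa>" for l
  proof -
    define a where "a = width * real (i l)"
    have "real (i l) + 1 \<le> real (num_div \<beta> j)" using i[OF l] by simp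
    then have "width * (real (i l) + 1) \<le> len"
      unfolding len_eq[symmetric] using pos(3) by (intro mult_left_mono) auto
    then have 1: "a + width \<le> len" by (simp add: a_def algebra_simps)
    have 2: "0 \<le> a" using pos(3) by (simp add: a_def)
    have "width * (1 / 2 + real (i l)) = a + width / 2" by (simp add: a_def algebra_simps)
    then have "\<bar>x $ l - (a + width / 2)\<bar> \<le> width / 2 - (x $ \<kappa> - len) / slope" using x(2)[OF l] by simp
    with 1 2 q show ?thesis by linarith
  qed
  moreover have "len + (x $ \<kappa> - len) \<le> top x"
    unfolding le_top_iff
  proof (intro allI impI)
    fix l assume l: "l \<noteq> \<kappa>"
    have "(x $ \<kappa> - len) / slope \<le> grid_dist width (x $ l)"
      using x(2)[OF l] grid_dist_ge[OF pos(3), of "x $ l" "i l"] by linarith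
    then show "x $ \<kappa> - len \<le> slope * grid_dist width (x $ l)"
      using pos(4) by (simp add: divide_le_eq mult.commute)
  qed
  ultimately show "x \<in> closed_region" using x(1) pos(1) by (auto simp: closed_region_def)
qed

lemma closure_Omega_subset: "closure (Omega \<alpha> \<beta> \<kappa> j) \<subseteq> closed_region"
proof (rule closure_minimal[OF _ closed_closed_region])
  have "closure (cube j) \<subseteq> closed_region"
    unfolding closure_cube closed_region_def using top_ge order_trans by blast
  moreover have "closed_pyramid \<alpha> \<beta> \<kappa> j i \<subseteq> closed_region" if "\<forall>l. l \<noteq> \<kappa> \<longrightarrow> i l < num_div \<beta> j" for i
    using closed_pyramid_subset_cone[of i] cone_subset_closed_region[of i] that by blast
  ultimately show "Omega \<alpha> \<beta> \<kappa> j \<subseteq> closed_region"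
    unfolding Omega_def using interior_subset by blast
qed

text \<open>
  A point above the level of the cube belongs to the pyramid over its own cell: it divides
  the segment from the vertex to some point \<open>y\<close> of the base in the ratio given by its height.
  The inequality \<open>x $ \<kappa> < top x\<close> says precisely that \<open>y\<close> is interior to the base.
\<close>

lemma open_region_subset: "open_region \<subseteq> Omega \<alpha> \<beta> \<kappa> j"
  unfolding Omega_def
proof (rule interior_maximal[OF _ open_open_region], rule subsetI)
  fix x assume "x \<in> open_region"
  then have x: "\<And>l. l \<noteq> \<kappa> \<Longrightarrow> 0 < x $ l \<and> x $ l < len" "0 < x $ \<kappa>" "x $ \<kappa> < top x"
    by (auto simp: open_region_def)
  show "x \<in> closure (cube j) \<union> (\<Union>i\<in>{i. \<forall>l. l \<noteq> \<kappa> \<longrightarrow> i l < num_div \<beta> j}. closed_pyramid \<alpha> \<beta> \<kappa> j i)"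
  proof (cases "x $ \<kappa> \<le> len")
    case True
    have "0 \<le> x $ l \<and> x $ l \<le> len" for l
      using x(1)[of l] x(2) True by (cases "l = \<kappa>") auto
    then show ?thesis by (simp add: closure_cube)
  next
    case False
    define i where "i l = nat \<lfloor>x $ l / width\<rfloor>" for l
    have il: "i l < num_div \<beta> j" if "l \<noteq> \<kappa>" for l
    proof -
      have "x $ l / width < real (num_div \<beta> j)"
        using x(1)[OF that] pos(3) len_eq by (simp add: divide_less_eq mult.commute)
      then show ?thesis
        unfolding i_def using x(1)[OF that] pos(3) by (simp add: nat_less_iff floor_less_iff)
    qed
    \<comment> \<open>the height above the base relative to the height of the pyramid\<close>
    define s where "s = (x $ \<kappa> - len) / height"
    have s0: "s > 0" using False pos(2) by (simp add: s_def)
    have xk: "x $ \<kappa> = len + s * height" using pos(2) by (simp add: s_def)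
    have d: "\<bar>x $ l - centre \<beta> j (i l)\<bar> < (1 - s) * (width / 2)" if l: "l \<noteq> \<kappa>" for l
    proof -
      have "s * height < slope * tent x" using x(3) unfolding xk top_def by simp
      also have "\<dots> \<le> slope * grid_dist width (x $ l)"
        using tent_le[OF l] pos(4) by (intro mult_left_mono) auto
      finally have "slope * (s * (width / 2)) < slope * grid_dist width (x $ l)"
        using slope_half by (simp add: mult.left_commute)
      then have "s * (width / 2) < grid_dist width (x $ l)" using pos(4) by (simp only: mult_less_cancel_left_pos)
      moreover have "grid_dist width (x $ l) \<le> width / 2 - \<bar>x $ l - centre \<beta> j (i l)\<bar>"
        unfolding centre_eq
      proof (rule grid_dist_cell_le[OF pos(3)])
        have "0 \<le> x $ l" using x(1)[OF l] by simp
        from nat_floor_bounds[OF this pos(3)]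
        show "width * real (i l) \<le> x $ l" "x $ l \<le> width * real (i l) + width"
          by (auto simp: i_def mult.commute)
      qed
      ultimately show ?thesis by (simp add: left_diff_distrib)
    qed
    have s1: "s < 1"
    proof -
      obtain l where "l \<noteq> \<kappa>" using coords_nonempty by blast
      from d[OF this] have "0 < (1 - s) * (width / 2)" by (rule le_less_trans[OF abs_ge_zero])
      then show ?thesis using pos(3) by (simp add: zero_less_mult_iff)
    qed
    define y where "y = (\<chi> l. if l = \<kappa> then len else centre \<beta> j (i l) + (x $ l - centre \<beta> j (i l)) / (1 - s))"
    let ?v = "pyramid_vertex \<alpha> \<beta> \<kappa> j i"
    have "y \<in> pyramid_base \<beta> \<kappa> j i"
    proof -
      have q: "\<bar>(x $ l - centre \<beta> j (i l)) / (1 - s)\<bar> < width / 2" if "l \<noteq> \<kappa>" for l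
        using d[OF that] s1 by (simp add: divide_less_eq mult.commute)
      have "centre \<beta> j (i l) - width / 2 < y $ l \<and> y $ l < centre \<beta> j (i l) + width / 2" if "l \<noteq> \<kappa>" for l
        using that
        by (simp only: y_def vec_lambda_beta if_False) (intro conjI; use q[OF that] in linarith)
      moreover have "y $ \<kappa> = 1 / real j" by (simp add: y_def len_def)
      ultimately show ?thesis unfolding pyramid_base_def half_width_eq by blast
    qed
    then have y: "y \<in> closure (pyramid_base \<beta> \<kappa> j i)" using closure_subset by blast
    have "(1 - s) *\<^sub>R y + s *\<^sub>R ?v = x"
    proof (rule vec_eq_iff[THEN iffD2], rule allI)
      fix l
      show "((1 - s) *\<^sub>R y + s *\<^sub>R ?v) $ l = x $ l"
      proof (cases "l = \<kappa>")
        case True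
        then show ?thesis
          using xk by (simp add: y_def pyramid_vertex_def len_def[symmetric] height_def[symmetric] algebra_simps)
      next
        case False
        then have "((1 - s) *\<^sub>R y + s *\<^sub>R ?v) $ l =
          (1 - s) * centre \<beta> j (i l) + (1 - s) * ((x $ l - centre \<beta> j (i l)) / (1 - s)) + s * centre \<beta> j (i l)"
          by (simp add: y_def pyramid_vertex_def distrib_left)
        also have "(1 - s) * ((x $ l - centre \<beta> j (i l)) / (1 - s)) = x $ l - centre \<beta> j (i l)"
          using s1 by simp
        finally show ?thesis by (simp add: algebra_simps)
      qed
    qed
    moreover have "(1 - s) *\<^sub>R y + s *\<^sub>R ?v \<in> closed_pyramid \<alpha> \<beta> \<kappa> j i"
      unfolding closed_pyramid_def using s0 s1 y
      by (intro convexD_alt[OF convex_convex_hull] hull_inc) auto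
    ultimately have "x \<in> closed_pyramid \<alpha> \<beta> \<kappa> j i" by simp
    then show ?thesis using il by blast
  qed
qed

lemma bounded_Omega: "bounded (Omega \<alpha> \<beta> \<kappa> j)"
proof (rule bounded_subset[OF bounded_cbox])
  show "Omega \<alpha> \<beta> \<kappa> j \<subseteq> cbox 0 (\<chi> l. 2 * len)"
  proof
    fix x assume "x \<in> Omega \<alpha> \<beta> \<kappa> j"
    then have x: "x \<in> closed_region" using closure_Omega_subset closure_subset by blast
    have "0 \<le> x $ l \<and> x $ l \<le> 2 * len" for l
      using x top_le[of x] height_le pos(1) by (cases "l = \<kappa>") (force simp: closed_region_def)+
    then show "x \<in> cbox 0 (\<chi> l. 2 * len)" by (simp add: mem_box_cart)
  qed
qed

lemma subgraph_domain_Omega: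
  assumes "p > 1"
  shows "subgraph_domain (Omega \<alpha> \<beta> \<kappa> j) p \<kappa> len slope top"
proof (unfold_locales)
  show "open (Omega \<alpha> \<beta> \<kappa> j)" by (simp add: Omega_def)
  show "bounded (Omega \<alpha> \<beta> \<kappa> j)" by (rule bounded_Omega)
  show "top x \<le> 2 * len" for x using top_le[of x] height_le by simp
  show "\<bar>top x - top y\<bar> \<le> slope * t" if "0 \<le> t" "\<And>l. l \<noteq> \<kappa> \<Longrightarrow> \<bar>x $ l - y $ l\<bar> \<le> t" for x y t
    by (rule top_lip[OF that])
  show "{x. (\<forall>l. l \<noteq> \<kappa> \<longrightarrow> 0 < x $ l \<and> x $ l < len) \<and> 0 < x $ \<kappa> \<and> x $ \<kappa> < top x} \<subseteq> Omega \<alpha> \<beta> \<kappa> j"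
    using open_region_subset by (simp add: open_region_def)
  show "closure (Omega \<alpha> \<beta> \<kappa> j) \<subseteq> {x. (\<forall>l. l \<noteq> \<kappa> \<longrightarrow> 0 \<le> x $ l \<and> x $ l \<le> len) \<and> 0 \<le> x $ \<kappa> \<and> x $ \<kappa> \<le> top x}"
    using closure_Omega_subset by (simp add: closed_region_def)
  show "top x = len" if "l \<noteq> \<kappa>" "x $ l = 0 \<or> x $ l = len" for x l by (rule top_edge[OF that])
qed (use assms pos top_ge in auto)

text \<open>
  The slope is \<open>2 j\<^bsup>-\<alpha>\<^esup> / width\<close> with \<open>1 / width = j m(j) \<le> 2 j\<^bsup>\<beta>\<^esup>\<close>, and \<open>\<beta> - \<alpha> = n - 1\<close>.
\<close>

lemma slope_le: "slope + 1 \<le> 5 * real j powr (real CARD('n) - 1)"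
proof -
  have j1: "real j \<ge> 1" using j_ge by simp
  have "real (num_div \<beta> j) \<le> real j powr (\<beta> - 1) + 1" by (simp add: num_div_def)
  also have "\<dots> \<le> 2 * real j powr (\<beta> - 1)"
    using ge_one_powr_ge_zero[OF j1, of "\<beta> - 1"] \<beta>_gt card_ge by simp
  finally have m: "real (num_div \<beta> j) \<le> 2 * real j powr (\<beta> - 1)" .
  have "slope = 2 * (real j powr (- \<alpha>) * (real j powr 1 * real (num_div \<beta> j)))"
    using j1 by (simp add: slope_def height_def width_def len_def powr_minus divide_inverse)
  also have "\<dots> \<le> 2 * (real j powr (- \<alpha>) * (real j powr 1 * (2 * real j powr (\<beta> - 1))))"
    by (intro mult_left_mono m) auto
  also have "\<dots> = 4 * real j powr (- \<alpha> + (1 + (\<beta> - 1)))"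
  proof -
    have "2 * (a * (b * (2 * c))) = 4 * (a * (b * c))" for a b c :: real by simp
    then show ?thesis by (simp only: powr_add)
  qed
  also have "- \<alpha> + (1 + (\<beta> - 1)) = real CARD('n) - 1" by (simp add: \<alpha>_eq)
  finally show ?thesis
    using ge_one_powr_ge_zero[OF j1, of "real CARD('n) - 1"] card_ge by simp
qed

end

lemma trace_const_pos: "n > 0 \<Longrightarrow> trace_const n p > 0"
  unfolding trace_const_def graph_const_def by (intro mult_pos_pos add_pos_nonneg) auto

theorem theorem4p1:
  fixes p :: real
  assumes "CARD('n::finite) \<ge> 2"
    and "p > real CARD('n)"
  shows "\<exists>C>0. \<forall>\<alpha> \<beta> :: real. \<forall>\<kappa> :: 'n. \<forall>j::nat.
           \<alpha> > 0 \<longrightarrow> \<beta> > 0 \<longrightarrow> \<beta> > real CARD('n) \<longrightarrow> \<alpha> = \<beta> - real CARD('n) + 1 \<longrightarrow> j \<ge> 1 \<longrightarrow>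
           steklov_eigenvalue (Omega \<alpha> \<beta> \<kappa> j) p 2 \<ge> ennreal (C * real j powr (p - real CARD('n)))"
proof -
  let ?n = "real CARD('n)"
  \<comment> \<open>the factor 5 is that of \<open>slope_le\<close>, and \<open>8\<^sup>p\<close> that of the passage to the limit\<close>
  define A where "A = 8 powr p * (trace_const CARD('n) p * 5)"
  have t: "trace_const CARD('n) p > 0" by (rule trace_const_pos) simp
  then have A: "A > 0" by (simp add: A_def)
  have p: "p > 1" using assms by linarith
  show ?thesis
  proof (intro exI[of _ "1 / A"] conjI allI impI)
    show "1 / A > 0" using A by simp
    fix \<alpha> \<beta> :: real and \<kappa> :: 'n and j :: nat
    assume "\<beta> > ?n" "\<alpha> = \<beta> - ?n + 1" "j \<ge> 1"
    then interpret P: pyramid_domain \<alpha> \<beta> \<kappa> j using assms(1) by unfold_locales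
    interpret S: subgraph_domain "Omega \<alpha> \<beta> \<kappa> j" p \<kappa> P.len P.slope P.top
      by (rule P.subgraph_domain_Omega[OF p])
    have j: "real j \<ge> 1" using \<open>j \<ge> 1\<close> by simp
    define T where "T = trace_const CARD('n) p * 5 * real j powr (?n - p)"
    have T: "trace_const CARD('n) p * (P.slope + 1) * P.len powr (p - 1) \<le> T"
    proof -
      have "P.len powr (p - 1) = real j powr (1 - p)"
        using j by (simp add: P.len_def powr_divide powr_minus_divide[symmetric])
      then have "trace_const CARD('n) p * (P.slope + 1) * P.len powr (p - 1) \<le>
          trace_const CARD('n) p * (5 * real j powr (?n - 1)) * real j powr (1 - p)"
        using t P.slope_le by (simp only:) (intro mult_right_mono mult_left_mono, auto)
      also have "\<dots> = trace_const CARD('n) p * 5 * real j powr ((?n - 1) + (1 - p))"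
        by (simp only: powr_add mult.assoc)
      finally show ?thesis by (simp add: T_def)
    qed
    have "T > 0" using t j by (simp add: T_def)
    from S.steklov_eigenvalue_ge[OF T this]
    have "ennreal (1 / (8 powr p * T)) \<le> steklov_eigenvalue (Omega \<alpha> \<beta> \<kappa> j) p 2" .
    moreover have "1 / (8 powr p * T) = 1 / A * real j powr (p - ?n)"
    proof -
      have "8 powr p * T = A * real j powr (- (p - ?n))" by (simp add: T_def A_def mult.assoc)
      then show ?thesis unfolding powr_minus by (simp add: divide_inverse)
    qed
    ultimately show "ennreal (1 / A * real j powr (p - ?n)) \<le> steklov_eigenvalue (Omega \<alpha> \<beta> \<kappa> j) p 2" by simp
  qed
qed

end
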